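(* Let $k,d$ be positive integers with $d\ge2$, or $d=k=1$, and let $b_{k,d}\in L^1(\mathbb{R}^d)$ be the radial kernel of the factorization operator $M_k$, i.e. the function such that $R_P^1 f=b_{k,d}*R_Pf$ for every $P\in\mathcal{H}_k^d$ and $f\in L^2(\mathbb{R}^d)$. Then its Fourier transform satisfies $$|\widehat{b_{k,d}}(\xi)|\le1,\qquad \xi\in\mathbb{R}^d.$$ Consequently, the operator $M_kf=b_{k,d}*f$ is a contraction on $L^2(\mathbb{R}^d)$, and for all $P\in\mathcal{H}_k^d$, all $t>0$ and all $f\in L^2(\mathbb{R}^d)$, $$\|R_P^tf\|_{L^2(\mathbb{R}^d)}\le\|R_Pf\|_{L^2(\mathbb{R}^d)}.$$
   Context: Let $k,d$ be positive integers. $\mathcal{H}_k^d$ denotes the space of spherical harmonics of degree $k$ on $\mathbb{S}^{d-1}$, identified with the space of (complex-valued) harmonic polynomials on $\mathbb{R}^d$ that are homogeneous of degree $k$. We only consider pairs $(k,d)$ for which $\mathcal{H}_k^d\ne\{0\}$, i.e. $d\ge 2$, or $d=k=1$. The Fourier transform is $\widehat f(\xi)=\int_{\mathbb{R}^d} f(x)e^{-2\pi i x\cdot\xi}\,dx$. For $P\in\mathcal{H}_k^d$ and $t>0$, the truncated Riesz transform is $$R_P^t f(x)=\gamma_{k,d}\int_{|y|>t}\frac{P(y)}{|y|^{d+k}}f(x-y)\,dy,\qquad \gamma_{k,d}=\frac{\Gamma(\frac{k+d}{2})}{\pi^{d/2}\Gamma(\frac k2)},$$ and the Riesz transform of order $k$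 is $R_Pf=\lim_{t\to0^+}R_P^tf$ (for $f\in L^2(\mathbb{R}^d)$ the limit exists in $L^2$ and a.e.); $R_P$ is the Fourier multiplier operator with multiplier $(-i)^kP(\xi/|\xi|)$. It is known that there is a unique function $b_{k,d}\in L^1(\mathbb{R}^d)$, which is real-valued and radial and does not depend on $P$, such that, with $b_{k,d}^t(x)=t^{-d}b_{k,d}(x/t)$, one has $R_P^tf=b_{k,d}^t*(R_Pf)$ for all $P\in\mathcal{H}_k^d$, $t>0$ and $f\in L^2(\mathbb{R}^d)$. *)

theory Defs
  imports "HOL-Analysis.Analysis"
begin

text \<open>
  Throughout, the space \<open>\<real>\<^sup>d\<close> is a type \<open>'a\<close> of class \<open>euclidean_space\<close> with \<open>d = DIM('a)\<close>.
  Elements of \<open>L\<^sup>2\<close> and \<open>L\<^sup>1\<close> are represented by Borel functions; identities between such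
  elements are stated almost everywhere.
\<close>

definition partial_deriv :: "'a::euclidean_space \<Rightarrow> ('a \<Rightarrow> complex) \<Rightarrow> 'a \<Rightarrow> complex" where
  "partial_deriv b f x = vector_derivative (\<lambda>t. f (x + t *\<^sub>R b)) (at 0)"

definition laplacian :: "('a::euclidean_space \<Rightarrow> complex) \<Rightarrow> 'a \<Rightarrow> complex" where
  "laplacian f x = (\<Sum>b\<in>Basis. partial_deriv b (partial_deriv b f) x)"

definition spherical_harmonics :: "nat \<Rightarrow> ('a::euclidean_space \<Rightarrow> complex) set" where
  "spherical_harmonics k =
     {P. polynomial_function P \<and> (\<forall>c x. P (c *\<^sub>R x) = c ^ k *\<^sub>R P x) \<and> (\<forall>x. laplacian P x = 0)}"

definition L2 :: "('a::euclidean_space \<Rightarrow> complex) set" where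
  "L2 = {f. f \<in> borel_measurable lborel \<and> integrable lborel (\<lambda>x. (norm (f x))\<^sup>2)}"

text \<open>Only meaningful on \<open>L2\<close>: the Bochner integral of a non-integrable function is \<open>0\<close>.\<close>

definition L2_norm :: "('a::euclidean_space \<Rightarrow> complex) \<Rightarrow> real" where
  "L2_norm f = sqrt (LINT x|lborel. (norm (f x))\<^sup>2)"

definition L2_limit ::
    "('i \<Rightarrow> 'a::euclidean_space \<Rightarrow> complex) \<Rightarrow> ('a \<Rightarrow> complex) \<Rightarrow> 'i filter \<Rightarrow> bool" where
  "L2_limit F g A \<longleftrightarrow> (\<forall>\<^sub>F i in A. F i \<in> L2) \<and> g \<in> L2 \<and>
     ((\<lambda>i. L2_norm (\<lambda>x. F i x - g x)) \<longlongrightarrow> 0) A"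

definition fourier :: "('a::euclidean_space \<Rightarrow> complex) \<Rightarrow> 'a \<Rightarrow> complex" where
  "fourier f \<xi> = (LINT x|lborel. f x * exp (- 2 * of_real pi * \<i> * of_real (x \<bullet> \<xi>)))"

definition convolution ::
    "('a::euclidean_space \<Rightarrow> real) \<Rightarrow> ('a \<Rightarrow> complex) \<Rightarrow> 'a \<Rightarrow> complex" where
  "convolution b f x = (LINT y|lborel. of_real (b y) * f (x - y))"

definition riesz_const :: "nat \<Rightarrow> nat \<Rightarrow> real" where
  "riesz_const k d =
     Gamma ((real k + real d) / 2) / (pi powr (real d / 2) * Gamma (real k / 2))"

definition truncated_riesz ::
    "nat \<Rightarrow> ('a::euclidean_space \<Rightarrow> complex) \<Rightarrow> real \<Rightarrow> ('a \<Rightarrow> complex) \<Rightarrow> 'a \<Rightarrow> complex" where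
  "truncated_riesz k P t f x = of_real (riesz_const k DIM('a)) *
     (LINT y:{y. norm y > t}|lborel. P y / of_real (norm y ^ (DIM('a) + k)) * f (x - y))"

text \<open>
  A representative of the limit in \<open>L\<^sup>2\<close> of the truncations as \<open>t\<close> tends to \<open>0\<close> from the right;
  the limit exists for \<open>f \<in> L2\<close> and \<open>P \<in> spherical_harmonics k\<close>, \<open>k > 0\<close>, and is unique
  up to null sets.
\<close>

definition riesz_transform ::
    "nat \<Rightarrow> ('a::euclidean_space \<Rightarrow> complex) \<Rightarrow> ('a \<Rightarrow> complex) \<Rightarrow> 'a \<Rightarrow> complex" where
  "riesz_transform k P f =
     (SOME g. L2_limit (\<lambda>t. truncated_riesz k P t f) g (at_right 0))"

definition riesz_factorization_kernel :: "nat \<Rightarrow> ('a::euclidean_space \<Rightarrow> real) \<Rightarrow> bool" where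
  "riesz_factorization_kernel k b \<longleftrightarrow>
     integrable lborel b \<and>
     (\<forall>x y. norm x = norm y \<longrightarrow> b x = b y) \<and>
     (\<forall>P\<in>spherical_harmonics k. \<forall>f\<in>L2.
        AE x in lborel. truncated_riesz k P 1 f x = convolution b (riesz_transform k P f) x)"

end

(*
  For a frequency xi other than 0 choose an isotropic vector a + i a' of C^d with a parallel to xi
  (in dimension one, the real vector a) and let P(y) = (y.a + i y.a')^k, a harmonic polynomial that
  does not vanish at xi.  A Gaussian argument (the moments of P(y) exp(-l |y|^2), together with the
  Weierstrass theorem in exp(-|y|^2)) gives the Hecke-Bochner formula for P on annuli, so R_P^t has
  the multiplier C P(xi/|xi|) (c - n(2 pi t |xi|)), where n(s) is the integral of r^(k-1) j(r) over
  [0,s], j(r) = r^(-v) J_v(r), v = k + d/2 - 1, and c is the limit of n at infinity.  Applying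
  the factorization to a Gaussian, the Fourier transform of b at xi is (c - n(2 pi |xi|)) / c.

  That |c - n| <= c holds is a statement about the ODE of j, and is proved with quadratic forms in
  (n, u, u') that are monotone along the ODE: one starts at 0 at the origin, the other tends to 0 at
  infinity, and at a maximum of n the two combine to n <= 2c.

  The bound |b^| <= 1 makes convolution with b a contraction of L^2, first for bounded functions
  through Gaussian-weighted integrals of |f^|^2, then in general by Fatou's lemma.  The remaining
  claim follows by dilation.  The existence of the limit defining R_P f, which is needed there, is
  a consequence of the factorization hypothesis itself.
*)
theory Submission
  imports "HOL-Probability.Characteristic_Functions" "HOL-Real_Asymp.Real_Asymp" Defs
begin

section \<open>Monotone quadratic forms for Bessel systems\<close>

text \<open>Only the quotient (c - n) / c matters, so no normalising constant has to be evaluated;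
  the constants in front of the multiplier merely have to be nonzero. One P with P(\<xi>) nonzero
  suffices because b is the same for every P, and the Gaussian is a convenient test function because
  its Fourier transform has no zeros. Since n > 0, the bound |c - n| <= c is the single inequality n
  <= 2c. The difficulty is that the maximum of n sits at an unknown critical point, out of reach of
  expansions at 0 or at infinity, and one argument has to serve all k and d. The monotone forms
  carry sign information from both ends to that point. Dimension one needs forms of its own: u = s^k
  j behaves like s^(-(d-1)/2) at infinity, so for d >= 2 it decays and the damping coefficient e = d
  - 2 is nonnegative, while for d = 1 it is a sine and e would be -1.\<close>

lemma nonpos_of_deriv_nonneg_tendsto_0:
  fixes W :: "real \<Rightarrow> real"
  assumes W: "\<And>s. s > S \<Longrightarrow> \<exists>D. (W has_real_derivative D) (at s) \<and> D \<ge> 0"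
    and lim: "(W \<longlongrightarrow> 0) at_top" and s: "s > S"
  shows "W s \<le> 0"
proof (rule tendsto_lowerbound[OF lim])
  show "\<forall>\<^sub>F t in at_top. W s \<le> W t"
    using eventually_ge_at_top[of s]
  proof eventually_elim
    case (elim t)
    show ?case
      by (rule DERIV_nonneg_imp_nondecreasing[OF elim]) (use W s in auto)
  qed
qed auto

text \<open>Strictness comes from the initial interval of length \<delta>: W gains a positive amount
  there and keeps it, being nondecreasing up to r.\<close>

lemma pos_of_deriv_nonneg_tendsto_0:
  fixes W :: "real \<Rightarrow> real"
  assumes W: "\<And>s. 0 < s \<Longrightarrow> s < r \<Longrightarrow> (W has_real_derivative D s) (at s)"
    and nonneg: "\<And>s. 0 < s \<Longrightarrow> s < r \<Longrightarrow> D s \<ge> 0"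
    and pos: "\<And>s. 0 < s \<Longrightarrow> s < \<delta> \<Longrightarrow> D s > 0" and \<delta>: "\<delta> > 0"
    and lim: "(W \<longlongrightarrow> 0) (at_right 0)" and s: "0 < s" "s < r"
  shows "W s > 0"
proof -
  have mono: "W a \<le> W b" if "0 < a" "a \<le> b" "b < r" for a b
  proof (rule DERIV_nonneg_imp_nondecreasing[OF \<open>a \<le> b\<close>])
    fix x assume "a \<le> x" "x \<le> b"
    then show "\<exists>y. (W has_real_derivative y) (at x) \<and> 0 \<le> y"
      using that W[of x] nonneg[of x] by (intro exI[of _ "D x"]) auto
  qed
  have ge0: "W a \<ge> 0" if "0 < a" "a < r" for a
  proof (rule tendsto_upperbound[OF lim])
    show "\<forall>\<^sub>F t in at_right 0. W t \<le> W a"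
      using eventually_at_right_less[of "0::real"] eventually_at_right_real[OF \<open>a > 0\<close>]
      by eventually_elim (use mono that in auto)
  qed auto
  define b where "b = min s (\<delta>/2)"
  have b: "b > 0" "b \<le> s" "b < \<delta>" using s \<delta> by (auto simp: b_def)
  have "W (b/2) < W b"
  proof (rule DERIV_pos_imp_increasing[where f = W])
    fix x assume "b / 2 \<le> x" "x \<le> b"
    then show "\<exists>y. (W has_real_derivative y) (at x) \<and> 0 < y"
      using b s W[of x] pos[of x] by (intro exI[of _ "D x"]) auto
  qed (use b in auto)
  then show ?thesis using ge0[of "b/2"] mono[of b s] b s by auto
qed

text \<open>The derivative of C / (2 s^2) is - C / s^3, so adding this function to \<Phi> gives a
  nonincreasing function and subtracting it a nondecreasing one. This takes the place of estimating
  an improper integral; the constant C instead of C / 2 in the second claim is slack.\<close>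

lemma inverse_square_decay_of_deriv:
  fixes \<Phi> :: "real \<Rightarrow> real"
  assumes \<Phi>: "\<And>s. s \<ge> S \<Longrightarrow> (\<Phi> has_real_derivative D s) (at s)"
    and D: "\<And>s. s \<ge> S \<Longrightarrow> \<bar>D s\<bar> \<le> C / s ^ 3" and S: "S > 0"
  shows "\<exists>c. (\<Phi> \<longlongrightarrow> c) at_top"
    and "(\<Phi> \<longlongrightarrow> c) at_top \<Longrightarrow> \<bar>\<Phi> S - c\<bar> \<le> C / S\<^sup>2"
proof -
  have C: "C \<ge> 0"
  proof -
    have "0 \<le> C / S ^ 3" using D[of S] abs_ge_zero order_trans by fastforce
    then show ?thesis using S by (simp add: zero_le_divide_iff)
  qed
  have up: "\<Phi> b + C / b\<^sup>2 / 2 \<le> \<Phi> a + C / a\<^sup>2 / 2" if "S \<le> a" "a \<le> b" for a b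
  proof (rule DERIV_nonpos_imp_nonincreasing[OF \<open>a \<le> b\<close>])
    fix x assume x: "a \<le> x" "x \<le> b"
    have "((\<lambda>x. \<Phi> x + C / x\<^sup>2 / 2) has_real_derivative D x - C / x ^ 3) (at x)"
      using x that S
      by (auto intro!: derivative_eq_intros \<Phi> simp: field_simps power2_eq_square power3_eq_cube)
    moreover have "D x - C / x ^ 3 \<le> 0" using D[of x] x that by auto
    ultimately show "\<exists>y. ((\<lambda>x. \<Phi> x + C / x\<^sup>2 / 2) has_real_derivative y) (at x) \<and> y \<le> 0" by blast
  qed
  have dn: "\<Phi> a - C / a\<^sup>2 / 2 \<le> \<Phi> b - C / b\<^sup>2 / 2" if "S \<le> a" "a \<le> b" for a b
  proof (rule DERIV_nonneg_imp_nondecreasing[OF \<open>a \<le> b\<close>])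
    fix x assume x: "a \<le> x" "x \<le> b"
    have "((\<lambda>x. \<Phi> x - C / x\<^sup>2 / 2) has_real_derivative D x + C / x ^ 3) (at x)"
      using x that S
      by (auto intro!: derivative_eq_intros \<Phi> simp: field_simps power2_eq_square power3_eq_cube)
    moreover have "D x + C / x ^ 3 \<ge> 0" using D[of x] x that by auto
    ultimately show "\<exists>y. ((\<lambda>x. \<Phi> x - C / x\<^sup>2 / 2) has_real_derivative y) (at x) \<and> y \<ge> 0" by blast
  qed
  have diff: "\<bar>\<Phi> b - \<Phi> a\<bar> \<le> C / a\<^sup>2" if "S \<le> a" "a \<le> b" for a b
  proof -
    have "C / b\<^sup>2 \<ge> 0" "C / b\<^sup>2 \<le> C / a\<^sup>2" using C that S
      by (auto intro!: divide_left_mono power_mono mult_pos_pos)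
    then show ?thesis using up[OF that] dn[OF that] unfolding abs_le_iff by simp
  qed
  show "\<bar>\<Phi> S - c\<bar> \<le> C / S\<^sup>2" if "(\<Phi> \<longlongrightarrow> c) at_top"
  proof (rule tendsto_upperbound)
    show "((\<lambda>b. \<bar>\<Phi> S - \<Phi> b\<bar>) \<longlongrightarrow> \<bar>\<Phi> S - c\<bar>) at_top"
      by (intro tendsto_intros that)
    show "\<forall>\<^sub>F b in at_top. \<bar>\<Phi> S - \<Phi> b\<bar> \<le> C / S\<^sup>2"
      using eventually_ge_at_top[of S]
    proof eventually_elim
      case (elim b)
      then show ?case using diff[of S b] by (simp add: abs_minus_commute)
    qed
  qed auto
  \<comment> \<open>The limit is first found along the points S + n; the two-point estimate
    \<open>diff\<close> then extends it to real arguments.\<close>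
  have sq: "Cauchy (\<lambda>n. \<Phi> (S + real n))"
  proof (rule metric_CauchyI)
    fix \<epsilon> :: real assume \<epsilon>: "\<epsilon> > 0"
    have "((\<lambda>n. C / (S + real n)\<^sup>2) \<longlongrightarrow> 0) at_top" by real_asymp
    then have "\<forall>\<^sub>F n in at_top. C / (S + real n)\<^sup>2 < \<epsilon> / 2"
      using \<epsilon> by (intro order_tendstoD) auto
    then obtain N where N: "\<And>n. n \<ge> N \<Longrightarrow> C / (S + real n)\<^sup>2 < \<epsilon> / 2"
      by (auto simp: eventually_sequentially)
    have "dist (\<Phi> (S + real m)) (\<Phi> (S + real n)) < \<epsilon>" if "m \<ge> N" "n \<ge> N" for m n
    proof -
      have "\<bar>\<Phi> (S + real i) - \<Phi> (S + real N)\<bar> < \<epsilon> / 2" if "i \<ge> N" for i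
      proof -
        have "\<bar>\<Phi> (S + real i) - \<Phi> (S + real N)\<bar> \<le> C / (S + real N)\<^sup>2"
          by (rule diff) (use that in auto)
        also have "\<dots> < \<epsilon> / 2" using N by blast
        finally show ?thesis .
      qed
      from this[OF that(1)] this[OF that(2)] show ?thesis unfolding dist_real_def by linarith
    qed
    then show "\<exists>M. \<forall>m\<ge>M. \<forall>n\<ge>M. dist (\<Phi> (S + real m)) (\<Phi> (S + real n)) < \<epsilon>" by blast
  qed
  then obtain c where c: "(\<lambda>n. \<Phi> (S + real n)) \<longlonglongrightarrow> c"
    using Cauchy_convergent_iff convergent_def by blast
  have "\<bar>\<Phi> a - c\<bar> \<le> C / a\<^sup>2" if a: "a \<ge> S" for a
  proof (rule tendsto_upperbound)
    show "((\<lambda>n. \<bar>\<Phi> a - \<Phi> (S + real n)\<bar>) \<longlongrightarrow> \<bar>\<Phi> a - c\<bar>) sequentially"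
      by (intro tendsto_intros c)
    have "\<forall>\<^sub>F n in sequentially. real n \<ge> a" by real_asymp
    then show "\<forall>\<^sub>F n in sequentially. \<bar>\<Phi> a - \<Phi> (S + real n)\<bar> \<le> C / a\<^sup>2"
    proof eventually_elim
      case (elim n)
      then show ?case using diff[OF a, of "S + real n"] S by (simp add: abs_minus_commute)
    qed
  qed auto
  then have "\<forall>\<^sub>F a in at_top. norm (\<Phi> a - c) \<le> C / a\<^sup>2"
    by (intro eventually_mono[OF eventually_ge_at_top[of S]]) simp
  moreover have "((\<lambda>a. C / a\<^sup>2) \<longlongrightarrow> 0) at_top" by real_asymp
  ultimately have "((\<lambda>a. \<Phi> a - c) \<longlongrightarrow> 0) at_top" by (rule Lim_null_comparison)
  then show "\<exists>c. (\<Phi> \<longlongrightarrow> c) at_top" using LIM_zero_cancel by blast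
qed

text \<open>A maximum of \<open>n\<close> above both end values is a critical point; the two hypotheses on critical
  points come from monotone quadratic forms started at \<open>0\<close> and at infinity respectively.\<close>

lemma le_twice_limit_of_critical_points:
  fixes n q z A :: "real \<Rightarrow> real"
  assumes n: "\<And>s. s > 0 \<Longrightarrow> (n has_real_derivative q s) (at s)"
    and lim0: "(n \<longlongrightarrow> 0) (at_right 0)" and lim: "(n \<longlongrightarrow> c) at_top"
    and npos: "\<And>s. s > 0 \<Longrightarrow> n s > 0" and c: "c > 0"
    and max: "\<And>s. s > 0 \<Longrightarrow> q s = 0 \<Longrightarrow> (\<And>t. t > 0 \<Longrightarrow> n t \<le> n s) \<Longrightarrow> z s \<le> 0"
    and left: "\<And>s. s > 0 \<Longrightarrow> q s = 0 \<Longrightarrow> A s * (n s)\<^sup>2 + 2 * n s * z s > 0"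
    and right: "\<And>s. s > 0 \<Longrightarrow> q s = 0 \<Longrightarrow> A s > 0 \<Longrightarrow> z s \<le> 0 \<Longrightarrow> c - n s \<ge> z s / A s"
    and s: "s > 0"
  shows "n s \<le> 2 * c"
proof (rule ccontr)
  assume "\<not> n s \<le> 2 * c"
  then have ns: "n s > 2 * c" by simp
  have "\<forall>\<^sub>F t in at_top. n t < 2 * c" by (rule order_tendstoD[OF lim]) (use c in auto)
  then obtain b where b: "\<And>t. t \<ge> b \<Longrightarrow> n t < 2 * c" by (auto simp: eventually_at_top_linorder)
  have "\<forall>\<^sub>F t in at_right 0. n t < 2 * c" by (rule order_tendstoD[OF lim0]) (use c in auto)
  then obtain a where a: "a > 0" "\<And>t. 0 < t \<Longrightarrow> t < a \<Longrightarrow> n t < 2 * c"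
    by (auto simp: eventually_at_right_field)
  have sb: "s < b" "s \<ge> a" using b[of s] a(2)[of s] ns s by force+
  \<comment> \<open>To the left of a and to the right of b the function stays below 2c, hence below
    n(s), so a maximum on this compact interval is a global one and a critical point.\<close>
  have "continuous_on {a/2..b} n"
    by (rule continuous_at_imp_continuous_on) (use DERIV_isCont[OF n] a in auto)
  then obtain y where y: "y \<in> {a/2..b}" "\<And>t. t \<in> {a/2..b} \<Longrightarrow> n t \<le> n y"
    using continuous_attains_sup[of "{a/2..b}" n] sb a by auto
  have ny: "n y > 2 * c" using y(2)[of s] sb a ns by auto
  have ypos: "y > 0" using y a by auto
  have glob: "n t \<le> n y" if "t > 0" for t
    using y(2)[of t] a(2)[of t] b[of t] ny that by (cases "t \<in> {a/2..b}") (auto simp: not_le)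
  have q0: "q y = 0"
    by (rule DERIV_local_max[OF n[OF ypos] ypos]) (use glob in auto)
  have zy: "z y \<le> 0" using max[OF ypos q0] glob by auto
  have L: "A y * n y + 2 * z y > 0"
  proof -
    have "n y * (A y * n y + 2 * z y) > 0" using left[OF ypos q0] by (simp add: algebra_simps power2_eq_square)
    then show ?thesis using npos[OF ypos] by (simp add: zero_less_mult_iff)
  qed
  have Ay: "A y > 0"
  proof -
    have "A y * n y > 0" using L zy by auto
    then show ?thesis using npos[OF ypos] by (simp add: zero_less_mult_iff)
  qed
  \<comment> \<open>The two ends meet here: A n + 2 z > 0 bounds z / A from below, and c - n >= z /
    A then gives c - n > - n / 2, that is n < 2c.\<close>
  have "z y / A y > - n y / 2" using L Ay by (simp add: field_simps)
  then have "c - n y > - n y / 2" using right[OF ypos q0 Ay zy] by linarith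
  then show False using ny by auto
qed

text \<open>The second-order condition at a maximum of n: if q had positive slope at its zero y,
  then n would increase to the right of y.\<close>

lemma deriv_nonpos_at_max_of_antiderivative:
  fixes n q :: "real \<Rightarrow> real"
  assumes n: "\<And>s. s > 0 \<Longrightarrow> (n has_real_derivative q s) (at s)"
    and q: "(q has_real_derivative D) (at y)" and y: "y > 0" "q y = 0"
    and max: "\<And>t. t > 0 \<Longrightarrow> n t \<le> n y"
  shows "D \<le> 0"
proof (rule ccontr)
  assume "\<not> D \<le> 0"
  then have "D > 0" by simp
  then obtain d where d: "d > 0" "\<And>h. 0 < h \<Longrightarrow> h < d \<Longrightarrow> q (y + h) > 0"
    using DERIV_pos_inc_right[OF q] y by auto
  have "n y < n (y + d / 2)"
  proof (rule DERIV_pos_imp_increasing_open[where f = n])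
    show "y < y + d / 2" using d by auto
    show "continuous_on {y..y + d / 2} n"
      by (rule continuous_at_imp_continuous_on) (use DERIV_isCont[OF n] y in auto)
    fix x assume "y < x" "x < y + d / 2"
    then show "\<exists>z. (n has_real_derivative z) (at x) \<and> 0 < z"
      using n[of x] d(2)[of "x - y"] y d by (auto intro!: exI[of _ "q x"])
  qed
  then show False using max[of "y + d / 2"] y d by auto
qed

lemma pos_of_no_zero:
  fixes n :: "real \<Rightarrow> real"
  assumes "\<And>s. s > 0 \<Longrightarrow> isCont n s" "\<And>s. s > 0 \<Longrightarrow> n s \<noteq> 0"
    and "\<And>s. 0 < s \<Longrightarrow> s < \<delta> \<Longrightarrow> n s > 0" "\<delta> > 0" and s: "s > 0"
  shows "n s > 0"
proof (rule ccontr)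
  assume neg: "\<not> n s > 0"
  have p: "n (\<delta>/2) > 0" using assms by auto
  have sd: "\<delta> / 2 < s" using neg assms(3)[of s] s \<open>\<delta> > 0\<close> by (cases "s < \<delta>") auto
  have "\<exists>x. \<delta>/2 \<le> x \<and> x \<le> s \<and> n x = 0"
    by (rule IVT2) (use neg p sd assms(1) \<open>\<delta> > 0\<close> in \<open>auto simp: less_imp_le\<close>)
  then show False using assms by force
qed

text \<open>The one-dimensional case, with \<open>u = sin\<close> up to a factor; the strategy is the one explained at
  \<open>bessel_system_bound\<close>, with quadratic forms adapted to the opposite sign of the damping.\<close>

lemma sine_system_bound:
  fixes n u z :: "real \<Rightarrow> real"
  assumes n: "\<And>s. s > 0 \<Longrightarrow> (n has_real_derivative u s / s) (at s)"
    and u: "\<And>s. s > 0 \<Longrightarrow> (u has_real_derivative z s) (at s)"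
    and z: "\<And>s. s > 0 \<Longrightarrow> (z has_real_derivative - u s) (at s)"
    and n0: "(n \<longlongrightarrow> 0) (at_right 0)" and u0: "((\<lambda>s. u s / s) \<longlongrightarrow> l) (at_right 0)"
    and z0: "(z \<longlongrightarrow> l') (at_right 0)"
    and upos: "\<And>s. 0 < s \<Longrightarrow> s < \<delta> \<Longrightarrow> u s > 0" and \<delta>: "\<delta> > 0"
  shows "\<exists>c>0. (n \<longlongrightarrow> c) at_top \<and> (\<forall>s>0. \<bar>c - n s\<bar> \<le> c)"
proof -
  have u_lim0: "(u \<longlongrightarrow> 0) (at_right 0)"
  proof -
    have "((\<lambda>s. u s / s * s) \<longlongrightarrow> l * 0) (at_right 0)"
      by (intro tendsto_mult u0 tendsto_ident_at)
    moreover have "\<forall>\<^sub>F s in at_right 0. u s / s * s = u s"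
      using eventually_at_right_less[of "0::real"] by eventually_elim auto
    ultimately show ?thesis using Lim_transform_eventually by fastforce
  qed
  have npos0: "n s > 0" if "0 < s" "s < \<delta>" for s
    by (rule pos_of_deriv_nonneg_tendsto_0[where r = \<delta> and \<delta> = \<delta> and D = "\<lambda>s. u s / s"])
       (use that upos n n0 in \<open>auto intro: less_imp_le\<close>)
  \<comment> \<open>This is s^2 n^2 + 2 s n z - u^2 divided by s. Without the weight 1 / s the
    derivative would be 2 s n^2 + 2 n z, which has no sign; with it the cross terms cancel and two
    squares remain.\<close>
  define W where "W = (\<lambda>s. s * (n s)\<^sup>2 + 2 * n s * z s - (u s)\<^sup>2 / s)"
  have W': "(W has_real_derivative (n s)\<^sup>2 + (u s)\<^sup>2 / s\<^sup>2) (at s)" if "s > 0" for s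
    unfolding W_def using that
    by (auto intro!: derivative_eq_intros n u z) (simp add: power2_eq_square field_simps)
  have Wpos: "W s > 0" if "s > 0" for s
  proof (rule pos_of_deriv_nonneg_tendsto_0[where r = "s + 1" and W = W])
    have "((\<lambda>s. s * (n s)\<^sup>2 + 2 * n s * z s - u s * (u s / s)) \<longlongrightarrow> 0 * 0\<^sup>2 + 2 * 0 * l' - 0 * l) (at_right 0)"
      by (intro tendsto_intros n0 z0 u0 u_lim0)
    then show "(W \<longlongrightarrow> 0) (at_right 0)" by (simp add: W_def power2_eq_square)
    show "(n s)\<^sup>2 + (u s)\<^sup>2 / s\<^sup>2 > 0" if "0 < s" "s < \<delta>" for s
      using npos0[OF that] by (intro add_pos_nonneg) auto
  qed (use that W' \<delta> in auto)
  have npos: "n s > 0" if "s > 0" for s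
  proof (rule pos_of_no_zero[OF _ _ npos0 \<delta> that])
    show "n s \<noteq> 0" if "s > 0" for s
      using Wpos[OF that] that by (auto simp: W_def divide_less_0_iff)
  qed (use n DERIV_isCont in blast)
  \<comment> \<open>The energy u^2 + z^2 is conserved. It bounds u and z, but unlike in the case d
    >= 2 no decay is available.\<close>
  obtain C where C: "\<And>s. s > 0 \<Longrightarrow> (u s)\<^sup>2 + (z s)\<^sup>2 = C"
  proof
    fix s :: real assume s: "s > 0"
    show "(u s)\<^sup>2 + (z s)\<^sup>2 = (u 1)\<^sup>2 + (z 1)\<^sup>2"
    proof (rule DERIV_zero_connected_constant[of "{0<..}" "{}" "\<lambda>s. (u s)\<^sup>2 + (z s)\<^sup>2", simplified])
      show "\<forall>x\<in>{0<..}. ((\<lambda>s. (u s)\<^sup>2 + (z s)\<^sup>2) has_real_derivative 0) (at x)"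
        by (auto intro!: derivative_eq_intros u z)
      then show "continuous_on {0<..} (\<lambda>s. (u s)\<^sup>2 + (z s)\<^sup>2)"
        by (auto intro!: continuous_at_imp_continuous_on DERIV_isCont)
    qed (use s in auto)
  qed
  define M where "M = sqrt C"
  have uM: "\<bar>u s\<bar> \<le> M" and zM: "\<bar>z s\<bar> \<le> M" if "s > 0" for s
    unfolding M_def using C[OF that]
    by (auto intro!: real_le_rsqrt simp: power2_abs)
  have M0: "M \<ge> 0" using uM[of 1] by auto
  \<comment> \<open>Two integrations by parts in c - n(s), the integral of u(r) / r over r > s,
    produce the boundary terms z / s and u / s^2. The remainder is the integral of 2 u / r^3, which
    converges absolutely and is O(s^-2) although u is merely bounded.\<close>
  define \<Phi> where "\<Phi> = (\<lambda>s. n s + z s / s + u s / s\<^sup>2)"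
  have \<Phi>': "(\<Phi> has_real_derivative - 2 * u s / s ^ 3) (at s)" if "s > 0" for s
    unfolding \<Phi>_def using that
    by (auto intro!: derivative_eq_intros n u z) (simp add: power2_eq_square power3_eq_cube power4_eq_xxxx field_simps)
  have \<Phi>b: "\<bar>- 2 * u s / s ^ 3\<bar> \<le> 2 * M / s ^ 3" if "s > 0" for s
    using uM[OF that] that by (auto simp: abs_mult intro!: divide_right_mono)
  obtain c where c: "(\<Phi> \<longlongrightarrow> c) at_top"
    using inverse_square_decay_of_deriv(1)[of 1 \<Phi>, OF \<Phi>' \<Phi>b] by auto
  define T where "T = (\<lambda>s. \<Phi> s - c)"
  have T: "\<bar>T s\<bar> \<le> 2 * M / s\<^sup>2" if "s > 0" for s
    unfolding T_def
    by (rule inverse_square_decay_of_deriv(2)[OF \<Phi>' \<Phi>b that c]) (use that in auto)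
  have small: "((\<lambda>s. K / s) \<longlongrightarrow> 0) at_top" "((\<lambda>s. K / s ^ 2) \<longlongrightarrow> 0) at_top"
     "((\<lambda>s. K / s ^ 3) \<longlongrightarrow> 0) at_top" for K :: real by real_asymp+
  have ev: "\<forall>\<^sub>F s in at_top. s > (0::real)" by (rule eventually_gt_at_top)
  have nc: "(n \<longlongrightarrow> c) at_top"
  proof -
    have "((\<lambda>s. z s / s) \<longlongrightarrow> 0) at_top"
      by (rule Lim_null_comparison[OF _ small(1)[of M]])
         (use ev in eventually_elim, use zM in \<open>auto intro!: divide_right_mono\<close>)
    moreover have "((\<lambda>s. u s / s\<^sup>2) \<longlongrightarrow> 0) at_top"
      by (rule Lim_null_comparison[OF _ small(2)[of M]])
         (use ev in eventually_elim, use uM in \<open>auto intro!: divide_right_mono\<close>)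
    ultimately have "((\<lambda>s. \<Phi> s - z s / s - u s / s\<^sup>2) \<longlongrightarrow> c - 0 - 0) at_top"
      by (intro tendsto_intros c)
    then show ?thesis by (simp add: \<Phi>_def)
  qed
  have c0: "c > 0"
  proof -
    have "c \<ge> 0"
      by (rule tendsto_lowerbound[OF nc eventually_mono[OF ev]]) (use npos less_imp_le in auto)
    moreover have "c \<noteq> 0"
    proof
      \<comment> \<open>Then n = O(1 / s), which would make the nondecreasing W tend to 0 at
        infinity although W > 0.\<close>
      assume "c = 0"
      have nb: "\<bar>n s\<bar> \<le> 4 * M / s" if "s \<ge> 1" for s
      proof -
        have "n s = T s - z s / s - u s / s\<^sup>2" by (simp add: T_def \<Phi>_def \<open>c = 0\<close>)
        then have "\<bar>n s\<bar> \<le> \<bar>T s\<bar> + \<bar>z s / s\<bar> + \<bar>u s / s\<^sup>2\<bar>" by linarith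
        also have "\<dots> \<le> 2 * M / s\<^sup>2 + M / s + M / s\<^sup>2"
          using T[of s] zM[of s] uM[of s] that by (intro add_mono) (auto intro!: divide_right_mono)
        also have "\<dots> \<le> 2 * M / s + M / s + M / s"
          using M0 that by (intro add_mono divide_left_mono) (auto simp: power2_eq_square)
        finally show ?thesis by simp
      qed
      have "(W \<longlongrightarrow> 0) at_top"
      proof (rule Lim_null_comparison)
        show "((\<lambda>s. 16 * M\<^sup>2 / s + 8 * M\<^sup>2 / s + M\<^sup>2 / s) \<longlongrightarrow> 0) at_top" by real_asymp
        show "\<forall>\<^sub>F s in at_top. norm (W s) \<le> 16 * M\<^sup>2 / s + 8 * M\<^sup>2 / s + M\<^sup>2 / s"
          using eventually_ge_at_top[of 1]
        proof eventually_elim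
          case (elim s)
          have "\<bar>s * (n s)\<^sup>2\<bar> \<le> s * (4 * M / s)\<^sup>2"
            using elim nb[OF elim] M0 by (simp add: abs_mult abs_le_square_iff[symmetric])
          moreover have "\<bar>2 * n s * z s\<bar> \<le> 2 * (4 * M / s) * M"
            using elim nb[OF elim] zM[of s] M0 unfolding abs_mult by (intro mult_mono) auto
          moreover have "\<bar>(u s)\<^sup>2 / s\<bar> \<le> M\<^sup>2 / s"
            using elim uM[of s] M0 by (auto intro!: divide_right_mono simp: abs_le_square_iff[symmetric])
          moreover have "s * (4 * M / s)\<^sup>2 = 16 * M\<^sup>2 / s" "2 * (4 * M / s) * M = 8 * M\<^sup>2 / s"
            using elim by (simp_all add: power2_eq_square field_simps)
          ultimately show ?case unfolding W_def real_norm_def by linarith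
        qed
      qed
      from nonpos_of_deriv_nonneg_tendsto_0[OF _ this, of 0 1] Wpos[of 1] W'
      show False by (force intro!: exI add_nonneg_nonneg)
    qed
    ultimately show ?thesis by simp
  qed
  \<comment> \<open>With the weight h = 2 / s^3, for which T' = - h u, this is T^2 / h - 2 T z - h
    u^2. The coefficients are chosen so that the products T u and u z cancel in the derivative; what
    is left has a sign because h decreases.\<close>
  define W2 where "W2 = (\<lambda>s. s ^ 3 / 2 * (T s)\<^sup>2 - 2 * T s * z s - 2 * (u s)\<^sup>2 / s ^ 3)"
  have T': "(T has_real_derivative - 2 * u s / s ^ 3) (at s)" if "s > 0" for s
    unfolding T_def using \<Phi>'[OF that] by (auto intro!: derivative_eq_intros)
  have W2': "(W2 has_real_derivative 3 * s\<^sup>2 / 2 * (T s)\<^sup>2 + 6 * (u s)\<^sup>2 / s ^ 4) (at s)" if "s > 0" for s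
    unfolding W2_def using that
    by (auto intro!: derivative_eq_intros T' u z) (simp add: field_simps eval_nat_numeral)
  have W2le: "W2 s \<le> 0" if "s > 0" for s
  proof (rule nonpos_of_deriv_nonneg_tendsto_0[OF _ _ that])
    show "(W2 \<longlongrightarrow> 0) at_top"
    proof (rule Lim_null_comparison)
      show "((\<lambda>s. 2 * M\<^sup>2 / s + 4 * M\<^sup>2 / s\<^sup>2 + 2 * M\<^sup>2 / s ^ 3) \<longlongrightarrow> 0) at_top" by real_asymp
      show "\<forall>\<^sub>F s in at_top. norm (W2 s) \<le> 2 * M\<^sup>2 / s + 4 * M\<^sup>2 / s\<^sup>2 + 2 * M\<^sup>2 / s ^ 3"
        using ev
      proof eventually_elim
        case (elim s)
        have "(T s)\<^sup>2 \<le> (2 * M / s\<^sup>2)\<^sup>2" using T[OF elim] M0 by (simp add: abs_le_square_iff[symmetric])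
        then have "\<bar>s ^ 3 / 2 * (T s)\<^sup>2\<bar> \<le> s ^ 3 / 2 * (2 * M / s\<^sup>2)\<^sup>2"
          using elim by (simp add: abs_mult)
        moreover have "\<bar>2 * T s * z s\<bar> \<le> 2 * (2 * M / s\<^sup>2) * M"
          using elim T[OF elim] zM[of s] M0 unfolding abs_mult by (intro mult_mono) auto
        moreover have "\<bar>2 * (u s)\<^sup>2 / s ^ 3\<bar> \<le> 2 * M\<^sup>2 / s ^ 3"
          using elim uM[of s] M0 by (auto intro!: divide_right_mono simp: abs_le_square_iff[symmetric])
        moreover have "s ^ 3 / 2 * (2 * M / s\<^sup>2)\<^sup>2 = 2 * M\<^sup>2 / s" "2 * (2 * M / s\<^sup>2) * M = 4 * M\<^sup>2 / s\<^sup>2"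
          using elim by (simp_all add: power2_eq_square power3_eq_cube field_simps)
        ultimately show ?case unfolding W2_def real_norm_def by linarith
      qed
    qed
  qed (use W2' in \<open>force intro!: exI add_nonneg_nonneg\<close>)
  have "n s \<le> 2 * c" if "s > 0" for s
  proof (rule le_twice_limit_of_critical_points[OF n n0 nc npos c0 _ _ _ that, where z = z and A = "\<lambda>s. s"])
    fix s :: real assume s: "s > 0" and "u s / s = 0"
    then have us: "u s = 0" by simp
    show "s * (n s)\<^sup>2 + 2 * n s * z s > 0" using Wpos[OF s] us by (simp add: W_def)
    show "z s / s \<le> c - n s" if "z s \<le> 0"
    proof -
      have "s ^ 3 / 2 * (T s)\<^sup>2 \<le> 2 * T s * z s" using W2le[OF s] us by (simp add: W2_def)
      have "T s \<le> 0"
      proof (rule ccontr)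
        assume "\<not> T s \<le> 0"
        then have "s ^ 3 / 2 * (T s)\<^sup>2 > 0" "2 * T s * z s \<le> 0"
          using s that by (auto intro!: mult_nonneg_nonpos)
        then show False using \<open>s ^ 3 / 2 * (T s)\<^sup>2 \<le> 2 * T s * z s\<close> by linarith
      qed
      then show ?thesis using us by (simp add: T_def \<Phi>_def)
    qed
    show "z s \<le> 0" if "\<And>t. t > 0 \<Longrightarrow> n t \<le> n s"
    proof -
      have "((\<lambda>s. u s / s) has_real_derivative z s / s) (at s)"
        using s us by (auto intro!: derivative_eq_intros u simp: field_simps)
      from deriv_nonpos_at_max_of_antiderivative[OF n this s _ that] us s
      show ?thesis by (simp add: divide_le_0_iff)
    qed
  qed auto
  then have "\<forall>s>0. \<bar>c - n s\<bar> \<le> c" using npos by (force simp: abs_le_iff)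
  then show ?thesis using c0 nc by blast
qed

text \<open>The exponent 3/2 in the proof lies between 1 and 2 on purpose. For e = 0 the derivative
  of B is close to B / s at large s, so a power above 1 is needed in the bound on B; since B
  dominates s^2 u^2 / 4 and V^2 / 2, any power below 2 still yields decay of u and of V / s.\<close>

lemma bessel_system_decay:
  fixes u V :: "real \<Rightarrow> real"
  assumes e: "e \<ge> 0" and \<kappa>: "\<kappa> \<ge> 0"
    and u: "\<And>s. s > 0 \<Longrightarrow> (u has_real_derivative (V s - e * u s) / s) (at s)"
    and V: "\<And>s. s > 0 \<Longrightarrow> (V has_real_derivative - (s\<^sup>2 - \<kappa>) * u s / s) (at s)"
  shows "(u \<longlongrightarrow> 0) at_top" "((\<lambda>s. V s / s) \<longlongrightarrow> 0) at_top"
proof -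
  \<comment> \<open>Beyond s1 the inequality s^2 >= 5 \<kappa> + (e + 3/2)^2 holds, which is what
    remains to be nonnegative once the square of V + (e + 3/2) u has been completed. The summand 1
    gives s <= s^2.\<close>
  define s1 where "s1 = 1 + 5 * \<kappa> + (e + 3/2)\<^sup>2"
  have s1: "s1 \<ge> 1" using \<kappa> by (auto simp: s1_def)
  have sq: "s\<^sup>2 \<ge> 5 * \<kappa> + (e + 3/2)\<^sup>2" if "s \<ge> s1" for s
  proof -
    have "5 * \<kappa> + (e + 3/2)\<^sup>2 \<le> s" using that by (simp add: s1_def)
    also have "s \<le> s\<^sup>2" using that s1 by (simp add: self_le_power)
    finally show ?thesis .
  qed
  \<comment> \<open>The cross term \<open>u V\<close> makes \<open>B s\<^sup>-\<^sup>3\<^sup>/\<^sup>2\<close> eventually nonincreasing, which gives decay of \<open>u\<close>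
    and not only boundedness.\<close>
  define B where "B = (\<lambda>s. (V s)\<^sup>2 + (s\<^sup>2 - \<kappa>) * (u s)\<^sup>2 + u s * V s)"
  have B': "(B has_real_derivative ((V s)\<^sup>2 + (s\<^sup>2 + \<kappa>) * (u s)\<^sup>2 - 2 * e * (s\<^sup>2 - \<kappa>) * (u s)\<^sup>2 - e * u s * V s) / s) (at s)"
    if "s > 0" for s
    unfolding B_def using that
    by (auto intro!: derivative_eq_intros u V) (simp add: power2_eq_square field_simps)
  define C where "C = B s1 * s1 powr (-3/2)"
  have B: "B s * s powr (-3/2) \<le> C" if "s \<ge> s1" for s
    unfolding C_def
  proof (rule DERIV_nonpos_imp_nonincreasing[OF that])
    fix x assume x: "s1 \<le> x" "x \<le> s"
    then have x0: "x > 0" using s1 by auto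
    let ?b = "(V x)\<^sup>2 + (x\<^sup>2 + \<kappa>) * (u x)\<^sup>2 - 2 * e * (x\<^sup>2 - \<kappa>) * (u x)\<^sup>2 - e * u x * V x"
    have "((\<lambda>s. B s * s powr (-3/2)) has_real_derivative ?b / x * x powr (-3/2) + B x * (-3/2 * x powr (-3/2 - 1))) (at x)"
      using x0 by (auto intro!: derivative_eq_intros B')
    moreover have "?b / x * x powr (-3/2) + B x * (-3/2 * x powr (-3/2 - 1)) \<le> 0"
    proof -
      have "?b - 3/2 * B x = - (V x + (e + 3/2) * u x)\<^sup>2 / 2 - (x\<^sup>2 - 5 * \<kappa> - (e + 3/2)\<^sup>2) / 2 * (u x)\<^sup>2
              - 2 * e * (x\<^sup>2 - \<kappa>) * (u x)\<^sup>2"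
        unfolding B_def by (simp add: power2_eq_square field_simps)
      also have "\<dots> \<le> 0"
      proof -
        have "(x\<^sup>2 - 5 * \<kappa> - (e + 3/2)\<^sup>2) / 2 * (u x)\<^sup>2 \<ge> 0" using sq[OF x(1)] by (intro mult_nonneg_nonneg) auto
        moreover have "x\<^sup>2 \<ge> \<kappa>" using sq[OF x(1)] \<kappa> zero_le_power2[of "e + 3/2"] by linarith
        then have "2 * e * (x\<^sup>2 - \<kappa>) * (u x)\<^sup>2 \<ge> 0" using e by (intro mult_nonneg_nonneg) auto
        moreover have "(V x + (e + 3/2) * u x)\<^sup>2 / 2 \<ge> 0" by simp
        ultimately show ?thesis by linarith
      qed
      finally have "(?b - 3/2 * B x) * (x powr (-3/2) / x) \<le> 0"
        using x0 by (intro mult_nonpos_nonneg) auto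
      moreover have "x powr (-3/2 - 1) = x powr (-3/2) / x" using x0 by (subst powr_diff) simp
      ultimately show ?thesis by (simp add: algebra_simps diff_divide_distrib add_divide_distrib)
    qed
    ultimately show "\<exists>y. ((\<lambda>s. B s * s powr (-3/2)) has_real_derivative y) (at x) \<and> y \<le> 0" by blast
  qed
  have key: "(V s)\<^sup>2 / 2 + s\<^sup>2 * (u s)\<^sup>2 / 4 \<le> C * s powr (3/2)" if "s \<ge> s1" for s
  proof -
    have s0: "s > 0" using that s1 by auto
    have "B s - ((V s)\<^sup>2 / 2 + s\<^sup>2 * (u s)\<^sup>2 / 4) = (V s + u s)\<^sup>2 / 2 + (3 * s\<^sup>2 / 4 - \<kappa> - 1/2) * (u s)\<^sup>2"
      unfolding B_def by (simp add: power2_eq_square field_simps)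
    also have "\<dots> \<ge> 0"
    proof -
      have "(e + 3/2)\<^sup>2 \<ge> (3/2)\<^sup>2" using e by (intro power_mono) auto
      then have "3 * s\<^sup>2 / 4 - \<kappa> - 1/2 \<ge> 0" using sq[OF that] \<kappa> by (simp add: power2_eq_square)
      then show ?thesis by simp
    qed
    finally have "(V s)\<^sup>2 / 2 + s\<^sup>2 * (u s)\<^sup>2 / 4 \<le> B s" by simp
    also have "B s = B s * s powr (-3/2) * s powr (3/2)" using s0 by (simp add: mult.assoc powr_add[symmetric])
    also have "\<dots> \<le> C * s powr (3/2)" using B[OF that] by (intro mult_right_mono) auto
    finally show ?thesis .
  qed
  have sqz: "((\<lambda>s. (f s)\<^sup>2) \<longlongrightarrow> 0) at_top \<Longrightarrow> (f \<longlongrightarrow> 0) at_top" for f :: "real \<Rightarrow> real"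
    using tendsto_real_sqrt[of "\<lambda>s. (f s)\<^sup>2" 0 at_top] by (simp add: tendsto_rabs_zero_iff)
  show "(u \<longlongrightarrow> 0) at_top"
  proof (rule sqz, rule Lim_null_comparison)
    show "((\<lambda>s::real. 4 * C * s powr (-1/2)) \<longlongrightarrow> 0) at_top" by real_asymp
    show "\<forall>\<^sub>F s in at_top. norm ((u s)\<^sup>2) \<le> 4 * C * s powr (-1/2)"
      using eventually_ge_at_top[of s1]
    proof eventually_elim
      case (elim s)
      have s0: "s > 0" using elim s1 by auto
      have "s powr (3/2) = s\<^sup>2 * s powr (-1/2)" using s0 by (simp add: powr_add[symmetric] powr_numeral[symmetric] del: powr_numeral)
      moreover have "s\<^sup>2 * (u s)\<^sup>2 / 4 \<le> C * s powr (3/2)" using key[OF elim] zero_le_power2[of "V s"] by linarith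
      ultimately have "s\<^sup>2 * (u s)\<^sup>2 \<le> s\<^sup>2 * (4 * C * s powr (-1/2))" by (simp add: mult_ac)
      then show ?case using s0 by simp
    qed
  qed
  show "((\<lambda>s. V s / s) \<longlongrightarrow> 0) at_top"
  proof (rule sqz, rule Lim_null_comparison)
    show "((\<lambda>s::real. 2 * C * s powr (-1/2)) \<longlongrightarrow> 0) at_top" by real_asymp
    show "\<forall>\<^sub>F s in at_top. norm ((V s / s)\<^sup>2) \<le> 2 * C * s powr (-1/2)"
      using eventually_ge_at_top[of s1]
    proof eventually_elim
      case (elim s)
      have s0: "s > 0" using elim s1 by auto
      have "s powr (3/2) = s\<^sup>2 * s powr (-1/2)" using s0 by (simp add: powr_add[symmetric] powr_numeral[symmetric] del: powr_numeral)
      moreover have "(V s)\<^sup>2 / 2 \<le> C * s powr (3/2)" 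
      proof -
        have "0 \<le> s\<^sup>2 * (u s)\<^sup>2 / 4" by simp
        then show ?thesis using key[OF elim] by linarith
      qed
      ultimately have "(V s)\<^sup>2 \<le> s\<^sup>2 * (2 * C * s powr (-1/2))" by (simp add: mult_ac)
      then show ?case using s0 by (simp add: power_divide field_simps)
    qed
  qed
qed

text \<open>
  In the variable \<open>x = ln s\<close> the system reads \<open>n' = u\<close>, \<open>u' = V - e u\<close>, \<open>V' = - Q u\<close> with \<open>Q = s\<^sup>2 - \<kappa>\<close>.
  The form \<open>W = Q n\<^sup>2 + 2 n V - u\<^sup>2\<close> is nondecreasing and starts at \<open>0\<close>, so \<open>Q n + 2 V > 0\<close> where \<open>u = 0\<close>.
  Integrating \<open>c - n = \<integral>\<^sub>x\<^sup>\<infinity> u\<close> by parts twice gives \<open>c - n = V / Q + (2 s\<^sup>2 / Q\<^sup>2) u - T\<close> with \<open>T' = - h u\<close>;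
  the form \<open>W2 = (Q / h) T\<^sup>2 - 2 T V - h u\<^sup>2\<close> is nondecreasing and tends to \<open>0\<close> at infinity, so \<open>T\<close> has the
  sign of \<open>V\<close> where \<open>u = 0\<close>. At a maximum of \<open>n\<close>, where \<open>V \<le> 0\<close>, this leaves \<open>n - c \<le> - V / Q < n / 2\<close>.
\<close>

lemma bessel_system_bound:
  fixes n u V :: "real \<Rightarrow> real"
  assumes e: "e \<ge> 0" and \<kappa>: "\<kappa> \<ge> 0"
    and n: "\<And>s. s > 0 \<Longrightarrow> (n has_real_derivative u s / s) (at s)"
    and u: "\<And>s. s > 0 \<Longrightarrow> (u has_real_derivative (V s - e * u s) / s) (at s)"
    and V: "\<And>s. s > 0 \<Longrightarrow> (V has_real_derivative - (s\<^sup>2 - \<kappa>) * u s / s) (at s)"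
    and n0: "(n \<longlongrightarrow> 0) (at_right 0)" and u0: "(u \<longlongrightarrow> 0) (at_right 0)" and V0: "(V \<longlongrightarrow> 0) (at_right 0)"
    and upos: "\<And>s. 0 < s \<Longrightarrow> s < \<delta> \<Longrightarrow> u s > 0" and \<delta>: "\<delta> > 0"
  shows "\<exists>c>0. (n \<longlongrightarrow> c) at_top \<and> (\<forall>s>0. \<bar>c - n s\<bar> \<le> c)"
proof -
  note decay = bessel_system_decay[OF e \<kappa> u V]
  define Q where "Q = (\<lambda>s. s\<^sup>2 - \<kappa>)"
  have Q': "(Q has_real_derivative 2 * s) (at s)" for s
    unfolding Q_def by (auto intro!: derivative_eq_intros)
  have npos0: "n s > 0" if "0 < s" "s < \<delta>" for s
    by (rule pos_of_deriv_nonneg_tendsto_0[where r = \<delta> and \<delta> = \<delta> and D = "\<lambda>s. u s / s"])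
       (use that upos n n0 in \<open>auto intro: less_imp_le\<close>)
  define W where "W = (\<lambda>s. Q s * (n s)\<^sup>2 + 2 * n s * V s - (u s)\<^sup>2)"
  have W': "(W has_real_derivative 2 * s * (n s)\<^sup>2 + 2 * e * (u s)\<^sup>2 / s) (at s)" if "s > 0" for s
    unfolding W_def using that
    by (auto intro!: derivative_eq_intros n u V Q') (simp add: Q_def power2_eq_square field_simps)
  have Wpos: "W s > 0" if "s > 0" for s
  proof (rule pos_of_deriv_nonneg_tendsto_0[where r = "s + 1" and W = W])
    have "(W \<longlongrightarrow> (0\<^sup>2 - \<kappa>) * 0\<^sup>2 + 2 * 0 * 0 - 0\<^sup>2) (at_right 0)"
      unfolding W_def Q_def by (intro tendsto_intros n0 u0 V0)
    then show "(W \<longlongrightarrow> 0) (at_right 0)" by simp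
    show "2 * s * (n s)\<^sup>2 + 2 * e * (u s)\<^sup>2 / s > 0" if "0 < s" "s < \<delta>" for s
      using npos0[OF that] that e by (intro add_pos_nonneg) auto
  qed (use that W' \<delta> e in auto)
  have npos: "n s > 0" if "s > 0" for s
  proof (rule pos_of_no_zero[OF _ _ npos0 \<delta> that])
    show "n s \<noteq> 0" if "s > 0" for s
      using Wpos[OF that] that by (auto simp: W_def)
  qed (use n DERIV_isCont in blast)
  \<comment> \<open>Let g = 2 s^2 / Q^2, the coefficient of u in \<open>\<Phi>\<close> below.
    Differentiating \<open>\<Phi>\<close> in ln s cancels every term except (s g' - e g) u, and h is
    e g - s g'.\<close>
  define h where "h = (\<lambda>s. 2 * e * (s\<^sup>2 / (Q s)\<^sup>2) + 4 * (s\<^sup>2 * (s\<^sup>2 + \<kappa>) / (Q s) ^ 3))"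
  define h' where "h' = (\<lambda>s. 2 * e * (- 2 * s * (s\<^sup>2 + \<kappa>) / (Q s) ^ 3)
                              + 4 * (- 2 * s * (s ^ 4 + 4 * \<kappa> * s\<^sup>2 + \<kappa>\<^sup>2) / (Q s) ^ 4))"
  have h': "(h has_real_derivative h' s) (at s)" if "Q s > 0" for s
  proof -
    have \<kappa>s: "\<kappa> = s\<^sup>2 - Q s" by (simp add: Q_def)
    have 1: "((\<lambda>s. s\<^sup>2 / (Q s)\<^sup>2) has_real_derivative (- 2 * s * (s\<^sup>2 + \<kappa>) / (Q s) ^ 3)) (at s)"
      using that unfolding \<kappa>s
      by (auto intro!: derivative_eq_intros Q') (simp add: field_simps power2_eq_square power3_eq_cube power4_eq_xxxx)
    have 2: "((\<lambda>s. s\<^sup>2 * (s\<^sup>2 + \<kappa>) / (Q s) ^ 3) has_real_derivative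
               (- 2 * s * (s ^ 4 + 4 * \<kappa> * s\<^sup>2 + \<kappa>\<^sup>2) / (Q s) ^ 4)) (at s)"
    proof (rule DERIV_cong)
      show "((\<lambda>s. s\<^sup>2 * (s\<^sup>2 + \<kappa>) / (Q s) ^ 3) has_real_derivative
        ((2 * s * (s\<^sup>2 + \<kappa>) + s\<^sup>2 * (2 * s)) * (Q s) ^ 3 - s\<^sup>2 * (s\<^sup>2 + \<kappa>) * (3 * (Q s)\<^sup>2 * (2 * s))) / ((Q s)^3 * (Q s)^3)) (at s)"
        using that by (auto intro!: derivative_eq_intros Q')
      have A: "((2 * s * (s\<^sup>2 + \<kappa>) + s\<^sup>2 * (2 * s)) * (Q s) ^ 3 - s\<^sup>2 * (s\<^sup>2 + \<kappa>) * (3 * (Q s)\<^sup>2 * (2 * s)))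
        = (- 2 * s * (s ^ 4 + 4 * \<kappa> * s\<^sup>2 + \<kappa>\<^sup>2)) * (Q s)\<^sup>2"
        unfolding Q_def by (simp add: algebra_simps power2_eq_square power3_eq_cube power4_eq_xxxx)
      have B: "(Q s)^3 * (Q s)^3 = (Q s)^4 * (Q s)\<^sup>2" by (simp add: power_add[symmetric])
      show "((2 * s * (s\<^sup>2 + \<kappa>) + s\<^sup>2 * (2 * s)) * (Q s) ^ 3 - s\<^sup>2 * (s\<^sup>2 + \<kappa>) * (3 * (Q s)\<^sup>2 * (2 * s))) / ((Q s)^3 * (Q s)^3)
        = - 2 * s * (s ^ 4 + 4 * \<kappa> * s\<^sup>2 + \<kappa>\<^sup>2) / (Q s) ^ 4"
        unfolding A B by (rule nonzero_mult_divide_mult_cancel_right) (use that in simp)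
    qed
    show ?thesis unfolding h_def h'_def by (intro derivative_intros DERIV_cmult 1 2)
  qed
  \<comment> \<open>The sign of the derivative of \<open>W2\<close> rests on this: where Q > 0, both
    Q / h increases and h decreases.\<close>
  have h'_le: "h' s \<le> 0" if "s > 0" "Q s > 0" for s
  proof -
    have "2 * e * (2 * s * (s\<^sup>2 + \<kappa>) / (Q s) ^ 3) \<ge> 0" "2 * s * (s ^ 4 + 4 * \<kappa> * s\<^sup>2 + \<kappa>\<^sup>2) / (Q s) ^ 4 \<ge> 0"
      using that e \<kappa> by simp_all
    moreover have "h' s = - (2 * e * (2 * s * (s\<^sup>2 + \<kappa>) / (Q s) ^ 3)) - 4 * (2 * s * (s ^ 4 + 4 * \<kappa> * s\<^sup>2 + \<kappa>\<^sup>2) / (Q s) ^ 4)"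
      unfolding h'_def by simp
    ultimately show ?thesis by linarith
  qed
  have h_pos: "h s > 0" if "s > 0" "Q s > 0" for s
  proof -
    have "s\<^sup>2 + \<kappa> > 0" using that \<kappa> by (simp add: add_pos_nonneg)
    then have "s\<^sup>2 * (s\<^sup>2 + \<kappa>) / (Q s) ^ 3 > 0" "2 * e * (s\<^sup>2 / (Q s)\<^sup>2) \<ge> 0"
      using that e by simp_all
    then show ?thesis unfolding h_def by linarith
  qed
  define \<Phi> where "\<Phi> = (\<lambda>s. n s + V s / Q s + 2 * s\<^sup>2 / (Q s)\<^sup>2 * u s)"
  have \<Phi>': "(\<Phi> has_real_derivative - h s * u s / s) (at s)" if "s > 0" "Q s > 0" for s
  proof -
    have \<kappa>s: "\<kappa> = s\<^sup>2 - Q s" by (simp add: Q_def)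
    have V': "(V has_real_derivative - Q s * u s / s) (at s)" using V[OF that(1)] by (simp add: Q_def)
    show ?thesis unfolding \<Phi>_def h_def using that
      by (auto intro!: derivative_eq_intros n u V' Q') (simp add: \<kappa>s field_simps power2_eq_square power3_eq_cube power4_eq_xxxx)
  qed
  have evQ: "\<forall>\<^sub>F s in at_top. s > 0 \<and> Q s > 0" unfolding Q_def by (intro eventually_conj; real_asymp)
  have hlim: "((\<lambda>s. s\<^sup>2 * h s) \<longlongrightarrow> 2 * e + 4) at_top" unfolding h_def Q_def by real_asymp
  have hu: "((\<lambda>s. s\<^sup>2 * h s * u s) \<longlongrightarrow> 0) at_top"
    using tendsto_mult[OF hlim decay(1)] by simp
  have \<Phi>b: "\<exists>S>0. \<forall>s\<ge>S. s > 0 \<and> Q s > 0 \<and> \<bar>- h s * u s / s\<bar> \<le> \<epsilon> / s ^ 3" if "\<epsilon> > 0" for \<epsilon>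
  proof -
    have "\<forall>\<^sub>F s in at_top. \<bar>s\<^sup>2 * h s * u s\<bar> < \<epsilon>"
      using hu that by (auto simp: tendsto_iff dist_real_def)
    with evQ have "\<forall>\<^sub>F s in at_top. s > 0 \<and> Q s > 0 \<and> \<bar>- h s * u s / s\<bar> \<le> \<epsilon> / s ^ 3"
    proof eventually_elim
      case (elim s)
      have "\<bar>- h s * u s / s\<bar> = \<bar>s\<^sup>2 * h s * u s\<bar> / s ^ 3"
        using elim by (simp add: abs_mult field_simps power2_eq_square power3_eq_cube)
      also have "\<dots> \<le> \<epsilon> / s ^ 3" using elim by (intro divide_right_mono) auto
      finally show ?case using elim by simp
    qed
    then obtain S where "\<forall>s\<ge>S. s > 0 \<and> Q s > 0 \<and> \<bar>- h s * u s / s\<bar> \<le> \<epsilon> / s ^ 3"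
      by (auto simp: eventually_at_top_linorder)
    then show ?thesis by (intro exI[of _ "max S 1"]) auto
  qed
  obtain c where c: "(\<Phi> \<longlongrightarrow> c) at_top"
  proof -
    obtain S where "S > 0" "\<forall>s\<ge>S. s > 0 \<and> Q s > 0 \<and> \<bar>- h s * u s / s\<bar> \<le> 1 / s ^ 3" using \<Phi>b[of 1] by auto
    then show ?thesis
      using inverse_square_decay_of_deriv(1)[of S \<Phi> "\<lambda>s. - h s * u s / s" 1] \<Phi>' that by blast
  qed
  define T where "T = (\<lambda>s. \<Phi> s - c)"
  \<comment> \<open>The first term of \<open>W2\<close> is comparable to (s^2 T)^2, so T = O(s^-2)
    would not make it vanish at infinity. The improvement to o(s^-2) comes from the decay of u,
    which allows an arbitrarily small constant in \<open>\<Phi>b\<close>.\<close>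
  have T_lim: "((\<lambda>s. s\<^sup>2 * T s) \<longlongrightarrow> 0) at_top"
  proof (rule tendstoI)
    fix \<epsilon> :: real assume "\<epsilon> > 0"
    then obtain S where S: "S > 0" "\<forall>s\<ge>S. s > 0 \<and> Q s > 0 \<and> \<bar>- h s * u s / s\<bar> \<le> (\<epsilon>/2) / s ^ 3"
      using \<Phi>b[of "\<epsilon>/2"] by auto
    have "\<bar>s\<^sup>2 * T s\<bar> < \<epsilon>" if s: "s \<ge> S" for s
    proof -
      have "\<bar>\<Phi> s - c\<bar> \<le> (\<epsilon>/2) / s\<^sup>2"
        by (rule inverse_square_decay_of_deriv(2)[where D = "\<lambda>s. - h s * u s / s", OF _ _ _ c])
           (use \<Phi>' S s in force)+
      moreover have "s\<^sup>2 > 0" using S(1) s by (intro zero_less_power) linarith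
      ultimately have "s\<^sup>2 * \<bar>T s\<bar> \<le> \<epsilon> / 2" by (simp add: T_def field_simps)
      then show ?thesis using \<open>\<epsilon> > 0\<close> by (simp add: abs_mult)
    qed
    then show "\<forall>\<^sub>F s in at_top. dist (s\<^sup>2 * T s) 0 < \<epsilon>"
      by (intro eventually_mono[OF eventually_ge_at_top[of S]]) (simp add: dist_real_def)
  qed
  have ev: "\<forall>\<^sub>F s in at_top. s > (0::real)" by (rule eventually_gt_at_top)
  have sm: "((\<lambda>s. s * (c - n s)) \<longlongrightarrow> 0) at_top"
  proof -
    have a: "((\<lambda>s. s\<^sup>2 / Q s) \<longlongrightarrow> 1) at_top" "((\<lambda>s. 2 * s ^ 3 / (Q s)\<^sup>2) \<longlongrightarrow> 0) at_top"
      "((\<lambda>s::real. 1 / s) \<longlongrightarrow> 0) at_top" unfolding Q_def by real_asymp+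
    have "((\<lambda>s. V s / s * (s\<^sup>2 / Q s) + 2 * s ^ 3 / (Q s)\<^sup>2 * u s - s\<^sup>2 * T s * (1 / s)) \<longlongrightarrow> 0 * 1 + 0 * 0 - 0 * 0) at_top"
      by (intro tendsto_intros decay a T_lim)
    moreover have "\<forall>\<^sub>F s in at_top. V s / s * (s\<^sup>2 / Q s) + 2 * s ^ 3 / (Q s)\<^sup>2 * u s - s\<^sup>2 * T s * (1 / s) = s * (c - n s)"
      using evQ
      by eventually_elim (simp add: T_def \<Phi>_def field_simps power2_eq_square power3_eq_cube)
    ultimately show ?thesis using Lim_transform_eventually by fastforce
  qed
  have nc: "(n \<longlongrightarrow> c) at_top"
  proof -
    have "((\<lambda>s::real. 1 / s) \<longlongrightarrow> 0) at_top" by real_asymp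
    from tendsto_mult[OF this sm, unfolded mult_zero_left] have "((\<lambda>s. c - n s) \<longlongrightarrow> 0) at_top"
      by (rule Lim_transform_eventually[OF _ eventually_mono[OF ev]]) auto
    from tendsto_diff[OF tendsto_const[of c] this] show ?thesis by simp
  qed
  have c0: "c > 0"
  proof -
    have "c \<ge> 0"
      by (rule tendsto_lowerbound[OF nc eventually_mono[OF ev]]) (use npos less_imp_le in auto)
    moreover have "c \<noteq> 0"
    proof
      \<comment> \<open>By \<open>sm\<close> the product s n would then tend to 0, and with it W,
        whose leading term is about (s n)^2; but W is positive and nondecreasing.\<close>
      assume c: "c = 0"
      have a: "((\<lambda>s. Q s / s\<^sup>2) \<longlongrightarrow> 1) at_top" unfolding Q_def by real_asymp
      have "((\<lambda>s. Q s / s\<^sup>2 * (s * (c - n s))\<^sup>2 - 2 * (s * (c - n s)) * (V s / s) - (u s)\<^sup>2) \<longlongrightarrow> 1 * 0\<^sup>2 - 2 * 0 * 0 - 0\<^sup>2) at_top"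
        by (intro tendsto_intros sm decay a)
      moreover have "\<forall>\<^sub>F s in at_top. Q s / s\<^sup>2 * (s * (c - n s))\<^sup>2 - 2 * (s * (c - n s)) * (V s / s) - (u s)\<^sup>2 = W s"
        using ev by eventually_elim (simp add: W_def c power_mult_distrib)
      ultimately have "(W \<longlongrightarrow> 0) at_top" using Lim_transform_eventually by fastforce
      from nonpos_of_deriv_nonneg_tendsto_0[OF _ this, of 0 1] Wpos[of 1] W' e
      show False by (force intro!: exI add_nonneg_nonneg)
    qed
    ultimately show ?thesis by simp
  qed
  define W2 where "W2 = (\<lambda>s. Q s / h s * (T s)\<^sup>2 - 2 * T s * V s - h s * (u s)\<^sup>2)"
  have T': "(T has_real_derivative - h s * u s / s) (at s)" if "s > 0" "Q s > 0" for s
    unfolding T_def using \<Phi>'[OF that] by (auto intro!: derivative_eq_intros)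
  have W2': "(W2 has_real_derivative (2 * s * h s - Q s * h' s) / (h s)\<^sup>2 * (T s)\<^sup>2 + (2 * e * h s / s - h' s) * (u s)\<^sup>2) (at s)"
    if s: "s > 0" "Q s > 0" for s
  proof -
    have V': "(V has_real_derivative - Q s * u s / s) (at s)" using V[OF that(1)] by (simp add: Q_def)
    show ?thesis unfolding W2_def using s h_pos[OF s]
      by (auto intro!: derivative_eq_intros T'[OF s] u V' Q' h') (simp add: field_simps power2_eq_square)
  qed
  have W2le: "W2 s \<le> 0" if s: "s > 0" "Q s > 0" for s
  proof (rule nonpos_of_deriv_nonneg_tendsto_0[where S = "sqrt \<kappa>" and W = W2])
    show "sqrt \<kappa> < s" using s by (simp add: Q_def real_less_lsqrt)
    have a: "((\<lambda>s. Q s / s\<^sup>2 / (s\<^sup>2 * h s)) \<longlongrightarrow> 1 / (2 * e + 4)) at_top"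
    proof (intro tendsto_divide hlim)
      show "((\<lambda>s. Q s / s\<^sup>2) \<longlongrightarrow> 1) at_top" unfolding Q_def by real_asymp
    qed (use e in auto)
    have b: "((\<lambda>s::real. 1 / s) \<longlongrightarrow> 0) at_top" "((\<lambda>s::real. 1 / s\<^sup>2) \<longlongrightarrow> 0) at_top" by real_asymp+
    have "((\<lambda>s. Q s / s\<^sup>2 / (s\<^sup>2 * h s) * (s\<^sup>2 * T s)\<^sup>2 - 2 * (s\<^sup>2 * T s) * (V s / s) * (1 / s) - s\<^sup>2 * h s * u s * u s * (1 / s\<^sup>2))
       \<longlongrightarrow> 1 / (2 * e + 4) * 0\<^sup>2 - 2 * 0 * 0 * 0 - 0 * 0 * 0) at_top"
      by (intro tendsto_intros a b T_lim decay hu)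
    moreover have "\<forall>\<^sub>F s in at_top. Q s / s\<^sup>2 / (s\<^sup>2 * h s) * (s\<^sup>2 * T s)\<^sup>2 - 2 * (s\<^sup>2 * T s) * (V s / s) * (1 / s) - s\<^sup>2 * h s * u s * u s * (1 / s\<^sup>2) = W2 s"
      using evQ
    proof eventually_elim
      case (elim s)
      then show ?case using h_pos[of s] by (simp add: W2_def field_simps power2_eq_square)
    qed
    ultimately show "(W2 \<longlongrightarrow> 0) at_top" using Lim_transform_eventually by fastforce
    fix t assume "sqrt \<kappa> < t"
    then have t: "t > 0" "Q t > 0"
      using le_less_trans[OF real_sqrt_ge_zero[OF \<kappa>], of t] real_sqrt_less_iff[of \<kappa> "t\<^sup>2"] by (auto simp: Q_def)
    have "2 * t * h t \<ge> 0" "2 * e * h t / t \<ge> 0" "Q t * h' t \<le> 0"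
      using t e h_pos[OF t] h'_le[OF t] by (auto intro: mult_nonneg_nonpos)
    then have "2 * t * h t - Q t * h' t \<ge> 0" "2 * e * h t / t - h' t \<ge> 0"
      using h'_le[OF t] by linarith+
    then show "\<exists>D. (W2 has_real_derivative D) (at t) \<and> 0 \<le> D"
      using W2'[OF t] h_pos[OF t]
      by (intro exI[of _ "(2 * t * h t - Q t * h' t) / (h t)\<^sup>2 * (T t)\<^sup>2 + (2 * e * h t / t - h' t) * (u t)\<^sup>2"])
         (simp add: add_nonneg_nonneg del: diff_ge_0_iff_ge)
  qed
  have "n s \<le> 2 * c" if "s > 0" for s
  proof (rule le_twice_limit_of_critical_points[OF n n0 nc npos c0 _ _ _ that, where z = V and A = Q])
    fix s :: real assume s: "s > 0" and "u s / s = 0"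
    then have us: "u s = 0" by simp
    show "Q s * (n s)\<^sup>2 + 2 * n s * V s > 0" using Wpos[OF s] us by (simp add: W_def)
    show "V s / Q s \<le> c - n s" if "Q s > 0" "V s \<le> 0"
    proof -
      have W: "Q s / h s * (T s)\<^sup>2 \<le> 2 * T s * V s" using W2le[OF s that(1)] us by (simp add: W2_def)
      have "T s \<le> 0"
      proof (rule ccontr)
        assume "\<not> T s \<le> 0"
        then have "Q s / h s * (T s)\<^sup>2 > 0" "2 * T s * V s \<le> 0"
          using s that h_pos[of s] by (auto intro!: mult_nonneg_nonpos)
        then show False using W by linarith
      qed
      then show ?thesis using us by (simp add: T_def \<Phi>_def)
    qed
    show "V s \<le> 0" if "\<And>t. t > 0 \<Longrightarrow> n t \<le> n s"
    proof -
      have "((\<lambda>s. u s / s) has_real_derivative V s / s\<^sup>2) (at s)"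
        using s us by (auto intro!: derivative_eq_intros u simp: field_simps power2_eq_square)
      from deriv_nonpos_at_max_of_antiderivative[OF n this s _ that] us s
      show ?thesis by (simp add: divide_le_0_iff)
    qed
  qed auto
  then have "\<forall>s>0. \<bar>c - n s\<bar> \<le> c" using npos by (force simp: abs_le_iff)
  then show ?thesis using c0 nc by blast
qed

section \<open>Bessel functions as power series\<close>

text \<open>Up to normalisation \<open>j D s = s\<^sup>-\<^sup>\<nu> J\<^sub>\<nu> s\<close> with \<open>\<nu> = D / 2 - 1\<close>, the radial Fourier transform of
  the unit sphere in dimension \<open>D\<close>.\<close>

definition bessel_coeff :: "real \<Rightarrow> nat \<Rightarrow> real" where
  "bessel_coeff D n = (-1) ^ n / (4 ^ n * fact n * pochhammer (D / 2) n)"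

definition bessel_j :: "real \<Rightarrow> real \<Rightarrow> real" where
  "bessel_j D s = (\<Sum>n. bessel_coeff D n * (s\<^sup>2) ^ n)"

lemma pochhammer_ge_1: "x \<ge> 1 \<Longrightarrow> pochhammer x n \<ge> (1 :: real)"
proof (induction n)
  case (Suc n)
  then have "pochhammer x n * (x + real n) \<ge> 1 * 1" by (intro mult_mono) auto
  then show ?case by (simp add: pochhammer_Suc)
qed simp

lemma abs_bessel_coeff_le: "D \<ge> 2 \<Longrightarrow> \<bar>bessel_coeff D n\<bar> \<le> 1 / (4 ^ n * fact n)"
  using pochhammer_ge_1[of "D / 2" n]
  by (auto simp: bessel_coeff_def abs_mult power_abs intro!: divide_left_mono mult_pos_pos)

lemma summable_bessel_coeff:
  assumes "D \<ge> 2" shows "summable (\<lambda>n. bessel_coeff D n * w ^ n)"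
proof (rule summable_comparison_test)
  show "\<exists>N. \<forall>n\<ge>N. norm (bessel_coeff D n * w ^ n) \<le> \<bar>w\<bar> ^ n /\<^sub>R fact n"
  proof (intro exI allI impI)
    fix n
    have "norm (bessel_coeff D n * w ^ n) \<le> 1 / (4 ^ n * fact n) * \<bar>w\<bar> ^ n"
      unfolding real_norm_def abs_mult power_abs
      by (intro mult_right_mono abs_bessel_coeff_le[OF assms]) auto
    also have "\<dots> \<le> 1 / (1 * fact n) * \<bar>w\<bar> ^ n"
      by (intro mult_right_mono divide_left_mono) auto
    finally show "norm (bessel_coeff D n * w ^ n) \<le> \<bar>w\<bar> ^ n /\<^sub>R fact n" by (simp add: field_simps)
  qed
  show "summable (\<lambda>n. \<bar>w\<bar> ^ n /\<^sub>R fact n)" by (rule summable_exp_generic)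
qed

lemma bessel_coeff_Suc:
  "D > 0 \<Longrightarrow> 4 * real (Suc n) * (D / 2 + real n) * bessel_coeff D (Suc n) = - bessel_coeff D n"
proof -
  assume "D > 0"
  then have "pochhammer (D / 2) n \<noteq> 0" "D / 2 + real n \<noteq> 0"
    using pochhammer_pos[of "D / 2" n] by auto
  then show ?thesis unfolding bessel_coeff_def pochhammer_Suc by (simp add: divide_simps del: of_nat_Suc)
qed

text \<open>In the variable w = s^2 the Bessel equation becomes 4 w f'' + 2 D f' + f = 0. Its
  solution normalised by f(0) = 1 is an entire power series, and the behaviour at s = 0 can be read
  off without singular terms. Coefficientwise the equation is
  \<open>bessel_coeff_Suc\<close>.\<close>

lemma bessel_series_derivs:
  fixes D :: real assumes D: "D \<ge> 2"
  obtains f0 f1 f2 :: "real \<Rightarrow> real" where "\<And>w. f0 w = (\<Sum>n. bessel_coeff D n * w ^ n)" "f0 0 = 1"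
    "\<And>w. (f0 has_real_derivative f1 w) (at w)" "\<And>w. (f1 has_real_derivative f2 w) (at w)"
    "\<And>w. 4 * w * f2 w + 2 * D * f1 w + f0 w = 0"
proof -
  let ?a = "bessel_coeff D"
  let ?f0 = "\<lambda>w. \<Sum>n. ?a n * w ^ n" and ?f1 = "\<lambda>w. \<Sum>n. diffs ?a n * w ^ n"
    and ?f2 = "\<lambda>w. \<Sum>n. diffs (diffs ?a) n * w ^ n"
  have s0: "summable (\<lambda>n. ?a n * w ^ n)" for w by (rule summable_bessel_coeff[OF D])
  have s1: "summable (\<lambda>n. diffs ?a n * w ^ n)" for w by (rule termdiff_converges_all[OF s0])
  have s2: "summable (\<lambda>n. diffs (diffs ?a) n * w ^ n)" for w by (rule termdiff_converges_all[OF s1])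
  have ode: "4 * w * ?f2 w + 2 * D * ?f1 w + ?f0 w = 0" for w
  proof -
    \<comment> \<open>Index shift for w f'': the terms of w f2 are g (n + 1), and g 0 = 0, so the
      sum can be started at 0 and added to the other two series.\<close>
    define g where "g = (\<lambda>n. real n * diffs ?a n * w ^ n)"
    have "(\<lambda>n. w * (diffs (diffs ?a) n * w ^ n)) sums (w * ?f2 w)"
      by (intro sums_mult summable_sums s2)
    also have "(\<lambda>n. w * (diffs (diffs ?a) n * w ^ n)) = (\<lambda>n. g (Suc n))"
      by (simp add: g_def diffs_def fun_eq_iff)
    finally have "g sums (w * ?f2 w)" using sums_Suc[of g] by (simp add: g_def)
    then have "(\<lambda>n. real n * diffs ?a n * w ^ n) sums (w * ?f2 w)" by (simp add: g_def)
    then have "(\<lambda>n. 4 * (real n * diffs ?a n * w ^ n) + 2 * D * (diffs ?a n * w ^ n) + ?a n * w ^ n)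
       sums (4 * (w * ?f2 w) + 2 * D * ?f1 w + ?f0 w)"
      by (intro sums_add sums_mult summable_sums s0 s1)
    also have "(\<lambda>n. 4 * (real n * diffs ?a n * w ^ n) + 2 * D * (diffs ?a n * w ^ n) + ?a n * w ^ n) = (\<lambda>n. 0)"
    proof
      fix n
      have "4 * (real n * diffs ?a n * w ^ n) + 2 * D * (diffs ?a n * w ^ n) + ?a n * w ^ n
        = (4 * real (Suc n) * (D / 2 + real n) * ?a (Suc n) + ?a n) * w ^ n"
        by (simp add: diffs_def algebra_simps)
      then show "4 * (real n * diffs ?a n * w ^ n) + 2 * D * (diffs ?a n * w ^ n) + ?a n * w ^ n = 0"
        using bessel_coeff_Suc[of D n] D by simp
    qed
    finally show ?thesis using sums_unique2 sums_zero by fastforce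
  qed
  show ?thesis
  proof
    show "?f0 0 = 1" unfolding powser_zero by (simp add: bessel_coeff_def)
    show "(?f0 has_real_derivative ?f1 w) (at w)" for w
      by (rule termdiffs_strong_converges_everywhere[OF s0])
    show "(?f1 has_real_derivative ?f2 w) (at w)" for w
      by (rule termdiffs_strong_converges_everywhere[OF s1])
  qed (use ode in auto)
qed

text \<open>By Hecke-Bochner, a radial function times a harmonic polynomial of degree k in dimension
  d transforms like a radial function in dimension 2 k + d, hence the index of
  \<open>bessel_j\<close>. The weight is the radial density r^(2k+d-1) of that dimension times the
  factor r^(-(d+k)) of the Riesz kernel.\<close>

definition bessel_primitive :: "nat \<Rightarrow> nat \<Rightarrow> real \<Rightarrow> real" where
  "bessel_primitive k d s = integral {0..s} (\<lambda>r. bessel_j (real (2 * k + d)) r * r ^ (k - 1))"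

lemma continuous_on_bessel_j [continuous_intros]:
  assumes "D \<ge> 2" "continuous_on S g" shows "continuous_on S (\<lambda>x. bessel_j D (g x))"
proof -
  obtain f0 f1 f2 where f: "\<And>w. f0 w = (\<Sum>n. bessel_coeff D n * w ^ n)" "\<And>w. (f0 has_real_derivative f1 w) (at w)"
    using bessel_series_derivs[OF assms(1)] by metis
  have "continuous_on UNIV f0" by (auto intro!: continuous_at_imp_continuous_on DERIV_isCont f(2))
  then have "continuous_on S (\<lambda>x. f0 ((g x)\<^sup>2))"
    by (rule continuous_on_compose2) (auto intro!: continuous_intros assms)
  then show ?thesis by (simp add: bessel_j_def f(1))
qed

lemma bessel_primitive_0 [simp]: "bessel_primitive k d 0 = 0"
  by (simp add: bessel_primitive_def)

lemma bessel_primitive_deriv: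
  assumes "s > 0" "k > 0"
  shows "(bessel_primitive k d has_real_derivative bessel_j (real (2 * k + d)) s * s ^ (k - 1)) (at s)"
proof -
  have "((\<lambda>u. integral {0..u} (\<lambda>r. bessel_j (real (2 * k + d)) r * r ^ (k - 1))) has_real_derivative
     bessel_j (real (2 * k + d)) s * s ^ (k - 1)) (at s within {0..s+1})"
    using assms by (intro integral_has_real_derivative continuous_intros) auto
  then show ?thesis using assms unfolding bessel_primitive_def[abs_def]
    by (subst (asm) at_within_interior) auto
qed

lemma continuous_on_bessel_primitive:
  assumes "k > 0" shows "continuous_on {0..} (bessel_primitive k d)"
proof -
  have "continuous_on {0..b} (bessel_primitive k d)" for b
    unfolding bessel_primitive_def[abs_def] using assms
    by (intro indefinite_integral_continuous_1 integrable_continuous_real continuous_intros) auto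
  note c = this
  show ?thesis unfolding continuous_on_def
  proof
    fix x :: real assume "x \<in> {0..}"
    then have "(bessel_primitive k d \<longlongrightarrow> bessel_primitive k d x) (at x within {0..x+1})"
      using c[of "x + 1"] by (auto simp: continuous_on_def)
    moreover have "at x within {0..x+1} = at x within {0..}"
      by (rule at_within_nhd[of _ "{..<x+1}"]) auto
    ultimately show "(bessel_primitive k d \<longlongrightarrow> bessel_primitive k d x) (at x within {0..})" by simp
  qed
qed

text \<open>The function u = s^k j(s) is the radial factor of the solutions u(|x|) Y(x / |x|) of the
  Helmholtz equation in dimension d, with Y of degree k. In ln s it satisfies u'' + e u' + (s^2 -
  \<kappa>) u = 0 with e = d - 2 and \<kappa> = k (k + d - 2), the eigenvalue of the spherical
  Laplacian; V is u' + e u. This is the system of \<open>bessel_system_bound\<close>.\<close>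

lemma bessel_primitive_bound:
  assumes k: "k > 0" and d: "d \<ge> 2 \<or> (d = 1 \<and> k = 1)"
  shows "\<exists>c>0. (bessel_primitive k d \<longlongrightarrow> c) at_top \<and> (\<forall>s>0. \<bar>c - bessel_primitive k d s\<bar> \<le> c)"
proof -
  define D where "D = real (2 * k + d)"
  have D: "D \<ge> 2" using k by (auto simp: D_def)
  obtain f0 f1 f2 :: "real \<Rightarrow> real" where f: "\<And>w. f0 w = (\<Sum>n. bessel_coeff D n * w ^ n)" "f0 0 = 1"
    "\<And>w. (f0 has_real_derivative f1 w) (at w)" "\<And>w. (f1 has_real_derivative f2 w) (at w)"
    "\<And>w. 4 * w * f2 w + 2 * D * f1 w + f0 w = 0"
    using bessel_series_derivs[OF D] by blast
  have jf: "bessel_j D s = f0 (s\<^sup>2)" for s by (simp add: bessel_j_def f)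
  note df = DERIV_chain'[OF _ f(3)] DERIV_chain'[OF _ f(4)]
  let ?n = "bessel_primitive k d"
  define u where "u = (\<lambda>s. s ^ k * f0 (s\<^sup>2))"
  have n: "(?n has_real_derivative u s / s) (at s)" if "s > 0" for s
  proof -
    have "s ^ k = s * s ^ (k - 1)" using k by (cases k) auto
    then have "u s / s = bessel_j D s * s ^ (k - 1)" using that by (simp add: u_def jf)
    then show ?thesis using bessel_primitive_deriv[OF that k, of d] by (simp only: D_def)
  qed
  have n0: "(?n \<longlongrightarrow> 0) (at_right 0)"
  proof -
    have "continuous_on {0..1} ?n" unfolding bessel_primitive_def[abs_def]
      using k by (intro indefinite_integral_continuous_1 integrable_continuous_real continuous_intros) auto
    then have "(?n \<longlongrightarrow> ?n 0) (at 0 within {0..1})" unfolding continuous_on_def by (elim ballE[of _ _ 0]) auto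
    then show ?thesis by (simp add: at_within_Icc_at_right)
  qed
  have cf: "isCont f0 w" "isCont f1 w" for w using f(3,4) DERIV_isCont by blast+
  have "(f0 \<longlongrightarrow> 1) (at 0)" using cf(1)[of 0] f(2) by (simp add: isCont_def)
  then have "\<forall>\<^sub>F w in at 0. f0 w > 0" by (rule order_tendstoD) auto
  then obtain \<delta>' where \<delta>': "\<delta>' > 0" "\<And>w. w \<noteq> 0 \<Longrightarrow> \<bar>w\<bar> < \<delta>' \<Longrightarrow> f0 w > 0"
    by (auto simp: eventually_at dist_real_def)
  define \<delta> where "\<delta> = min 1 \<delta>'"
  have \<delta>: "\<delta> > 0" using \<delta>' by (simp add: \<delta>_def)
  have upos: "u s > 0" if "0 < s" "s < \<delta>" for s
  proof -
    have "s\<^sup>2 \<le> s" using that by (auto simp: \<delta>_def power2_eq_square mult_le_cancel_left2)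
    then have "\<bar>s\<^sup>2\<bar> < \<delta>'" using that by (simp add: \<delta>_def)
    then show ?thesis using \<delta>'(2)[of "s\<^sup>2"] that by (simp add: u_def)
  qed
  have sq0: "((\<lambda>s::real. s\<^sup>2) \<longlongrightarrow> 0) (at_right 0)" by real_asymp
  have fl: "((\<lambda>s. f0 (s\<^sup>2)) \<longlongrightarrow> 1) (at_right 0)" "((\<lambda>s. f1 (s\<^sup>2)) \<longlongrightarrow> f1 0) (at_right 0)"
    using isCont_tendsto_compose[OF cf(1)[of 0] sq0] isCont_tendsto_compose[OF cf(2)[of 0] sq0] f(2) by auto
  have pk: "((\<lambda>s::real. s ^ k) \<longlongrightarrow> 0) (at_right 0)"
  proof -
    have "((\<lambda>s::real. s ^ k) \<longlongrightarrow> 0 ^ k) (at_right 0)" by (intro tendsto_intros)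
    then show ?thesis using k by simp
  qed
  show ?thesis
  proof (cases "d \<ge> 2")
    case True
    define e where "e = real d - 2"
    define V where "V = (\<lambda>s. s ^ k * ((real k + e) * f0 (s\<^sup>2) + 2 * s\<^sup>2 * f1 (s\<^sup>2)))"
    have De: "D = 2 * real k + e + 2" by (simp add: D_def e_def)
    have pd: "((\<lambda>s. s ^ k) has_real_derivative real k * s ^ k / s) (at s)" if "s > 0" for s :: real
    proof -
      have "s ^ k = s * s ^ (k - 1)" using k by (cases k) auto
      then show ?thesis using that by (auto intro!: derivative_eq_intros)
    qed
    show ?thesis
    proof (rule bessel_system_bound[OF _ _ n _ _ n0 _ _ upos \<delta>, where V = V and e = e and \<kappa> = "real k * (real k + e)"])
      show "e \<ge> 0" "real k * (real k + e) \<ge> 0" using True by (auto simp: e_def)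
      fix s :: real assume s: "s > 0"
      show "(u has_real_derivative (V s - e * u s) / s) (at s)"
        unfolding u_def V_def using s
        by (auto intro!: derivative_eq_intros df pd) (use k in \<open>simp add: field_simps power2_eq_square power_eq_if[of s k]\<close>)
      have f2: "4 * s\<^sup>2 * f2 (s\<^sup>2) = - 2 * D * f1 (s\<^sup>2) - f0 (s\<^sup>2)" using f(5)[of "s\<^sup>2"] by linarith
      have "(V has_real_derivative (real k * s ^ k / s) * ((real k + e) * f0 (s\<^sup>2) + 2 * s\<^sup>2 * f1 (s\<^sup>2))
         + s ^ k * ((real k + e) * (2 * s * f1 (s\<^sup>2)) + 4 * s * f1 (s\<^sup>2) + s * (4 * s\<^sup>2 * f2 (s\<^sup>2)))) (at s)"
        unfolding V_def using s
        by (auto intro!: derivative_eq_intros df pd) (use k in \<open>simp add: field_simps power2_eq_square power_eq_if[of s k]\<close>)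
      then show "(V has_real_derivative - (s\<^sup>2 - real k * (real k + e)) * u s / s) (at s)"
      proof (rule DERIV_cong)
        show "(real k * s ^ k / s) * ((real k + e) * f0 (s\<^sup>2) + 2 * s\<^sup>2 * f1 (s\<^sup>2))
         + s ^ k * ((real k + e) * (2 * s * f1 (s\<^sup>2)) + 4 * s * f1 (s\<^sup>2) + s * (4 * s\<^sup>2 * f2 (s\<^sup>2)))
         = - (s\<^sup>2 - real k * (real k + e)) * u s / s"
          unfolding f2 De u_def using s by (simp add: field_simps power2_eq_square)
      qed
    next
      have "((\<lambda>s. s ^ k * f0 (s\<^sup>2)) \<longlongrightarrow> 0 * 1) (at_right 0)" by (intro tendsto_intros fl pk)
      then show "(u \<longlongrightarrow> 0) (at_right 0)" by (simp add: u_def)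
      have "((\<lambda>s. s ^ k * ((real k + e) * f0 (s\<^sup>2) + 2 * s\<^sup>2 * f1 (s\<^sup>2))) \<longlongrightarrow> 0 * ((real k + e) * 1 + 2 * 0 * f1 0)) (at_right 0)"
        by (intro tendsto_intros fl pk sq0)
      then show "(V \<longlongrightarrow> 0) (at_right 0)" by (simp add: V_def)
    qed
  next
    case False
    \<comment> \<open>Here D = 3 and j(s) = sin s / s, so u is the sine, z the cosine and n the sine
      integral.\<close>
    then have dk: "d = 1" "k = 1" using d by auto
    define z where "z = (\<lambda>s. f0 (s\<^sup>2) + 2 * s\<^sup>2 * f1 (s\<^sup>2))"
    have D3: "D = 3" by (simp add: D_def dk)
    show ?thesis
    proof (rule sine_system_bound[OF n _ _ n0 _ _ upos \<delta>, where z = z])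
      fix s :: real assume s: "s > 0"
      show "(u has_real_derivative z s) (at s)"
        unfolding u_def z_def dk
        by (auto intro!: derivative_eq_intros df simp: power2_eq_square)
      have f2: "4 * s\<^sup>2 * f2 (s\<^sup>2) = - 6 * f1 (s\<^sup>2) - f0 (s\<^sup>2)" using f(5)[of "s\<^sup>2"] unfolding D3 by linarith
      have "(z has_real_derivative (6 * s * f1 (s\<^sup>2) + s * (4 * s\<^sup>2 * f2 (s\<^sup>2)))) (at s)"
        unfolding z_def by (auto intro!: derivative_eq_intros df simp: field_simps power2_eq_square)
      then show "(z has_real_derivative - u s) (at s)" unfolding f2 by (simp add: u_def dk algebra_simps)
    next
      have "((\<lambda>s. u s / s) \<longlongrightarrow> 1) (at_right 0)"
        by (rule Lim_transform_eventually[OF fl(1) eventually_mono[OF eventually_at_right_less[of 0]]]) (simp add: u_def dk)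
      then show "((\<lambda>s. u s / s) \<longlongrightarrow> 1) (at_right 0)" .
      have "((\<lambda>s. f0 (s\<^sup>2) + 2 * s\<^sup>2 * f1 (s\<^sup>2)) \<longlongrightarrow> 1 + 2 * 0 * f1 0) (at_right 0)" by (intro tendsto_intros fl sq0)
      then show "(z \<longlongrightarrow> 1) (at_right 0)" by (simp add: z_def)
    qed
  qed
qed

section \<open>Gaussian integrals on Euclidean space\<close>

lemma nn_integral_lborel_affine:
  fixes f :: "'a::euclidean_space \<Rightarrow> ennreal"
  assumes [measurable]: "f \<in> borel_measurable borel" and c: "c \<noteq> 0"
  shows "(\<integral>\<^sup>+x. f x \<partial>lborel) = ennreal (\<bar>c\<bar> ^ DIM('a)) * (\<integral>\<^sup>+x. f (t + c *\<^sub>R x) \<partial>lborel)"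
  by (subst lborel_affine[OF c, of t])
     (simp add: nn_integral_density nn_integral_distr nn_integral_cmult ennreal_power)

lemma integrable_lborel_affine:
  fixes f :: "'a::euclidean_space \<Rightarrow> 'b::{banach, second_countable_topology}"
  assumes f: "integrable lborel f" and c: "c \<noteq> 0"
  shows "integrable lborel (\<lambda>x. f (t + c *\<^sub>R x))"
  using f f[THEN borel_measurable_integrable] c unfolding integrable_iff_bounded
  by (subst (asm) nn_integral_lborel_affine[where c=c and t=t]) (auto simp: ennreal_mult_less_top)

lemma integrable_lborel_affine_iff:
  fixes f :: "'a::euclidean_space \<Rightarrow> 'b::{banach, second_countable_topology}"
  assumes c: "c \<noteq> 0"
  shows "integrable lborel (\<lambda>x. f (t + c *\<^sub>R x)) \<longleftrightarrow> integrable lborel f"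
  using integrable_lborel_affine[of f c t] c
    integrable_lborel_affine[of "\<lambda>x. f (t + c *\<^sub>R x)" "1/c" "-(1/c) *\<^sub>R t"]
  by (auto simp: algebra_simps)

lemma integral_lborel_affine:
  fixes f :: "'a::euclidean_space \<Rightarrow> 'b::{banach, second_countable_topology}"
  assumes c: "c \<noteq> 0"
  shows "(LINT x|lborel. f x) = \<bar>c\<bar> ^ DIM('a) *\<^sub>R (LINT x|lborel. f (t + c *\<^sub>R x))"
proof cases
  assume f[measurable]: "integrable lborel f" then show ?thesis
    using c f f[THEN borel_measurable_integrable] integrable_lborel_affine[OF f c, of t]
    by (subst lborel_affine[OF c, of t])
       (simp add: integral_density integral_distr)
next
  assume "\<not> integrable lborel f" with c show ?thesis
    by (simp add: integrable_lborel_affine_iff not_integrable_integral_eq)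
qed

lemma integral_lborel_reflect:
  fixes f :: "'a::euclidean_space \<Rightarrow> 'b::{banach, second_countable_topology}"
  shows "(LINT x|lborel. f (a - x)) = (LINT x|lborel. f x)"
  using integral_lborel_affine[of "-1" f a] by simp

lemma integral_lborel_translate:
  fixes f :: "'a::euclidean_space \<Rightarrow> 'b::{banach, second_countable_topology}"
  shows "(LINT x|lborel. f (x + a)) = (LINT x|lborel. f x)"
  using integral_lborel_affine[of 1 f a] by (simp add: add.commute)

lemma integrable_lborel_reflect:
  fixes f :: "'a::euclidean_space \<Rightarrow> 'b::{banach, second_countable_topology}"
  shows "integrable lborel (\<lambda>x. f (a - x)) \<longleftrightarrow> integrable lborel f"
  using integrable_lborel_affine_iff[of "-1" f a] by simp

lemma integrable_lborel_translate:
  fixes f :: "'a::euclidean_space \<Rightarrow> 'b::{banach, second_countable_topology}"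
  shows "integrable lborel (\<lambda>x. f (x + a)) \<longleftrightarrow> integrable lborel f"
  using integrable_lborel_affine_iff[of 1 f a] by (simp add: add.commute)

lemma nn_integral_lborel_reflect:
  fixes f :: "'a::euclidean_space \<Rightarrow> ennreal"
  assumes "f \<in> borel_measurable borel"
  shows "(\<integral>\<^sup>+x. f (a - x) \<partial>lborel) = (\<integral>\<^sup>+x. f x \<partial>lborel)"
  using nn_integral_lborel_affine[OF assms, of "-1" a] by simp

text \<open>The common shape of most interchanges below: two integrable functions coupled by a
  bounded kernel, in practice a character \<open>cis\<close>.\<close>

lemma Fubini_bounded_kernel:
  fixes f g :: "'a::euclidean_space \<Rightarrow> complex" and \<kappa> :: "'a \<times> 'a \<Rightarrow> complex"
  assumes f: "integrable lborel f" and g: "integrable lborel g"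
    and [measurable]: "\<kappa> \<in> borel_measurable borel" and C: "\<And>p. norm (\<kappa> p) \<le> C"
  shows "(LINT x|lborel. f x * (LINT y|lborel. g y * \<kappa> (x, y))) =
         (LINT y|lborel. g y * (LINT x|lborel. f x * \<kappa> (x, y)))"
    and "integrable (lborel \<Otimes>\<^sub>M lborel) (\<lambda>(x, y). f x * g y * \<kappa> (x, y))"
    and "integrable lborel (\<lambda>x. f x * (LINT y|lborel. g y * \<kappa> (x, y)))"
proof -
  have [measurable]: "f \<in> borel_measurable borel" "g \<in> borel_measurable borel"
    using f g borel_measurable_integrable by fastforce+
  have \<kappa>m[measurable]: "\<kappa> \<in> borel_measurable (borel \<Otimes>\<^sub>M borel)" using assms(3) by (simp add: borel_prod)
  have gk: "integrable lborel (\<lambda>y. g y * \<kappa> (x, y))" for x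
  proof (rule Bochner_Integration.integrable_bound)
    show "integrable lborel (\<lambda>y. C * norm (g y))" using g by simp
    show "AE y in lborel. norm (g y * \<kappa> (x, y)) \<le> norm (C * norm (g y))"
    proof (rule AE_I2)
      fix y
      have "norm (g y * \<kappa> (x, y)) \<le> norm (g y) * C"
        unfolding norm_mult by (intro mult_left_mono C) auto
      also have "\<dots> \<le> norm (C * norm (g y))" by (simp add: mult.commute)
      finally show "norm (g y * \<kappa> (x, y)) \<le> norm (C * norm (g y))" .
    qed
  qed measurable
  have C0: "C \<ge> 0" using C norm_ge_zero order_trans by blast
  show int: "integrable (lborel \<Otimes>\<^sub>M lborel) (\<lambda>(x, y). f x * g y * \<kappa> (x, y))"
  proof (rule lborel_pair.Fubini_integrable)
    show "(\<lambda>(x, y). f x * g y * \<kappa> (x, y)) \<in> borel_measurable (lborel \<Otimes>\<^sub>M lborel)" by measurable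
    show "AE x in lborel. integrable lborel (\<lambda>y. case (x, y) of (x, y) \<Rightarrow> f x * g y * \<kappa> (x, y))"
      using gk by (auto simp: mult.assoc)
    show "integrable lborel (\<lambda>x. LINT y|lborel. norm (case (x, y) of (x, y) \<Rightarrow> f x * g y * \<kappa> (x, y)))"
    proof (rule Bochner_Integration.integrable_bound)
      show "integrable lborel (\<lambda>x. norm (f x) * (C * (LINT y|lborel. norm (g y))))" using f by simp
      show "(\<lambda>x. LINT y|lborel. norm (case (x, y) of (x, y) \<Rightarrow> f x * g y * \<kappa> (x, y))) \<in> borel_measurable lborel"
        by measurable
      show "AE x in lborel. norm (LINT y|lborel. norm (case (x, y) of (x, y) \<Rightarrow> f x * g y * \<kappa> (x, y)))
          \<le> norm (norm (f x) * (C * (LINT y|lborel. norm (g y))))"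
      proof (rule AE_I2)
        fix x
        have "(LINT y|lborel. norm (f x * g y * \<kappa> (x, y))) = norm (f x) * (LINT y|lborel. norm (g y * \<kappa> (x, y)))"
          by (simp add: norm_mult mult.assoc)
        also have "\<dots> \<le> norm (f x) * (LINT y|lborel. C * norm (g y))"
        proof (intro mult_left_mono integral_mono)
          show "integrable lborel (\<lambda>y. norm (g y * \<kappa> (x, y)))" using gk by simp
          show "norm (g y * \<kappa> (x, y)) \<le> C * norm (g y)" for y
            using mult_left_mono[OF C[of "(x, y)"], of "norm (g y)"] by (simp add: norm_mult mult.commute)
        qed (use g in auto)
        finally show "norm (LINT y|lborel. norm (case (x, y) of (x, y) \<Rightarrow> f x * g y * \<kappa> (x, y)))
          \<le> norm (norm (f x) * (C * (LINT y|lborel. norm (g y))))"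
          using C0 by (simp add: integral_nonneg_AE)
      qed
    qed
  qed
  have "(LINT x|lborel. LINT y|lborel. f x * g y * \<kappa> (x, y)) = (LINT y|lborel. LINT x|lborel. f x * g y * \<kappa> (x, y))"
    by (rule lborel_pair.Fubini_integral[symmetric]) (rule int)
  also have "\<dots> = (LINT y|lborel. LINT x|lborel. g y * (f x * \<kappa> (x, y)))"
    by (simp add: mult_ac)
  finally show "(LINT x|lborel. f x * (LINT y|lborel. g y * \<kappa> (x, y))) =
         (LINT y|lborel. g y * (LINT x|lborel. f x * \<kappa> (x, y)))"
    by (simp add: mult.assoc)
  show "integrable lborel (\<lambda>x. f x * (LINT y|lborel. g y * \<kappa> (x, y)))"
    using lborel_pair.integrable_fst'[OF int] by (simp add: mult.assoc)
qed

text \<open>The real part of z is absorbed by completing the square and rescaling to the standard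
  normal density. What remains is its characteristic function at Im z / sqrt (2 l), so no shift of
  contour is involved.\<close>

lemma gaussian_integral_1d:
  fixes z :: complex
  assumes l: "l > 0"
  shows "integrable lborel (\<lambda>s::real. exp (of_real (- l * s\<^sup>2) + of_real s * z))" (is "integrable _ ?f")
    and "(LINT s|lborel. exp (of_real (- l * (s::real)\<^sup>2) + of_real s * z)) = of_real (sqrt (pi / l)) * exp (z\<^sup>2 / (4 * of_real l))"
proof -
  define p q where "p = Re z" and "q = Im z"
  define r where "r = sqrt (2 * l)"
  have r: "r > 0" "r\<^sup>2 = 2 * l" using l by (auto simp: r_def)
  have z: "z = Complex p q" by (simp add: p_def q_def)
  have char: "(LINT x|lborel. of_real (std_normal_density x) * exp (\<i> * of_real (t * x))) = of_real (exp (- (t\<^sup>2) / 2))" for t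
  proof -
    have "(LINT x|lborel. std_normal_density x *\<^sub>R iexp (t * x)) = char std_normal_distribution t"
      unfolding char_def by (subst integral_density) (auto simp: normal_density_nonneg)
    then show ?thesis by (simp add: char_std_normal_distribution scaleR_conv_of_real)
  qed
  have int: "integrable lborel (\<lambda>x. of_real (std_normal_density x) * exp (\<i> * of_real (t * x)))" for t
    by (rule Bochner_Integration.integrable_bound[of _ std_normal_density]) (auto simp: norm_mult)
  define t where "t = q / r"
  define K where "K = of_real (sqrt (2 * pi)) * exp (of_real (p\<^sup>2 / (4 * l)) + \<i> * of_real (q * p / (2 * l)))"
  have eq: "?f (p / (2 * l) + 1 / r * x) = K * (of_real (std_normal_density x) * exp (\<i> * of_real (t * x)))" for x
  proof -
    have "- l * (p / (2 * l) + 1 / r * x)\<^sup>2 + (p / (2 * l) + 1 / r * x) * p = p\<^sup>2 / (4 * l) - l * x\<^sup>2 / r\<^sup>2"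
      using l r(1) by (simp add: field_simps power2_eq_square)
    also have "l * x\<^sup>2 / r\<^sup>2 = x\<^sup>2 / 2" using l r by simp
    finally have 1: "- l * (p / (2 * l) + 1 / r * x)\<^sup>2 + (p / (2 * l) + 1 / r * x) * p = p\<^sup>2 / (4 * l) - x\<^sup>2 / 2" .
    have 2: "(p / (2 * l) + 1 / r * x) * q = q * p / (2 * l) + t * x" by (simp add: t_def algebra_simps)
    have "of_real (- l * (p / (2 * l) + 1 / r * x)\<^sup>2) + of_real (p / (2 * l) + 1 / r * x) * z
        = of_real (p\<^sup>2 / (4 * l) - x\<^sup>2 / 2) + \<i> * of_real (q * p / (2 * l) + t * x)"
      unfolding 1[symmetric] 2[symmetric] z by (simp add: complex_eq_iff)
    then have "?f (p / (2 * l) + 1 / r * x) = exp (of_real (p\<^sup>2 / (4 * l) - x\<^sup>2 / 2) + \<i> * of_real (q * p / (2 * l) + t * x))" by simp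
    also have "\<dots> = exp (of_real (p\<^sup>2 / (4 * l)) + \<i> * of_real (q * p / (2 * l))) * (of_real (exp (- x\<^sup>2 / 2)) * exp (\<i> * of_real (t * x)))"
    proof -
      have "of_real (p\<^sup>2 / (4 * l) - x\<^sup>2 / 2) + \<i> * of_real (q * p / (2 * l) + t * x)
        = (of_real (p\<^sup>2 / (4 * l)) + \<i> * of_real (q * p / (2 * l))) + (of_real (- x\<^sup>2 / 2) + \<i> * of_real (t * x))"
        by (simp add: algebra_simps)
      then show ?thesis by (simp only: exp_add exp_of_real)
    qed
    also have "\<dots> = K * (of_real (std_normal_density x) * exp (\<i> * of_real (t * x)))"
    proof -
      have "complex_of_real (sqrt (2 * pi)) * of_real (std_normal_density x) = of_real (exp (- x\<^sup>2 / 2))"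
        unfolding std_normal_density_def of_real_mult[symmetric] by simp
      then have "exp (of_real (p\<^sup>2 / (4 * l)) + \<i> * of_real (q * p / (2 * l))) * (of_real (exp (- x\<^sup>2 / 2)) * exp (\<i> * of_real (t * x)))
        = exp (of_real (p\<^sup>2 / (4 * l)) + \<i> * of_real (q * p / (2 * l))) * ((complex_of_real (sqrt (2 * pi)) * of_real (std_normal_density x)) * exp (\<i> * of_real (t * x)))"
        by (simp only:)
      then show ?thesis unfolding K_def by (simp only: mult_ac)
    qed
    finally show ?thesis .
  qed
  have "integrable lborel (\<lambda>x. ?f (p / (2 * l) + 1 / r * x))" unfolding eq using int by simp
  then show "integrable lborel ?f" using r by (subst (asm) lborel_integrable_real_affine_iff) auto
  have "(LINT s|lborel. ?f s) = (1 / r) *\<^sub>R (LINT x|lborel. ?f (p / (2 * l) + 1 / r * x))"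
    using lborel_integral_real_affine[of "1 / r" ?f "p / (2 * l)"] r by simp
  also have "\<dots> = of_real (1 / r) * (K * of_real (exp (- (t\<^sup>2) / 2)))"
    unfolding eq integral_mult_right_zero char by (simp add: scaleR_conv_of_real)
  also have "\<dots> = of_real (1 / r * sqrt (2 * pi)) * exp (of_real (p\<^sup>2 / (4 * l)) + \<i> * of_real (q * p / (2 * l)) + of_real (- (t\<^sup>2) / 2))"
    unfolding K_def by (simp only: exp_add exp_of_real of_real_mult mult.assoc)
  also have "1 / r * sqrt (2 * pi) = sqrt (pi / l)"
    using l by (simp add: r_def real_sqrt_divide real_sqrt_mult)
  also have "of_real (p\<^sup>2 / (4 * l)) + \<i> * of_real (q * p / (2 * l)) + of_real (- (t\<^sup>2) / 2) = z\<^sup>2 / (4 * of_real l)"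
  proof -
    have t2: "t\<^sup>2 = q\<^sup>2 / (2 * l)" by (simp add: t_def power_divide r)
    show ?thesis unfolding t2 z using l
      by (simp add: complex_eq_iff power2_eq_square Re_divide Im_divide field_simps)
  qed
  finally show "(LINT s|lborel. ?f s) = of_real (sqrt (pi / l)) * exp (z\<^sup>2 / (4 * of_real l))" .
qed

text \<open>The integral factors over the coordinates. The coefficients are arbitrary complex
  numbers because the generating function below integrates exponentials of y . (w (a + i a') - 2 pi
  i \<xi>).\<close>

lemma gaussian_integral:
  fixes z :: "'a::euclidean_space \<Rightarrow> complex"
  assumes l: "l > 0"
  shows "integrable lborel (\<lambda>y::'a. exp (of_real (- l * (norm y)\<^sup>2) + (\<Sum>b\<in>Basis. of_real (y \<bullet> b) * z b)))" (is ?A)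
    and "(LINT y|lborel. exp (of_real (- l * (norm (y::'a))\<^sup>2) + (\<Sum>b\<in>Basis. of_real (y \<bullet> b) * z b)))
       = of_real (sqrt (pi / l) ^ DIM('a)) * exp ((\<Sum>b\<in>Basis. (z b)\<^sup>2) / (4 * of_real l))" (is ?B)
proof -
  interpret product_sigma_finite "\<lambda>b::'a. lborel :: real measure" ..
  define T where "T = (\<lambda>f. \<Sum>b\<in>Basis. f b *\<^sub>R (b::'a))"
  let ?f = "\<lambda>b (s::real). exp (of_real (- l * s\<^sup>2) + of_real s * z b)"
  let ?F = "\<lambda>y::'a. exp (of_real (- l * (norm y)\<^sup>2) + (\<Sum>b\<in>Basis. of_real (y \<bullet> b) * z b))"
  have T[measurable]: "T \<in> PiM Basis (\<lambda>b::'a. lborel :: real measure) \<rightarrow>\<^sub>M borel" unfolding T_def by measurable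
  have lb: "lborel = distr (PiM Basis (\<lambda>b::'a. lborel :: real measure)) borel T" unfolding T_def by (rule lborel_eq)
  have Fm: "?F \<in> borel_measurable borel" by (intro borel_measurable_continuous_onI continuous_intros)
  have FT: "?F (T x) = (\<Prod>b\<in>Basis. ?f b (x b))" for x :: "'a \<Rightarrow> real"
  proof -
    have ip: "T x \<bullet> b = x b" if "b \<in> Basis" for b unfolding T_def using that by (simp add: inner_sum_left inner_Basis if_distrib sum.delta cong: if_cong)
    have "(norm (T x))\<^sup>2 = (\<Sum>b\<in>Basis. (x b)\<^sup>2)"
      unfolding power2_norm_eq_inner by (subst euclidean_inner) (simp add: ip power2_eq_square)
    then have "of_real (- l * (norm (T x))\<^sup>2) + (\<Sum>b\<in>Basis. of_real (T x \<bullet> b) * z b) = (\<Sum>b\<in>Basis. of_real (- l * (x b)\<^sup>2) + of_real (x b) * z b)"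
      by (simp add: ip sum.distrib sum_distrib_left sum_negf sum_subtractf)
    then show ?thesis by (simp add: exp_sum)
  qed
  have "integrable (PiM Basis (\<lambda>b::'a. lborel :: real measure)) (\<lambda>x. ?F (T x))"
    unfolding FT by (intro product_integrable_prod gaussian_integral_1d[OF l]) auto
  then show ?A by (subst lb) (simp add: integrable_distr_eq Fm)
  have "(LINT y|lborel. ?F y) = (LINT x|PiM Basis (\<lambda>b::'a. lborel :: real measure). ?F (T x))"
    by (subst lb) (simp add: integral_distr Fm)
  also have "\<dots> = (\<Prod>b\<in>Basis. LINT s|lborel. ?f b s)"
    unfolding FT by (intro product_integral_prod gaussian_integral_1d[OF l]) auto
  also have "\<dots> = (\<Prod>b\<in>Basis. of_real (sqrt (pi / l)) * exp ((z b)\<^sup>2 / (4 * of_real l)))"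
    by (intro prod.cong refl gaussian_integral_1d[OF l])
  also have "\<dots> = of_real (sqrt (pi / l) ^ DIM('a)) * exp ((\<Sum>b\<in>Basis. (z b)\<^sup>2) / (4 * of_real l))"
    by (simp add: prod.distrib exp_sum sum_divide_distrib)
  finally show ?B .
qed

lemma fourier_eq_cis:
  "fourier f \<xi> = (LINT x|lborel. f x * cis (- (2 * pi * (x \<bullet> \<xi>))))"
  unfolding fourier_def cis_conv_exp by (simp add: mult_ac)

lemma measurable_cis [measurable (raw)]:
  "f \<in> borel_measurable M \<Longrightarrow> (\<lambda>x. cis (f x)) \<in> borel_measurable M"
  by (rule measurable_compose[where g = cis and N = borel])
     (auto intro!: borel_measurable_continuous_onI continuous_intros)

lemma integrable_mult_cis:
  fixes f :: "'a::euclidean_space \<Rightarrow> complex"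
  assumes "integrable lborel f" "g \<in> borel_measurable borel"
  shows "integrable lborel (\<lambda>x. f x * cis (g x))"
  by (rule Bochner_Integration.integrable_bound[OF assms(1)])
     (use assms in \<open>auto simp: norm_mult intro: borel_measurable_integrable\<close>)

lemma gaussian_fourier:
  fixes x :: "'a::euclidean_space"
  assumes e: "\<epsilon> > 0"
  shows "integrable lborel (\<lambda>\<xi>::'a. exp (- (pi * \<epsilon>\<^sup>2 * (norm \<xi>)\<^sup>2)))"
    and "(LINT \<xi>|lborel. of_real (exp (- (pi * \<epsilon>\<^sup>2 * (norm \<xi>)\<^sup>2))) * cis (2 * pi * (x \<bullet> \<xi>)))
       = complex_of_real (exp (- (pi * (norm x)\<^sup>2 / \<epsilon>\<^sup>2)) / \<epsilon> ^ DIM('a))"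
proof -
  have l: "pi * \<epsilon>\<^sup>2 > 0" using e by simp
  have *: "exp (of_real (- (pi * \<epsilon>\<^sup>2) * (norm \<xi>)\<^sup>2) + (\<Sum>b\<in>Basis. of_real (\<xi> \<bullet> b) * (of_real (2 * pi) * \<i> * of_real (x \<bullet> b))))
      = of_real (exp (- (pi * \<epsilon>\<^sup>2 * (norm \<xi>)\<^sup>2))) * cis (2 * pi * (x \<bullet> \<xi>))" for x \<xi> :: 'a
  proof -
    have "(\<Sum>b\<in>Basis. of_real (\<xi> \<bullet> b) * (of_real (2 * pi) * \<i> * of_real (x \<bullet> b))) = \<i> * of_real (2 * pi * (x \<bullet> \<xi>))"
      by (subst (2) euclidean_inner) (simp add: sum_distrib_left mult_ac)
    then show ?thesis by (simp only: exp_add exp_of_real cis_conv_exp mult_minus_left minus_mult_left[symmetric])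
  qed
  have "integrable lborel (\<lambda>\<xi>::'a. complex_of_real (exp (- (pi * \<epsilon>\<^sup>2 * (norm \<xi>)\<^sup>2))) * cis (2 * pi * (0 \<bullet> \<xi>)))"
    using gaussian_integral(1)[where 'a = 'a, OF l, of "\<lambda>b. of_real (2 * pi) * \<i> * of_real (0 \<bullet> b)"] unfolding * .
  then show "integrable lborel (\<lambda>\<xi>::'a. exp (- (pi * \<epsilon>\<^sup>2 * (norm \<xi>)\<^sup>2)))"
    using integrable_Re by fastforce
  have s: "(\<Sum>b\<in>Basis. (of_real (2 * pi) * \<i> * of_real (x \<bullet> b))\<^sup>2) = of_real (- (4 * pi\<^sup>2 * (norm x)\<^sup>2))"
  proof -
    have "(norm x)\<^sup>2 = (\<Sum>b\<in>Basis. (x \<bullet> b)\<^sup>2)"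
      unfolding power2_norm_eq_inner by (subst euclidean_inner) (simp add: power2_eq_square)
    then show ?thesis by (simp add: power_mult_distrib sum_distrib_left sum_negf mult_ac)
  qed
  have 1: "sqrt (pi / (pi * \<epsilon>\<^sup>2)) = 1 / \<epsilon>" using e by (simp add: real_sqrt_divide)
  have 2: "complex_of_real (- (4 * pi\<^sup>2 * (norm x)\<^sup>2)) / (4 * of_real (pi * \<epsilon>\<^sup>2)) = of_real (- (pi * (norm x)\<^sup>2 / \<epsilon>\<^sup>2))"
    using e by (simp add: field_simps power2_eq_square)
  show "(LINT \<xi>|lborel. of_real (exp (- (pi * \<epsilon>\<^sup>2 * (norm \<xi>)\<^sup>2))) * cis (2 * pi * (x \<bullet> \<xi>)))
       = complex_of_real (exp (- (pi * (norm x)\<^sup>2 / \<epsilon>\<^sup>2)) / \<epsilon> ^ DIM('a))"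
    using gaussian_integral(2)[OF l, of "\<lambda>b. of_real (2 * pi) * \<i> * of_real (x \<bullet> b)"] unfolding * s 1 2 exp_of_real
    by (simp add: power_divide)
qed

lemma integral_gaussian_eq_1: "(LINT x|lborel. exp (- (pi * (norm (x::'a::euclidean_space))\<^sup>2))) = 1"
proof -
  have "complex_of_real (LINT x|lborel. exp (- (pi * (norm (x::'a))\<^sup>2))) = 1"
    using gaussian_fourier(2)[of 1 "0::'a"] by simp
  then show ?thesis by (simp only: of_real_eq_1_iff)
qed

text \<open>The substitution y = x - \<epsilon> z freezes the Gaussian and moves \<epsilon> into the
  argument of H, so dominated convergence needs only boundedness of H and continuity at the one
  point x.\<close>

lemma gaussian_approximate_identity:
  fixes H :: "'a::euclidean_space \<Rightarrow> complex"
  assumes [measurable]: "H \<in> borel_measurable borel" and B: "\<And>x. norm (H x) \<le> B" and cont: "isCont H x"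
  shows "(\<lambda>n. LINT y|lborel. H y * of_real (exp (- (pi * (norm (x - y))\<^sup>2 / (1 / Suc n)\<^sup>2)) / (1 / Suc n) ^ DIM('a))) \<longlonglongrightarrow> H x"
proof -
  let ?g = "\<lambda>z::'a. exp (- (pi * (norm z)\<^sup>2))"
  have g: "integrable lborel ?g" using gaussian_fourier(1)[of 1, where 'a = 'a] by simp
  have eq: "(LINT y|lborel. H y * of_real (exp (- (pi * (norm (x - y))\<^sup>2 / \<epsilon>\<^sup>2)) / \<epsilon> ^ DIM('a)))
    = (LINT z|lborel. H (x + (- \<epsilon>) *\<^sub>R z) * of_real (?g z))" if e: "\<epsilon> > 0" for \<epsilon>
  proof -
    let ?F = "\<lambda>y. H y * of_real (exp (- (pi * (norm (x - y))\<^sup>2 / \<epsilon>\<^sup>2)) / \<epsilon> ^ DIM('a))"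
    have "\<epsilon> ^ DIM('a) *\<^sub>R ?F (x + (- \<epsilon>) *\<^sub>R z) = H (x + (- \<epsilon>) *\<^sub>R z) * of_real (?g z)" for z
    proof -
      have "pi * (norm (x - (x + (- \<epsilon>) *\<^sub>R z)))\<^sup>2 / \<epsilon>\<^sup>2 = pi * (norm z)\<^sup>2"
        using e by (simp add: power_mult_distrib)
      then show ?thesis using e by (simp add: scaleR_conv_of_real)
    qed
    then have "(LINT z|lborel. \<epsilon> ^ DIM('a) *\<^sub>R ?F (x + (- \<epsilon>) *\<^sub>R z)) = (LINT z|lborel. H (x + (- \<epsilon>) *\<^sub>R z) * of_real (?g z))"
      by (simp only:)
    then show ?thesis using integral_lborel_affine[of "- \<epsilon>" ?F x] e by (simp only: integral_scaleR_right abs_minus_cancel abs_of_pos neg_equal_0_iff_equal less_irrefl)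
  qed
  have "(\<lambda>n. LINT z|lborel. H (x + (- (1 / real (Suc n))) *\<^sub>R z) * of_real (?g z)) \<longlonglongrightarrow> (LINT z|lborel. H x * of_real (?g z))"
  proof (rule integral_dominated_convergence[where w = "\<lambda>z. B * ?g z"])
    show "integrable lborel (\<lambda>z. B * ?g z)" using g by simp
    show "AE z in lborel. (\<lambda>n. H (x + (- (1 / real (Suc n))) *\<^sub>R z) * of_real (?g z)) \<longlonglongrightarrow> H x * of_real (?g z)"
    proof (rule AE_I2)
      fix z
      have "(\<lambda>n. x + (- (1 / real (Suc n))) *\<^sub>R z) \<longlonglongrightarrow> x + 0 *\<^sub>R z"
        by (intro tendsto_intros; real_asymp)
      then have "(\<lambda>n. H (x + (- (1 / real (Suc n))) *\<^sub>R z)) \<longlonglongrightarrow> H x"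
        using isCont_tendsto_compose[OF cont] by simp
      then show "(\<lambda>n. H (x + (- (1 / real (Suc n))) *\<^sub>R z) * of_real (?g z)) \<longlonglongrightarrow> H x * of_real (?g z)"
        by (intro tendsto_intros)
    qed
    show "AE z in lborel. norm (H (x + (- (1 / real (Suc n))) *\<^sub>R z) * of_real (?g z)) \<le> B * ?g z" for n
      by (auto simp: norm_mult intro!: mult_right_mono B)
  qed measurable
  also have "(LINT z|lborel. H x * of_real (?g z)) = H x"
    by (simp add: integral_gaussian_eq_1 flip: of_real_exp)
  finally show ?thesis by (subst eq) (simp_all del: of_nat_Suc)
qed

text \<open>Pairing the inverse transform with a Gaussian modulated to the frequency \<xi>0 gives
  the Gaussian average of H around \<xi>0, which tends to H(\<xi>0). Asking for continuity only at
  \<xi>0 matters: the Riesz multipliers are in general discontinuous at the origin.\<close>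

lemma eq_0_of_inverse_fourier_eq_0:
  fixes H :: "'a::euclidean_space \<Rightarrow> complex"
  assumes H: "integrable lborel H" and B: "\<And>x. norm (H x) \<le> B" and cont: "isCont H \<xi>0"
    and zero: "AE x in lborel. (LINT \<xi>|lborel. H \<xi> * cis (2 * pi * (x \<bullet> \<xi>))) = 0"
  shows "H \<xi>0 = 0"
proof -
  have [measurable]: "H \<in> borel_measurable borel" using H borel_measurable_integrable by fastforce
  have "(LINT \<xi>|lborel. H \<xi> * of_real (exp (- (pi * (norm (\<xi>0 - \<xi>))\<^sup>2 / \<epsilon>\<^sup>2)) / \<epsilon> ^ DIM('a))) = 0"
    if e: "\<epsilon> > 0" for \<epsilon>
  proof -
    let ?\<psi> = "\<lambda>x::'a. complex_of_real (exp (- (pi * \<epsilon>\<^sup>2 * (norm x)\<^sup>2))) * cis (- (2 * pi * (x \<bullet> \<xi>0)))"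
    have \<psi>: "integrable lborel ?\<psi>"
      by (rule integrable_mult_cis) (use gaussian_fourier(1)[OF e, where 'a = 'a] in auto)
    have "(LINT x|lborel. ?\<psi> x * (LINT \<xi>|lborel. H \<xi> * cis (2 * pi * (x \<bullet> \<xi>)))) = (LINT x|(lborel :: 'a measure). 0)"
      by (rule integral_cong_AE) (use zero in \<open>auto intro!: borel_measurable_integrable \<psi>\<close>)
    also have "(LINT x|lborel. ?\<psi> x * (LINT \<xi>|lborel. H \<xi> * cis (2 * pi * (x \<bullet> \<xi>)))) =
       (LINT \<xi>|lborel. H \<xi> * (LINT x|lborel. ?\<psi> x * cis (2 * pi * (x \<bullet> \<xi>))))"
      using Fubini_bounded_kernel(1)[OF \<psi> H, of "\<lambda>(x, \<xi>). cis (2 * pi * (x \<bullet> \<xi>))" 1]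
      by (simp add: split_beta borel_prod[symmetric])
    also have "(\<lambda>\<xi>. LINT x|lborel. ?\<psi> x * cis (2 * pi * (x \<bullet> \<xi>)))
      = (\<lambda>\<xi>. of_real (exp (- (pi * (norm (\<xi> - \<xi>0))\<^sup>2 / \<epsilon>\<^sup>2)) / \<epsilon> ^ DIM('a)))"
    proof
      fix \<xi> :: 'a
      have "?\<psi> x * cis (2 * pi * (x \<bullet> \<xi>)) = complex_of_real (exp (- (pi * \<epsilon>\<^sup>2 * (norm x)\<^sup>2))) * cis (2 * pi * ((\<xi> - \<xi>0) \<bullet> x))" for x
        unfolding mult.assoc cis_mult by (simp add: inner_diff_left inner_diff_right inner_commute algebra_simps)
      then show "(LINT x|lborel. ?\<psi> x * cis (2 * pi * (x \<bullet> \<xi>))) = of_real (exp (- (pi * (norm (\<xi> - \<xi>0))\<^sup>2 / \<epsilon>\<^sup>2)) / \<epsilon> ^ DIM('a))"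
        by (simp only: gaussian_fourier(2)[OF e])
    qed
    finally show ?thesis by (simp add: norm_minus_commute)
  qed
  then have "(\<lambda>n. LINT y|lborel. H y * of_real (exp (- (pi * (norm (\<xi>0 - y))\<^sup>2 / (1 / Suc n)\<^sup>2)) / (1 / Suc n) ^ DIM('a))) = (\<lambda>n. 0)"
    by (intro ext) (simp del: of_nat_Suc)
  with gaussian_approximate_identity[OF _ B cont] have "(\<lambda>n::nat. 0) \<longlonglongrightarrow> H \<xi>0"
    by (simp only: \<open>H \<in> borel_measurable borel\<close>)
  then show ?thesis by (simp only: LIMSEQ_const_iff)
qed

section \<open>Convolution with an integrable kernel on \<open>L\<^sup>2\<close>\<close>

lemma integral_abs_diff_translate_le:
  fixes f g :: "'a::euclidean_space \<Rightarrow> real"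
  assumes f: "integrable lborel f" and g: "integrable lborel g"
  shows "(LINT x|lborel. \<bar>f (x + h) - f x\<bar>) \<le>
    2 * (LINT x|lborel. \<bar>f x - g x\<bar>) + (LINT x|lborel. \<bar>g (x + h) - g x\<bar>)"
proof -
  note tr = integrable_lborel_translate[THEN iffD2]
  have "(LINT x|lborel. \<bar>f (x + h) - f x\<bar>)
      \<le> (LINT x|lborel. \<bar>f (x + h) - g (x + h)\<bar> + \<bar>f x - g x\<bar> + \<bar>g (x + h) - g x\<bar>)"
    by (intro integral_mono integrable_abs Bochner_Integration.integrable_diff Bochner_Integration.integrable_add
        f g tr[OF f] tr[OF g]) linarith
  also have "\<dots> = (LINT x|lborel. \<bar>f (x + h) - g (x + h)\<bar>) + (LINT x|lborel. \<bar>f x - g x\<bar>) + (LINT x|lborel. \<bar>g (x + h) - g x\<bar>)"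
    using f g tr[OF f] tr[OF g] by simp
  also have "(LINT x|lborel. \<bar>f (x + h) - g (x + h)\<bar>) = (LINT x|lborel. \<bar>f x - g x\<bar>)"
    by (rule integral_lborel_translate)
  finally show ?thesis by simp
qed

lemma L1_translation_tendsto_of_approx:
  fixes f :: "'a::euclidean_space \<Rightarrow> real"
  assumes f: "integrable lborel f"
    and approx: "\<And>\<epsilon>. \<epsilon> > 0 \<Longrightarrow> \<exists>g. integrable lborel g \<and> (LINT x|lborel. \<bar>f x - g x\<bar>) \<le> \<epsilon> \<and>
      (\<lambda>n. LINT x|lborel. \<bar>g (x + h n) - g x\<bar>) \<longlonglongrightarrow> 0"
  shows "(\<lambda>n::nat. LINT x|lborel. \<bar>f (x + h n) - f x\<bar>) \<longlonglongrightarrow> 0"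
proof (rule tendstoI)
  fix \<epsilon> :: real assume \<epsilon>: "\<epsilon> > 0"
  then obtain g where g: "integrable lborel g" "(LINT x|lborel. \<bar>f x - g x\<bar>) \<le> \<epsilon> / 4"
      "(\<lambda>n. LINT x|lborel. \<bar>g (x + h n) - g x\<bar>) \<longlonglongrightarrow> 0"
    using approx[of "\<epsilon> / 4"] by auto
  have "\<forall>\<^sub>F n in sequentially. (LINT x|lborel. \<bar>g (x + h n) - g x\<bar>) < \<epsilon> / 2"
    using \<epsilon> by (intro order_tendstoD(2)[OF g(3)]) auto
  then show "\<forall>\<^sub>F n in sequentially. dist (LINT x|lborel. \<bar>f (x + h n) - f x\<bar>) 0 < \<epsilon>"
  proof eventually_elim
    case (elim n)
    have "(LINT x|lborel. \<bar>f (x + h n) - f x\<bar>) < \<epsilon>"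
      using integral_abs_diff_translate_le[OF f g(1), of "h n"] g(2) elim \<epsilon> by linarith
    moreover have "(LINT x|lborel. \<bar>f (x + h n) - f x\<bar>) \<ge> 0" by (simp add: integral_nonneg_AE)
    ultimately show ?case by (simp add: dist_real_def)
  qed
qed

text \<open>The integrand is the sum of the two indicators minus twice their product. Translation
  invariance fixes the integrals of the indicators, so only the product has to converge; it vanishes
  outside U, and inside U openness keeps x + h n in U eventually. Boundary points, where the
  translated indicators may fail to converge, do no harm.\<close>

lemma L1_translation_tendsto_open:
  fixes U :: "'a::euclidean_space set"
  assumes U: "open U" "emeasure lborel U < \<infinity>" and h: "h \<longlonglongrightarrow> 0"
  shows "(\<lambda>n::nat. LINT x|lborel. \<bar>indicator U (x + h n) - indicator U x\<bar> :: real) \<longlonglongrightarrow> 0"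
proof -
  have [measurable]: "U \<in> sets borel" using U by simp
  have i: "integrable lborel (indicator U :: 'a \<Rightarrow> real)" using U by (intro integrable_real_indicator) auto
  have ih: "integrable lborel (\<lambda>x. indicator U (x + h n) :: real)" for n
    using integrable_lborel_translate[THEN iffD2, OF i] .
  have ip: "integrable lborel (\<lambda>x. indicator U x * indicator U (x + h n) :: real)" for n
    by (rule Bochner_Integration.integrable_bound[OF i]) (auto split: split_indicator)
  have eq: "(LINT x|lborel. \<bar>indicator U (x + h n) - indicator U x\<bar> :: real)
     = 2 * (LINT x|lborel. indicator U x) - 2 * (LINT x|lborel. indicator U x * indicator U (x + h n))" for n
  proof -
    have "(LINT x|lborel. \<bar>indicator U (x + h n) - indicator U x\<bar> :: real)
       = (LINT x|lborel. indicator U (x + h n) + indicator U x - 2 * (indicator U x * indicator U (x + h n)))"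
      by (intro Bochner_Integration.integral_cong) (auto split: split_indicator)
    also have "\<dots> = (LINT x|lborel. indicator U (x + h n)) + (LINT x|lborel. indicator U x)
        - 2 * (LINT x|lborel. indicator U x * indicator U (x + h n))"
      using i ih ip by simp
    also have "(LINT x|lborel. indicator U (x + h n) :: real) = (LINT x|lborel. indicator U x)"
      by (rule integral_lborel_translate)
    finally show ?thesis by simp
  qed
  have "(\<lambda>n. LINT x|lborel. indicator U x * indicator U (x + h n) :: real) \<longlonglongrightarrow> (LINT x|lborel. indicator U x)"
  proof (rule integral_dominated_convergence[where w = "indicator U"])
    show "AE x in lborel. (\<lambda>n. indicator U x * indicator U (x + h n) :: real) \<longlonglongrightarrow> indicator U x"
    proof (rule AE_I2)
      fix x
      show "(\<lambda>n. indicator U x * indicator U (x + h n) :: real) \<longlonglongrightarrow> indicator U x"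
      proof (cases "x \<in> U")
        case True
        have "(\<lambda>n. x + h n) \<longlonglongrightarrow> x + 0" by (intro tendsto_intros h)
        then have "\<forall>\<^sub>F n in sequentially. x + h n \<in> U"
          using True U(1) by (intro topological_tendstoD) auto
        then have "\<forall>\<^sub>F n in sequentially. indicator U x * indicator U (x + h n) = (indicator U x :: real)"
          by eventually_elim (use True in auto)
        then show ?thesis by (rule tendsto_eventually)
      qed simp
    qed
  qed (use i in \<open>auto split: split_indicator\<close>)
  then have "(\<lambda>n. 2 * (LINT x|lborel. indicator U x) - 2 * (LINT x|lborel. indicator U x * indicator U (x + h n)) :: real)
     \<longlonglongrightarrow> 2 * (LINT x|lborel. indicator U x) - 2 * (LINT x|lborel. indicator U x)"
    by (intro tendsto_intros)
  then show ?thesis unfolding eq by simp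
qed

text \<open>Indicators of Borel sets of finite measure are reduced to open sets by outer regularity;
  sums and dominated limits then reach every integrable function.\<close>

lemma L1_translation_tendsto:
  fixes f :: "'a::euclidean_space \<Rightarrow> real"
  assumes f: "integrable lborel f" and h: "h \<longlonglongrightarrow> 0"
  shows "(\<lambda>n::nat. LINT x|lborel. \<bar>f (x + h n) - f x\<bar>) \<longlonglongrightarrow> 0"
  using f
proof (induction rule: integrable_induct)
  case (base A c)
  have A: "A \<in> sets borel" "emeasure lborel A < \<infinity>" using base by auto
  have iA: "integrable lborel (indicator A :: 'a \<Rightarrow> real)" using base by (intro integrable_real_indicator) auto
  have "(\<lambda>n. LINT x|lborel. \<bar>indicator A (x + h n) - indicator A x\<bar> :: real) \<longlonglongrightarrow> 0"
  proof (rule L1_translation_tendsto_of_approx[OF iA])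
    fix \<epsilon> :: real assume \<epsilon>: "\<epsilon> > 0"
    obtain U where U: "open U" "A \<subseteq> U" "emeasure lborel (U - A) < \<epsilon>"
      using outer_regular_lborel[OF A(1) \<epsilon>] by blast
    have mU: "U \<in> sets borel" using U by simp
    have "emeasure lborel U = emeasure lborel A + emeasure lborel (U - A)"
      using U A mU by (subst plus_emeasure) (auto intro!: arg_cong2[where f = emeasure])
    also have "\<dots> < \<infinity>" using U(3) A(2) by (simp add: less_top[symmetric]) (metis ennreal_less_top order_less_trans less_top)
    finally have fU: "emeasure lborel U < \<infinity>" .
    have iU: "integrable lborel (indicator U :: 'a \<Rightarrow> real)" using fU mU by (intro integrable_real_indicator) auto
    have "(LINT x|lborel. \<bar>indicator A x - indicator U x\<bar> :: real) = (LINT x|lborel. indicator (U - A) x)"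
      using U(2) by (intro Bochner_Integration.integral_cong) (auto split: split_indicator)
    also have "\<dots> = measure lborel (U - A)" by simp
    also have "\<dots> \<le> \<epsilon>" using U(3) \<epsilon> by (simp add: measure_def enn2real_leI)
    finally show "\<exists>g. integrable lborel g \<and> (LINT x|lborel. \<bar>indicator A x - g x\<bar>) \<le> \<epsilon> \<and>
      (\<lambda>n. LINT x|lborel. \<bar>g (x + h n) - g x\<bar>) \<longlonglongrightarrow> 0"
      using L1_translation_tendsto_open[OF U(1) fU h] iU by blast
  qed
  then have "(\<lambda>n. \<bar>c\<bar> * (LINT x|lborel. \<bar>indicator A (x + h n) - indicator A x\<bar>)) \<longlonglongrightarrow> \<bar>c\<bar> * 0"
    by (intro tendsto_intros)
  moreover have "\<bar>c\<bar> * (LINT x|lborel. \<bar>indicator A (x + h n) - indicator A x\<bar>)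
     = (LINT x|lborel. \<bar>indicator A (x + h n) *\<^sub>R c - indicator A x *\<^sub>R c\<bar>)" for n
    by (subst integral_mult_right_zero[symmetric]) (simp add: abs_mult[symmetric] algebra_simps)
  ultimately show ?case by simp
next
  case (add f g)
  show ?case
  proof (rule Lim_null_comparison)
    show "\<forall>\<^sub>F n in sequentially. norm (LINT x|lborel. \<bar>f (x + h n) + g (x + h n) - (f x + g x)\<bar>)
      \<le> (LINT x|lborel. \<bar>f (x + h n) - f x\<bar>) + (LINT x|lborel. \<bar>g (x + h n) - g x\<bar>)"
    proof (rule always_eventually, rule allI)
      fix n
      have i: "integrable lborel (\<lambda>x. f (x + h n))" "integrable lborel (\<lambda>x. g (x + h n))"
        using add integrable_lborel_translate by blast+
      have "(LINT x|lborel. \<bar>f (x + h n) + g (x + h n) - (f x + g x)\<bar>)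
        \<le> (LINT x|lborel. \<bar>f (x + h n) - f x\<bar> + \<bar>g (x + h n) - g x\<bar>)"
        using add i by (intro integral_mono) auto
      also have "\<dots> = (LINT x|lborel. \<bar>f (x + h n) - f x\<bar>) + (LINT x|lborel. \<bar>g (x + h n) - g x\<bar>)"
        using add i by simp
      finally show "norm (LINT x|lborel. \<bar>f (x + h n) + g (x + h n) - (f x + g x)\<bar>)
        \<le> (LINT x|lborel. \<bar>f (x + h n) - f x\<bar>) + (LINT x|lborel. \<bar>g (x + h n) - g x\<bar>)"
        by (simp add: integral_nonneg_AE)
    qed
    show "(\<lambda>n. (LINT x|lborel. \<bar>f (x + h n) - f x\<bar>) + (LINT x|lborel. \<bar>g (x + h n) - g x\<bar>)) \<longlonglongrightarrow> 0"
      using tendsto_add[OF add.IH] by simp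
  qed
next
  case (lim f s)
  show ?case
  proof (rule L1_translation_tendsto_of_approx[OF lim.hyps(4)])
    fix \<epsilon> :: real assume \<epsilon>: "\<epsilon> > 0"
    have "(\<lambda>i. LINT x|lborel. \<bar>f x - s i x\<bar>) \<longlonglongrightarrow> (LINT x|(lborel :: 'a measure). 0)"
    proof (rule integral_dominated_convergence[where w = "\<lambda>x. 3 * \<bar>f x\<bar>"])
      show "AE x in lborel. (\<lambda>i. \<bar>f x - s i x\<bar>) \<longlonglongrightarrow> 0"
      proof (rule AE_I2)
        fix x
        have "(\<lambda>i. \<bar>f x - s i x\<bar>) \<longlonglongrightarrow> \<bar>f x - f x\<bar>" using lim.hyps(2) by (intro tendsto_intros) auto
        then show "(\<lambda>i. \<bar>f x - s i x\<bar>) \<longlonglongrightarrow> 0" by simp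
      qed
      show "AE x in lborel. norm \<bar>f x - s i x\<bar> \<le> 3 * \<bar>f x\<bar>" for i
      proof (rule AE_I2)
        fix x
        have "\<bar>s i x\<bar> \<le> 2 * \<bar>f x\<bar>" using lim.hyps(3)[of x i] by simp
        then show "norm \<bar>f x - s i x\<bar> \<le> 3 * \<bar>f x\<bar>" unfolding real_norm_def by linarith
      qed
    qed (use lim.hyps in auto)
    then have "\<forall>\<^sub>F i in sequentially. (LINT x|lborel. \<bar>f x - s i x\<bar>) < \<epsilon>"
      using \<epsilon> by (intro order_tendstoD(2)) auto
    then obtain i where "(LINT x|lborel. \<bar>f x - s i x\<bar>) < \<epsilon>" by (auto simp: eventually_sequentially)
    then show "\<exists>g. integrable lborel g \<and> (LINT x|lborel. \<bar>f x - g x\<bar>) \<le> \<epsilon> \<and>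
      (\<lambda>n. LINT x|lborel. \<bar>g (x + h n) - g x\<bar>) \<longlonglongrightarrow> 0"
      using lim.hyps(1) lim.IH by (intro exI[of _ "s i"]) auto
  qed
qed

lemma integrable_mult_bounded:
  fixes f g :: "'a::euclidean_space \<Rightarrow> 'b::{real_normed_field, second_countable_topology, banach}"
  assumes "integrable lborel f" "g \<in> borel_measurable borel" "\<And>x. norm (g x) \<le> B"
  shows "integrable lborel (\<lambda>x. f x * g x)"
proof (rule Bochner_Integration.integrable_bound)
  show "integrable lborel (\<lambda>x. B * norm (f x))" using assms(1) by simp
  show "AE x in lborel. norm (f x * g x) \<le> norm (B * norm (f x))"
  proof (rule AE_I2)
    fix x
    have "norm (f x) * norm (g x) \<le> norm (f x) * \<bar>B\<bar>"
      using assms(3)[of x] by (intro mult_left_mono) auto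
    then show "norm (f x * g x) \<le> norm (B * norm (f x))" by (simp add: norm_mult abs_mult mult.commute)
  qed
qed (use assms in \<open>auto intro: borel_measurable_integrable\<close>)

text \<open>Since f is merely bounded and measurable, the continuity must come from b: after moving
  x into b, the increment is at most B times the L^1 distance of b from a translate. It makes the
  Gaussian averages of the convolution converge pointwise.\<close>

lemma isCont_convolution:
  fixes b :: "'a::euclidean_space \<Rightarrow> real"
  assumes b: "integrable lborel b" and [measurable]: "f \<in> borel_measurable borel" and B: "\<And>x. norm (f x) \<le> B"
  shows "isCont (convolution b f) x"
proof -
  have conv: "convolution b f x = (LINT y|lborel. of_real (b (x - y)) * f y)" for x
    unfolding convolution_def
    using integral_lborel_reflect[of "\<lambda>y. of_real (b (x - y)) * f y" x] by simp
  have int: "integrable lborel (\<lambda>y. of_real (b (x - y)) * f y)" for x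
    by (rule integrable_mult_bounded[where B = B])
       (use b B integrable_lborel_reflect[of b x] in auto)
  show ?thesis
    unfolding continuous_at_sequentially comp_def
  proof (intro allI impI)
    fix z assume z: "z \<longlonglongrightarrow> x"
    have "(\<lambda>n. convolution b f (z n) - convolution b f x) \<longlonglongrightarrow> 0"
    proof (rule Lim_null_comparison)
      show "\<forall>\<^sub>F n in sequentially. norm (convolution b f (z n) - convolution b f x)
         \<le> B * (LINT y|lborel. \<bar>b (y + (z n - x)) - b y\<bar>)"
      proof (rule always_eventually, rule allI)
        fix n
        have i: "integrable lborel (\<lambda>y. B * \<bar>b (z n - y) - b (x - y)\<bar>)"
          using b integrable_lborel_reflect[of b] by simp
        have "convolution b f (z n) - convolution b f x = (LINT y|lborel. of_real (b (z n - y) - b (x - y)) * f y)"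
          unfolding conv by (subst Bochner_Integration.integral_diff[symmetric]) (use int in \<open>auto simp: algebra_simps\<close>)
        also have "norm \<dots> \<le> (LINT y|lborel. B * \<bar>b (z n - y) - b (x - y)\<bar>)"
        proof (rule order_trans[OF integral_norm_bound integral_mono])
          have "integrable lborel (\<lambda>y. of_real (b (z n - y) - b (x - y)) * f y)"
            using Bochner_Integration.integrable_diff[OF int int] by (simp add: algebra_simps)
          then show "integrable lborel (\<lambda>y. norm (of_real (b (z n - y) - b (x - y)) * f y))" by simp
          show "norm (of_real (b (z n - y) - b (x - y)) * f y) \<le> B * \<bar>b (z n - y) - b (x - y)\<bar>" for y
            using mult_left_mono[OF B, of "\<bar>b (z n - y) - b (x - y)\<bar>" y]
            by (simp add: norm_mult mult.commute flip: of_real_diff)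
        qed (use i in auto)
        also have "\<dots> = B * (LINT y|lborel. \<bar>b (y + (z n - x)) - b y\<bar>)"
          using integral_lborel_reflect[of "\<lambda>y. \<bar>b (y + (z n - x)) - b y\<bar>" x] by (simp add: algebra_simps)
        finally show "norm (convolution b f (z n) - convolution b f x)
         \<le> B * (LINT y|lborel. \<bar>b (y + (z n - x)) - b y\<bar>)" .
      qed
      have "(\<lambda>n. z n - x) \<longlonglongrightarrow> 0" using z by (simp add: LIM_zero_iff)
      from tendsto_mult[OF tendsto_const[of B] L1_translation_tendsto[OF b this]]
      show "(\<lambda>n. B * (LINT y|lborel. \<bar>b (y + (z n - x)) - b y\<bar>)) \<longlonglongrightarrow> 0" by simp
    qed
    then show "(\<lambda>n. convolution b f (z n)) \<longlonglongrightarrow> convolution b f x" by (simp add: LIM_zero_iff)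
  qed
qed

section \<open>Fourier transforms and convolutions\<close>

lemma norm_fourier_le: "norm (fourier f \<xi>) \<le> (LINT x|lborel. norm (f x))"
  unfolding fourier_eq_cis by (rule order_trans[OF integral_norm_bound]) (simp add: norm_mult)

lemma measurable_cnj [measurable (raw)]:
  "f \<in> borel_measurable M \<Longrightarrow> (\<lambda>x. cnj (f x)) \<in> borel_measurable M"
  by (rule measurable_compose[where g = cnj and N = borel])
     (auto intro!: borel_measurable_continuous_onI continuous_intros)

lemma borel_measurable_fourier [measurable]:
  assumes [measurable]: "f \<in> borel_measurable borel"
  shows "fourier f \<in> borel_measurable borel"
  unfolding fourier_eq_cis[abs_def] by measurable

lemma isCont_fourier:
  fixes f :: "'a::euclidean_space \<Rightarrow> complex"
  assumes f: "integrable lborel f" shows "isCont (fourier f) \<xi>"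
  unfolding continuous_at_sequentially comp_def fourier_eq_cis
proof (intro allI impI)
  fix z assume z: "z \<longlonglongrightarrow> \<xi>"
  show "(\<lambda>n. LINT x|lborel. f x * cis (- (2 * pi * (x \<bullet> z n)))) \<longlonglongrightarrow> (LINT x|lborel. f x * cis (- (2 * pi * (x \<bullet> \<xi>))))"
  proof (rule integral_dominated_convergence[where w = "\<lambda>x. norm (f x)"])
    show "AE x in lborel. (\<lambda>n. f x * cis (- (2 * pi * (x \<bullet> z n)))) \<longlonglongrightarrow> f x * cis (- (2 * pi * (x \<bullet> \<xi>)))"
      by (intro AE_I2 tendsto_intros z)
  qed (use f in \<open>auto simp: norm_mult intro!: borel_measurable_integrable integrable_mult_cis\<close>)
qed

lemma nn_integral_convolution:
  fixes b p :: "'a::euclidean_space \<Rightarrow> ennreal"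
  assumes [measurable]: "b \<in> borel_measurable borel" "p \<in> borel_measurable borel"
  shows "(\<integral>\<^sup>+x. \<integral>\<^sup>+y. b y * p (x - y) \<partial>lborel \<partial>lborel) = (\<integral>\<^sup>+x. b x \<partial>lborel) * (\<integral>\<^sup>+x. p x \<partial>lborel)"
proof -
  have "(\<integral>\<^sup>+x. \<integral>\<^sup>+y. b y * p (x - y) \<partial>lborel \<partial>lborel) = (\<integral>\<^sup>+y. \<integral>\<^sup>+x. b y * p (x - y) \<partial>lborel \<partial>lborel)"
    by (rule lborel_pair.Fubini'[symmetric]) measurable
  also have "\<dots> = (\<integral>\<^sup>+y. b y * (\<integral>\<^sup>+x. p x \<partial>lborel) \<partial>lborel)"
  proof (rule nn_integral_cong)
    fix y :: 'a
    have "(\<integral>\<^sup>+x. p x \<partial>lborel) = (\<integral>\<^sup>+x. p (x - y) \<partial>lborel)"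
      using nn_integral_lborel_affine[of p 1 "- y"] by (simp add: algebra_simps)
    then show "(\<integral>\<^sup>+x. b y * p (x - y) \<partial>lborel) = b y * (\<integral>\<^sup>+x. p x \<partial>lborel)"
      by (simp add: nn_integral_cmult)
  qed
  finally show ?thesis by (simp add: nn_integral_multc)
qed

lemma borel_measurable_convolution [measurable]:
  assumes [measurable]: "b \<in> borel_measurable borel" "f \<in> borel_measurable borel"
  shows "convolution b f \<in> borel_measurable borel"
  unfolding convolution_def[abs_def] by measurable

lemma integrable_convolution_pair:
  fixes b :: "'a::euclidean_space \<Rightarrow> real"
  assumes b: "integrable lborel b" and f: "integrable lborel f"
  shows "integrable (lborel \<Otimes>\<^sub>M lborel) (\<lambda>(x, y). complex_of_real (b y) * f (x - y))"
proof -
  have [measurable]: "b \<in> borel_measurable borel" "f \<in> borel_measurable borel"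
    using b f borel_measurable_integrable by fastforce+
  show ?thesis
  proof (rule integrableI_bounded)
    have "(\<integral>\<^sup>+p. norm (case p of (x, y) \<Rightarrow> complex_of_real (b y) * f (x - y)) \<partial>(lborel \<Otimes>\<^sub>M lborel))
       = (\<integral>\<^sup>+x. \<integral>\<^sup>+y. ennreal (norm (b y)) * ennreal (norm (f (x - y))) \<partial>lborel \<partial>lborel)"
      by (subst lborel.nn_integral_fst[symmetric]) (auto simp: norm_mult ennreal_mult')
    also have "\<dots> = (\<integral>\<^sup>+x. norm (b x) \<partial>lborel) * (\<integral>\<^sup>+x. norm (f x) \<partial>lborel)"
      by (rule nn_integral_convolution) measurable
    also have "\<dots> < \<infinity>" using b f by (auto simp: integrable_iff_bounded ennreal_mult_less_top)
    finally show "(\<integral>\<^sup>+p. norm (case p of (x, y) \<Rightarrow> complex_of_real (b y) * f (x - y)) \<partial>(lborel \<Otimes>\<^sub>M lborel)) < \<infinity>" .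
  qed measurable
qed

lemma integrable_convolution:
  fixes b :: "'a::euclidean_space \<Rightarrow> real"
  assumes "integrable lborel b" "integrable lborel f"
  shows "integrable lborel (convolution b f)"
  using lborel_pair.integrable_fst'[OF integrable_convolution_pair[OF assms]] by (simp add: convolution_def[abs_def])

lemma fourier_convolution:
  fixes b :: "'a::euclidean_space \<Rightarrow> real"
  assumes b: "integrable lborel b" and f: "integrable lborel f"
  shows "fourier (convolution b f) \<xi> = fourier (\<lambda>x. of_real (b x)) \<xi> * fourier f \<xi>"
proof -
  have [measurable]: "b \<in> borel_measurable borel" "f \<in> borel_measurable borel"
    using b f borel_measurable_integrable by fastforce+
  let ?e = "\<lambda>x. cis (- (2 * pi * (x \<bullet> \<xi>)))"
  have int: "integrable (lborel \<Otimes>\<^sub>M lborel) (\<lambda>(x, y). complex_of_real (b y) * f (x - y) * ?e x)"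
    by (rule Bochner_Integration.integrable_bound[OF integrable_convolution_pair[OF b f]])
       (auto simp: norm_mult)
  have "fourier (convolution b f) \<xi> = (LINT x|lborel. LINT y|lborel. complex_of_real (b y) * f (x - y) * ?e x)"
    unfolding fourier_eq_cis convolution_def by simp
  also have "\<dots> = (LINT y|lborel. LINT x|lborel. complex_of_real (b y) * f (x - y) * ?e x)"
    by (rule lborel_pair.Fubini_integral[symmetric]) (rule int)
  also have "\<dots> = (LINT y|lborel. of_real (b y) * ?e y * fourier f \<xi>)"
  proof (rule Bochner_Integration.integral_cong[OF refl])
    fix y :: 'a
    have "(LINT x|lborel. complex_of_real (b y) * f (x - y) * ?e x) = (LINT x|lborel. complex_of_real (b y) * f (x + y - y) * ?e (x + y))"
      by (rule integral_lborel_translate[symmetric])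
    also have "\<dots> = (LINT x|lborel. (of_real (b y) * ?e y) * (f x * ?e x))"
    proof (rule Bochner_Integration.integral_cong[OF refl])
      fix x
      have "?e (x + y) = ?e y * ?e x" unfolding cis_mult by (simp add: inner_add_left algebra_simps)
      then show "complex_of_real (b y) * f (x + y - y) * ?e (x + y) = (of_real (b y) * ?e y) * (f x * ?e x)"
        by (simp only: add_diff_cancel_right' mult_ac)
    qed
    also have "\<dots> = of_real (b y) * ?e y * fourier f \<xi>" unfolding fourier_eq_cis by simp
    finally show "(LINT x|lborel. complex_of_real (b y) * f (x - y) * ?e x) = of_real (b y) * ?e y * fourier f \<xi>" .
  qed
  finally show ?thesis by (simp add: fourier_eq_cis)
qed

text \<open>No integrability is assumed: the Bochner integral of a non-integrable function is
  0.\<close>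

lemma norm_integral_le_nn_integral:
  fixes f :: "'a \<Rightarrow> 'b::{banach, second_countable_topology}"
  shows "ennreal (norm (integral\<^sup>L M f)) \<le> (\<integral>\<^sup>+x. norm (f x) \<partial>M)"
  by (cases "integrable M f") (auto simp: integral_norm_bound_ennreal not_integrable_integral_eq)

section \<open>Gaussian regularisation of the L^2 norm\<close>

definition gauss_kernel :: "real \<Rightarrow> 'a::euclidean_space \<Rightarrow> real" where
  "gauss_kernel \<epsilon> x = exp (- (pi * (norm x)\<^sup>2 / \<epsilon>\<^sup>2)) / \<epsilon> ^ DIM('a)"

lemma borel_measurable_gauss_kernel [measurable]: "gauss_kernel \<epsilon> \<in> borel_measurable borel"
  unfolding gauss_kernel_def[abs_def] by measurable

lemma gauss_kernel_nonneg: "\<epsilon> > 0 \<Longrightarrow> gauss_kernel \<epsilon> x \<ge> 0"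
  by (simp add: gauss_kernel_def)

lemma gauss_kernel_integral:
  assumes e: "\<epsilon> > 0"
  shows "integrable lborel (gauss_kernel \<epsilon> :: 'a::euclidean_space \<Rightarrow> real)"
    and "(LINT x|lborel. gauss_kernel \<epsilon> (x :: 'a)) = 1"
    and "(\<integral>\<^sup>+x. gauss_kernel \<epsilon> (x :: 'a) \<partial>lborel) = 1"
proof -
  have "(\<lambda>x::'a. exp (- (pi * (1 / \<epsilon>)\<^sup>2 * (norm x)\<^sup>2)) / \<epsilon> ^ DIM('a)) = gauss_kernel \<epsilon>"
    by (simp add: gauss_kernel_def[abs_def] power_divide)
  then show i: "integrable lborel (gauss_kernel \<epsilon> :: 'a \<Rightarrow> real)"
    using gaussian_fourier(1)[of "1 / \<epsilon>", where 'a = 'a] e integrable_divide[of lborel _ "\<epsilon> ^ DIM('a)"] by (metis zero_less_divide_1_iff)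
  have "\<epsilon> ^ DIM('a) *\<^sub>R gauss_kernel \<epsilon> (0 + \<epsilon> *\<^sub>R x) = exp (- (pi * (norm x)\<^sup>2))" for x :: 'a
    using e by (simp add: gauss_kernel_def power_mult_distrib)
  then have "(LINT x|lborel. \<epsilon> ^ DIM('a) *\<^sub>R gauss_kernel \<epsilon> (0 + \<epsilon> *\<^sub>R x :: 'a)) = 1"
    using integral_gaussian_eq_1[where 'a = 'a] by (simp only:)
  then show "(LINT x|lborel. gauss_kernel \<epsilon> (x :: 'a)) = 1"
    using integral_lborel_affine[of \<epsilon> "gauss_kernel \<epsilon> :: 'a \<Rightarrow> real" 0] e by simp
  with i show "(\<integral>\<^sup>+x. gauss_kernel \<epsilon> (x :: 'a) \<partial>lborel) = 1"
    using gauss_kernel_nonneg[OF e] by (subst nn_integral_eq_integral) auto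
qed

text \<open>A substitute for Plancherel: as \<open>\<epsilon> \<longlongrightarrow> 0\<close> both sides tend to \<open>\<parallel>f\<parallel>\<^sup>2\<close> for bounded continuous \<open>f\<close>, and the left-hand side is
  monotone in \<open>\<bar>fourier f\<bar>\<close>.\<close>

lemma gaussian_quadratic_form:
  fixes f :: "'a::euclidean_space \<Rightarrow> complex"
  assumes f: "integrable lborel f" and e: "\<epsilon> > 0"
  shows "integrable lborel (\<lambda>\<xi>. (norm (fourier f \<xi>))\<^sup>2 * exp (- (pi * \<epsilon>\<^sup>2 * (norm \<xi>)\<^sup>2)))"
    and "complex_of_real (LINT \<xi>|lborel. (norm (fourier f \<xi>))\<^sup>2 * exp (- (pi * \<epsilon>\<^sup>2 * (norm \<xi>)\<^sup>2)))
      = (LINT x|lborel. f x * cnj (LINT y|lborel. f y * of_real (gauss_kernel \<epsilon> (x - y))))"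
proof -
  have [measurable]: "f \<in> borel_measurable borel" using f borel_measurable_integrable by fastforce
  define w :: "'a \<Rightarrow> complex" where "w = (\<lambda>\<xi>. of_real (exp (- (pi * \<epsilon>\<^sup>2 * (norm \<xi>)\<^sup>2))))"
  have w: "integrable lborel w" unfolding w_def using gaussian_fourier(1)[OF e, where 'a = 'a] by simp
  have [measurable]: "w \<in> borel_measurable borel" unfolding w_def by measurable
  define B where "B = (LINT x|lborel. norm (f x))"
  have fB: "norm (fourier f \<xi>) \<le> B" for \<xi> unfolding B_def by (rule norm_fourier_le)
  \<comment> \<open>The weighted |f^|^2 is split as G f^, and the two transforms are unfolded one
    after the other. Each time one factor is integrable and the other is an integral of f against a
    character, which is the situation of \<open>Fubini_bounded_kernel\<close>.\<close>
  define G where "G = (\<lambda>\<xi>. w \<xi> * cnj (fourier f \<xi>))"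
  have G: "integrable lborel G" unfolding G_def
    by (rule integrable_mult_bounded[OF w, where B = B]) (use fB in auto)
  have eq2: "complex_of_real ((norm (fourier f \<xi>))\<^sup>2 * exp (- (pi * \<epsilon>\<^sup>2 * (norm \<xi>)\<^sup>2))) = G \<xi> * fourier f \<xi>" for \<xi>
    unfolding G_def w_def of_real_mult complex_norm_square by (simp only: mult_ac)
  have eq1: "(norm (fourier f \<xi>))\<^sup>2 * exp (- (pi * \<epsilon>\<^sup>2 * (norm \<xi>)\<^sup>2)) = Re (G \<xi> * fourier f \<xi>)" for \<xi>
    using arg_cong[OF eq2, of Re \<xi>] by (simp only: Re_complex_of_real)
  have Gf: "integrable lborel (\<lambda>\<xi>. G \<xi> * fourier f \<xi>)"
    by (rule integrable_mult_bounded[OF G, where B = B]) (use fB in auto)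
  show "integrable lborel (\<lambda>\<xi>. (norm (fourier f \<xi>))\<^sup>2 * exp (- (pi * \<epsilon>\<^sup>2 * (norm \<xi>)\<^sup>2)))"
    unfolding eq1 by (rule integrable_Re[OF Gf])
  have "complex_of_real (LINT \<xi>|lborel. (norm (fourier f \<xi>))\<^sup>2 * exp (- (pi * \<epsilon>\<^sup>2 * (norm \<xi>)\<^sup>2))) = (LINT \<xi>|lborel. G \<xi> * fourier f \<xi>)"
    unfolding integral_complex_of_real[symmetric] eq2 ..
  also have "\<dots> = (LINT x|lborel. f x * (LINT \<xi>|lborel. G \<xi> * cis (- (2 * pi * (x \<bullet> \<xi>)))))"
    unfolding fourier_eq_cis
    using Fubini_bounded_kernel(1)[OF G f, of "\<lambda>(\<xi>, x). cis (- (2 * pi * (x \<bullet> \<xi>)))" 1]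
    by (simp add: split_beta borel_prod[symmetric])
  also have "(\<lambda>x. LINT \<xi>|lborel. G \<xi> * cis (- (2 * pi * (x \<bullet> \<xi>)))) = (\<lambda>x. cnj (LINT y|lborel. f y * of_real (gauss_kernel \<epsilon> (x - y))))"
  proof
    fix x :: 'a
    have wc: "integrable lborel (\<lambda>\<xi>. w \<xi> * cis (2 * pi * (x \<bullet> \<xi>)))" by (rule integrable_mult_cis[OF w]) measurable
    have "(LINT \<xi>|lborel. G \<xi> * cis (- (2 * pi * (x \<bullet> \<xi>)))) = (LINT \<xi>|lborel. cnj (w \<xi> * cis (2 * pi * (x \<bullet> \<xi>)) * fourier f \<xi>))"
      by (intro Bochner_Integration.integral_cong) (auto simp: G_def w_def cis_cnj mult_ac)
    also have "\<dots> = cnj (LINT \<xi>|lborel. w \<xi> * cis (2 * pi * (x \<bullet> \<xi>)) * fourier f \<xi>)" by (rule Bochner_Integration.integral_cnj)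
    also have "(LINT \<xi>|lborel. w \<xi> * cis (2 * pi * (x \<bullet> \<xi>)) * fourier f \<xi>)
       = (LINT y|lborel. f y * (LINT \<xi>|lborel. w \<xi> * cis (2 * pi * (x \<bullet> \<xi>)) * cis (- (2 * pi * (y \<bullet> \<xi>)))))"
      unfolding fourier_eq_cis
      using Fubini_bounded_kernel(1)[OF wc f, of "\<lambda>(\<xi>, y). cis (- (2 * pi * (y \<bullet> \<xi>)))" 1]
      by (simp add: split_beta borel_prod[symmetric])
    also have "\<dots> = (LINT y|lborel. f y * of_real (gauss_kernel \<epsilon> (x - y)))"
    proof (rule Bochner_Integration.integral_cong[OF refl])
      fix y :: 'a
      have "w \<xi> * cis (2 * pi * (x \<bullet> \<xi>)) * cis (- (2 * pi * (y \<bullet> \<xi>))) = of_real (exp (- (pi * \<epsilon>\<^sup>2 * (norm \<xi>)\<^sup>2))) * cis (2 * pi * ((x - y) \<bullet> \<xi>))" for \<xi>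
        unfolding w_def mult.assoc cis_mult by (simp add: inner_diff_left algebra_simps)
      then show "f y * (LINT \<xi>|lborel. w \<xi> * cis (2 * pi * (x \<bullet> \<xi>)) * cis (- (2 * pi * (y \<bullet> \<xi>)))) = f y * of_real (gauss_kernel \<epsilon> (x - y))"
        by (simp only: gaussian_fourier(2)[OF e] gauss_kernel_def)
    qed
    finally show "(LINT \<xi>|lborel. G \<xi> * cis (- (2 * pi * (x \<bullet> \<xi>)))) = cnj (LINT y|lborel. f y * of_real (gauss_kernel \<epsilon> (x - y)))" .
  qed
  finally show "complex_of_real (LINT \<xi>|lborel. (norm (fourier f \<xi>))\<^sup>2 * exp (- (pi * \<epsilon>\<^sup>2 * (norm \<xi>)\<^sup>2)))
      = (LINT x|lborel. f x * cnj (LINT y|lborel. f y * of_real (gauss_kernel \<epsilon> (x - y))))" .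
qed

text \<open>Schur's test: |f(x) f(y)| <= (|f(x)|^2 + |f(y)|^2) / 2, and the kernel has mass 1 in
  each variable. Nonnegative integrals are used throughout so that integrability of the inner
  integrals is never an issue.\<close>

lemma gaussian_quadratic_form_le:
  fixes f :: "'a::euclidean_space \<Rightarrow> complex"
  assumes [measurable]: "f \<in> borel_measurable borel" and f2: "integrable lborel (\<lambda>x. (norm (f x))\<^sup>2)" and e: "\<epsilon> > 0"
  shows "norm (LINT x|lborel. f x * cnj (LINT y|lborel. f y * of_real (gauss_kernel \<epsilon> (x - y)))) \<le> (LINT x|lborel. (norm (f x))\<^sup>2)"
proof -
  let ?g = "gauss_kernel \<epsilon> :: 'a \<Rightarrow> real"
  note g0 = gauss_kernel_nonneg[OF e]
  let ?A = "\<integral>\<^sup>+x. ennreal ((norm (f x))\<^sup>2) \<partial>lborel"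
  have "ennreal (norm (LINT x|lborel. f x * cnj (LINT y|lborel. f y * of_real (?g (x - y)))))
     \<le> (\<integral>\<^sup>+x. norm (f x * cnj (LINT y|lborel. f y * of_real (?g (x - y)))) \<partial>lborel)"
    by (rule norm_integral_le_nn_integral)
  also have "\<dots> \<le> (\<integral>\<^sup>+x. \<integral>\<^sup>+y. ennreal ((norm (f x))\<^sup>2 / 2) * ennreal (?g (x - y))
      + ennreal ((norm (f y))\<^sup>2 / 2) * ennreal (?g (x - y)) \<partial>lborel \<partial>lborel)"
  proof (rule nn_integral_mono)
    fix x
    have "ennreal (norm (f x * cnj (LINT y|lborel. f y * of_real (?g (x - y)))))
       = ennreal (norm (f x)) * ennreal (norm (LINT y|lborel. f y * of_real (?g (x - y))))"
      by (simp add: norm_mult ennreal_mult')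
    also have "\<dots> \<le> ennreal (norm (f x)) * (\<integral>\<^sup>+y. ennreal (norm (f y * of_real (?g (x - y)))) \<partial>lborel)"
      by (intro mult_left_mono norm_integral_le_nn_integral) auto
    also have "\<dots> = (\<integral>\<^sup>+y. ennreal (norm (f x)) * ennreal (norm (f y * of_real (?g (x - y)))) \<partial>lborel)"
      by (rule nn_integral_cmult[symmetric]) measurable
    also have "\<dots> \<le> (\<integral>\<^sup>+y. ennreal ((norm (f x))\<^sup>2 / 2) * ennreal (?g (x - y))
      + ennreal ((norm (f y))\<^sup>2 / 2) * ennreal (?g (x - y)) \<partial>lborel)"
    proof (rule nn_integral_mono)
      fix y
      have "norm (f x) * norm (f y) \<le> (norm (f x))\<^sup>2 / 2 + (norm (f y))\<^sup>2 / 2"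
        using sum_squares_bound[of "norm (f x)" "norm (f y)"] by simp
      from mult_right_mono[OF this g0[of "x - y"]]
      have "norm (f x) * norm (f y * of_real (?g (x - y))) \<le> (norm (f x))\<^sup>2 / 2 * ?g (x - y) + (norm (f y))\<^sup>2 / 2 * ?g (x - y)"
        using g0[of "x - y"] by (simp add: norm_mult distrib_right mult.assoc)
      then show "ennreal (norm (f x)) * ennreal (norm (f y * of_real (?g (x - y)))) \<le> ennreal ((norm (f x))\<^sup>2 / 2) * ennreal (?g (x - y))
      + ennreal ((norm (f y))\<^sup>2 / 2) * ennreal (?g (x - y))"
        using g0[of "x - y"] by (simp add: ennreal_mult'[symmetric] ennreal_plus[symmetric] ennreal_leI del: ennreal_plus)
    qed
    finally show "ennreal (norm (f x * cnj (LINT y|lborel. f y * of_real (?g (x - y))))) \<le> (\<integral>\<^sup>+y. ennreal ((norm (f x))\<^sup>2 / 2) * ennreal (?g (x - y))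
      + ennreal ((norm (f y))\<^sup>2 / 2) * ennreal (?g (x - y)) \<partial>lborel)" .
  qed
  also have "\<dots> = (\<integral>\<^sup>+x. \<integral>\<^sup>+y. ennreal ((norm (f x))\<^sup>2 / 2) * ennreal (?g (x - y)) \<partial>lborel \<partial>lborel)
      + (\<integral>\<^sup>+x. \<integral>\<^sup>+y. ennreal ((norm (f y))\<^sup>2 / 2) * ennreal (?g (x - y)) \<partial>lborel \<partial>lborel)"
    by (simp add: nn_integral_add)
  also have "(\<integral>\<^sup>+x. \<integral>\<^sup>+y. ennreal ((norm (f y))\<^sup>2 / 2) * ennreal (?g (x - y)) \<partial>lborel \<partial>lborel)
      = (\<integral>\<^sup>+x. ennreal ((norm (f x))\<^sup>2 / 2) \<partial>lborel)"
    using nn_integral_convolution[of "\<lambda>x. ennreal ((norm (f x))\<^sup>2 / 2)" "\<lambda>x. ennreal (?g x)"] gauss_kernel_integral(3)[OF e, where 'a = 'a] by simp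
  also have "(\<integral>\<^sup>+x. \<integral>\<^sup>+y. ennreal ((norm (f x))\<^sup>2 / 2) * ennreal (?g (x - y)) \<partial>lborel \<partial>lborel)
      = (\<integral>\<^sup>+x. ennreal ((norm (f x))\<^sup>2 / 2) \<partial>lborel)"
  proof (rule nn_integral_cong)
    fix x
    have "(\<integral>\<^sup>+y. ennreal (?g (x - y)) \<partial>lborel) = 1"
      using nn_integral_lborel_reflect[of "\<lambda>y. ennreal (?g y)" x] gauss_kernel_integral(3)[OF e, where 'a = 'a] by simp
    then show "(\<integral>\<^sup>+y. ennreal ((norm (f x))\<^sup>2 / 2) * ennreal (?g (x - y)) \<partial>lborel) = ennreal ((norm (f x))\<^sup>2 / 2)"
      by (simp add: nn_integral_cmult)
  qed
  also have "(\<integral>\<^sup>+x. ennreal ((norm (f x))\<^sup>2 / 2) \<partial>lborel) = ennreal ((LINT x|lborel. (norm (f x))\<^sup>2) / 2)"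
    using f2 by (subst nn_integral_eq_integral) auto
  also have "ennreal ((LINT x|lborel. (norm (f x))\<^sup>2) / 2) + ennreal ((LINT x|lborel. (norm (f x))\<^sup>2) / 2)
     = ennreal (LINT x|lborel. (norm (f x))\<^sup>2)"
    by (subst ennreal_plus[symmetric]) (auto intro: integral_nonneg_AE)
  finally show ?thesis by (subst (asm) ennreal_le_iff) (auto intro: integral_nonneg_AE)
qed

lemma gaussian_quadratic_form_tendsto:
  fixes f :: "'a::euclidean_space \<Rightarrow> complex"
  assumes f: "integrable lborel f" and B: "\<And>x. norm (f x) \<le> B" and cont: "\<And>x. isCont f x"
  shows "(\<lambda>n. LINT x|lborel. f x * cnj (LINT y|lborel. f y * of_real (gauss_kernel (1 / Suc n) (x - y))))
     \<longlonglongrightarrow> complex_of_real (LINT x|lborel. (norm (f x))\<^sup>2)"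
proof -
  have [measurable]: "f \<in> borel_measurable borel" using f borel_measurable_integrable by fastforce
  let ?I = "\<lambda>n x. LINT y|lborel. f y * of_real (gauss_kernel (1 / Suc n) (x - y))"
  have "(\<lambda>n. LINT x|lborel. f x * cnj (?I n x)) \<longlonglongrightarrow> (LINT x|lborel. f x * cnj (f x))"
  proof (rule integral_dominated_convergence[where w = "\<lambda>x. B * norm (f x)"])
    show "AE x in lborel. (\<lambda>n. f x * cnj (?I n x)) \<longlonglongrightarrow> f x * cnj (f x)"
      by (intro AE_I2 tendsto_intros gaussian_approximate_identity[OF _ B cont, folded gauss_kernel_def]) measurable
    show "AE x in lborel. norm (f x * cnj (?I n x)) \<le> B * norm (f x)" for n
    proof (rule AE_I2)
      fix x :: 'a
      have e: "1 / real (Suc n) > 0" by simp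
      have i: "integrable lborel (\<lambda>y. gauss_kernel (1 / Suc n) (x - y))"
        using gauss_kernel_integral(1)[OF e, where 'a = 'a] by (subst integrable_lborel_reflect)
      have "norm (?I n x) \<le> (LINT y|lborel. B * gauss_kernel (1 / Suc n) (x - y))"
      proof (rule order_trans[OF integral_norm_bound integral_mono])
        show "norm (f y * of_real (gauss_kernel (1 / Suc n) (x - y))) \<le> B * gauss_kernel (1 / Suc n) (x - y)" for y
          using gauss_kernel_nonneg[OF e, of "x - y"] B[of y] by (simp add: norm_mult mult_right_mono)
        have "integrable lborel (\<lambda>y. complex_of_real (gauss_kernel (1 / Suc n) (x - y)) * f y)"
          by (rule integrable_mult_bounded[where B = B]) (use i B in auto)
        then show "integrable lborel (\<lambda>y. norm (f y * of_real (gauss_kernel (1 / Suc n) (x - y))))"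
          by (simp add: mult.commute)
      qed (use i in auto)
      also have "\<dots> = B"
        using integral_lborel_reflect[of "gauss_kernel (1 / Suc n) :: 'a \<Rightarrow> real" x] gauss_kernel_integral(2)[OF e, where 'a = 'a]
        by simp
      finally show "norm (f x * cnj (?I n x)) \<le> B * norm (f x)"
        using mult_left_mono[of "norm (?I n x)" B "norm (f x)"] by (simp add: norm_mult mult.commute)
    qed
  qed (use f in auto)
  also have "(LINT x|lborel. f x * cnj (f x)) = complex_of_real (LINT x|lborel. (norm (f x))\<^sup>2)"
    by (simp only: complex_norm_square[symmetric] integral_complex_of_real)
  finally show ?thesis .
qed

text \<open>The regularised forms are compared for fixed \<epsilon>, where |b^| <= 1 applies under
  the integral. The limit is taken only on the side of the convolution, which is continuous; on the
  side of f, which need not be, the bound uniform in \<epsilon> is enough.\<close>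

lemma convolution_contraction_bounded:
  fixes b :: "'a::euclidean_space \<Rightarrow> real"
  assumes b: "integrable lborel b" and le1: "\<And>\<xi>. norm (fourier (\<lambda>x. of_real (b x)) \<xi>) \<le> 1"
    and f: "integrable lborel f" and B: "\<And>x. norm (f x) \<le> B"
  shows "(LINT x|lborel. (norm (convolution b f x))\<^sup>2) \<le> (LINT x|lborel. (norm (f x))\<^sup>2)"
    and "integrable lborel (\<lambda>x. (norm (convolution b f x))\<^sup>2)"
proof -
  have [measurable]: "f \<in> borel_measurable borel" "b \<in> borel_measurable borel"
    using f b borel_measurable_integrable by fastforce+
  let ?h = "convolution b f"
  have sq: "integrable lborel (\<lambda>x. (norm (g x))\<^sup>2)" if "integrable lborel g" "\<And>x. norm (g x) \<le> C" for g :: "'a \<Rightarrow> complex" and C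
    unfolding power2_eq_square
    by (rule integrable_mult_bounded[where B = C]) (use that in \<open>auto intro: borel_measurable_integrable\<close>)
  have h: "integrable lborel ?h" by (rule integrable_convolution[OF b f])
  define C where "C = (LINT y|lborel. \<bar>b y\<bar> * B)"
  have hC: "norm (?h x) \<le> C" for x
    unfolding convolution_def C_def
  proof (rule order_trans[OF integral_norm_bound integral_mono])
    show "norm (of_real (b y) * f (x - y)) \<le> \<bar>b y\<bar> * B" for y
      by (simp add: norm_mult mult_left_mono B)
    have "integrable lborel (\<lambda>y. complex_of_real (b y) * f (x - y))"
      by (rule integrable_mult_bounded[where B = B]) (use b B in auto)
    then show "integrable lborel (\<lambda>y. norm (complex_of_real (b y) * f (x - y)))" by simp
  qed (use b in auto)
  show "integrable lborel (\<lambda>x. (norm (?h x))\<^sup>2)" by (rule sq[OF h hC])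
  have "Re (LINT x|lborel. ?h x * cnj (LINT y|lborel. ?h y * of_real (gauss_kernel (1 / Suc n) (x - y)))) \<le> (LINT x|lborel. (norm (f x))\<^sup>2)" for n
  proof -
    define \<epsilon> where "\<epsilon> = 1 / real (Suc n)"
    have e: "\<epsilon> > 0" by (simp add: \<epsilon>_def)
    have "Re (LINT x|lborel. ?h x * cnj (LINT y|lborel. ?h y * of_real (gauss_kernel \<epsilon> (x - y))))
       = (LINT \<xi>|lborel. (norm (fourier ?h \<xi>))\<^sup>2 * exp (- (pi * \<epsilon>\<^sup>2 * (norm \<xi>)\<^sup>2)))"
      unfolding gaussian_quadratic_form(2)[OF h e, symmetric] by simp
    also have "\<dots> \<le> (LINT \<xi>|lborel. (norm (fourier f \<xi>))\<^sup>2 * exp (- (pi * \<epsilon>\<^sup>2 * (norm \<xi>)\<^sup>2)))"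
    proof (rule integral_mono[OF gaussian_quadratic_form(1)[OF h e] gaussian_quadratic_form(1)[OF f e]])
      fix \<xi> :: 'a
      have "norm (fourier ?h \<xi>) \<le> 1 * norm (fourier f \<xi>)"
        unfolding fourier_convolution[OF b f] norm_mult by (intro mult_right_mono le1) auto
      then show "(norm (fourier ?h \<xi>))\<^sup>2 * exp (- (pi * \<epsilon>\<^sup>2 * (norm \<xi>)\<^sup>2)) \<le> (norm (fourier f \<xi>))\<^sup>2 * exp (- (pi * \<epsilon>\<^sup>2 * (norm \<xi>)\<^sup>2))"
        by (intro mult_right_mono power_mono) auto
    qed
    also have "\<dots> = Re (LINT x|lborel. f x * cnj (LINT y|lborel. f y * of_real (gauss_kernel \<epsilon> (x - y))))"
      unfolding gaussian_quadratic_form(2)[OF f e, symmetric] by simp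
    also have "\<dots> \<le> (LINT x|lborel. (norm (f x))\<^sup>2)"
      by (rule order_trans[OF complex_Re_le_cmod gaussian_quadratic_form_le[OF _ sq[OF f B] e]]) measurable
    finally show ?thesis by (simp only: \<epsilon>_def)
  qed
  moreover have "(\<lambda>n. Re (LINT x|lborel. ?h x * cnj (LINT y|lborel. ?h y * of_real (gauss_kernel (1 / Suc n) (x - y)))))
      \<longlonglongrightarrow> Re (complex_of_real (LINT x|lborel. (norm (?h x))\<^sup>2))"
    by (intro tendsto_Re gaussian_quadratic_form_tendsto[OF h hC] isCont_convolution[OF b _ B]) measurable
  ultimately show "(LINT x|lborel. (norm (?h x))\<^sup>2) \<le> (LINT x|lborel. (norm (f x))\<^sup>2)"
    by (intro tendsto_upperbound) (auto simp del: of_nat_Suc)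
qed

lemma convolution_contraction:
  fixes b :: "'a::euclidean_space \<Rightarrow> real"
  assumes b: "integrable lborel b" and le1: "\<And>\<xi>. norm (fourier (\<lambda>x. of_real (b x)) \<xi>) \<le> 1"
    and f: "f \<in> L2"
  shows "convolution b f \<in> L2" "L2_norm (convolution b f) \<le> L2_norm f"
proof -
  have [measurable]: "f \<in> borel_measurable borel" and f2: "integrable lborel (\<lambda>x. (norm (f x))\<^sup>2)"
    using f by (auto simp: L2_def)
  have [measurable]: "b \<in> borel_measurable borel" using b borel_measurable_integrable by fastforce
  \<comment> \<open>Cutting off both the values and the support makes each fn bounded and
    integrable, as the preceding lemma requires.\<close>
  define fn where "fn = (\<lambda>(n::nat) x. if norm (f x) \<le> n \<and> norm x \<le> n then f x else 0)"
  have [measurable]: "fn n \<in> borel_measurable borel" for n unfolding fn_def by measurable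
  have fn_le: "norm (fn n x) \<le> norm (f x)" "norm (fn n x) \<le> n" for n x unfolding fn_def by auto
  have fn_int: "integrable lborel (fn n)" for n
  proof (rule Bochner_Integration.integrable_bound)
    show "integrable lborel (\<lambda>x::'a. indicator (cball 0 (real n)) x *\<^sub>R real n)"
      using emeasure_lborel_cball_finite[of "0::'a" "real n"] by (intro integrable_indicator) auto
    show "AE x in lborel. norm (fn n x) \<le> norm (indicator (cball 0 (real n)) x *\<^sub>R real n)"
      by (auto simp: fn_def)
  qed measurable
  have fn_lim: "(\<lambda>n. fn n x) \<longlonglongrightarrow> f x" for x
  proof (rule tendsto_eventually)
    obtain N :: nat where N: "max (norm (f x)) (norm x) \<le> N" using real_arch_simple by blast
    show "\<forall>\<^sub>F n in sequentially. fn n x = f x"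
      using eventually_ge_at_top[of N] by eventually_elim (use N in \<open>auto simp: fn_def\<close>)
  qed
  have bound: "(\<integral>\<^sup>+x. ennreal ((norm (convolution b (fn n) x))\<^sup>2) \<partial>lborel) \<le> ennreal (LINT x|lborel. (norm (f x))\<^sup>2)" for n
  proof -
    have "(\<integral>\<^sup>+x. ennreal ((norm (convolution b (fn n) x))\<^sup>2) \<partial>lborel) = ennreal (LINT x|lborel. (norm (convolution b (fn n) x))\<^sup>2)"
      by (rule nn_integral_eq_integral) (use convolution_contraction_bounded(2)[OF b le1 fn_int fn_le(2)] in auto)
    also have "\<dots> \<le> ennreal (LINT x|lborel. (norm (fn n x))\<^sup>2)"
      by (intro ennreal_leI convolution_contraction_bounded(1)[OF b le1 fn_int fn_le(2)])
    also have "\<dots> \<le> ennreal (LINT x|lborel. (norm (f x))\<^sup>2)"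
    proof (intro ennreal_leI integral_mono)
      show "integrable lborel (\<lambda>x. (norm (fn n x))\<^sup>2)"
        by (rule Bochner_Integration.integrable_bound[OF f2]) (auto intro!: power_mono fn_le)
    qed (use f2 in \<open>auto intro!: power_mono fn_le\<close>)
    finally show ?thesis .
  qed
  \<comment> \<open>A majorant for b(y) f(x - y) is needed although f need not be integrable. From t
    <= 1 + t^2 one gets |b(y)| (1 + |f(x - y)|^2), which is integrable in y for almost every x
    because b and |f|^2 are both in L^1.\<close>
  have ae: "AE x in lborel. (\<lambda>n. convolution b (fn n) x) \<longlonglongrightarrow> convolution b f x"
  proof -
    have "integrable lborel (\<lambda>x. complex_of_real ((norm (f x))\<^sup>2))" using f2 by (simp only: complex_of_real_integrable_eq)
    from lborel_pair.AE_integrable_fst'[OF integrable_convolution_pair[OF b this]]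
    have "AE x in lborel. integrable lborel (\<lambda>y. complex_of_real (b y) * of_real ((norm (f (x - y)))\<^sup>2))" by simp
    then show ?thesis
    proof eventually_elim
      case (elim x)
      show ?case unfolding convolution_def
      proof (rule integral_dominated_convergence[where w = "\<lambda>y. \<bar>b y\<bar> + norm (complex_of_real (b y) * of_real ((norm (f (x - y)))\<^sup>2))"])
        show "integrable lborel (\<lambda>y. \<bar>b y\<bar> + norm (complex_of_real (b y) * of_real ((norm (f (x - y)))\<^sup>2)))"
          using b elim by (intro Bochner_Integration.integrable_add integrable_norm integrable_abs)
        show "AE y in lborel. (\<lambda>n. complex_of_real (b y) * fn n (x - y)) \<longlonglongrightarrow> complex_of_real (b y) * f (x - y)"
          by (intro AE_I2 tendsto_intros fn_lim)
        show "AE y in lborel. norm (complex_of_real (b y) * fn n (x - y)) \<le> \<bar>b y\<bar> + norm (complex_of_real (b y) * of_real ((norm (f (x - y)))\<^sup>2))" for n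
        proof (rule AE_I2)
          fix y
          have "t \<le> 1 + t\<^sup>2" for t :: real using zero_le_power2[of "t - 1/2"] by (simp add: power2_eq_square algebra_simps)
          then have "norm (fn n (x - y)) \<le> 1 + (norm (f (x - y)))\<^sup>2" using fn_le(1) order_trans by blast
          from mult_left_mono[OF this, of "\<bar>b y\<bar>"]
          show "norm (complex_of_real (b y) * fn n (x - y)) \<le> \<bar>b y\<bar> + norm (complex_of_real (b y) * of_real ((norm (f (x - y)))\<^sup>2))"
            by (simp add: norm_mult norm_power distrib_left)
        qed
      qed measurable
    qed
  qed
  have "(\<integral>\<^sup>+x. ennreal ((norm (convolution b f x))\<^sup>2) \<partial>lborel)
     = (\<integral>\<^sup>+x. liminf (\<lambda>n. ennreal ((norm (convolution b (fn n) x))\<^sup>2)) \<partial>lborel)"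
  proof (rule nn_integral_cong_AE, use ae in eventually_elim)
    case (elim x)
    then have "(\<lambda>n. ennreal ((norm (convolution b (fn n) x))\<^sup>2)) \<longlonglongrightarrow> ennreal ((norm (convolution b f x))\<^sup>2)"
      by (intro tendsto_intros)
    then show ?case using lim_imp_Liminf[OF sequentially_bot] by metis
  qed
  also have "\<dots> \<le> liminf (\<lambda>n. \<integral>\<^sup>+x. ennreal ((norm (convolution b (fn n) x))\<^sup>2) \<partial>lborel)"
    by (rule nn_integral_liminf) measurable
  also have "\<dots> \<le> limsup (\<lambda>n. \<integral>\<^sup>+x. ennreal ((norm (convolution b (fn n) x))\<^sup>2) \<partial>lborel)"
    by (rule Liminf_le_Limsup) simp
  also have "\<dots> \<le> ennreal (LINT x|lborel. (norm (f x))\<^sup>2)"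
    by (rule Limsup_bounded) (simp add: bound)
  finally have le: "(\<integral>\<^sup>+x. ennreal ((norm (convolution b f x))\<^sup>2) \<partial>lborel) \<le> ennreal (LINT x|lborel. (norm (f x))\<^sup>2)" .
  have int: "integrable lborel (\<lambda>x. (norm (convolution b f x))\<^sup>2)"
    by (rule integrableI_bounded) (use le in \<open>auto intro: le_less_trans\<close>)
  then show "convolution b f \<in> L2" by (auto simp: L2_def)
  have "ennreal (LINT x|lborel. (norm (convolution b f x))\<^sup>2) \<le> ennreal (LINT x|lborel. (norm (f x))\<^sup>2)"
    using le int by (subst nn_integral_eq_integral[symmetric]) auto
  then show "L2_norm (convolution b f) \<le> L2_norm f"
    unfolding L2_norm_def by (subst (asm) ennreal_le_iff) (auto intro: integral_nonneg_AE)
qed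

section \<open>Riesz transforms under dilation\<close>

lemma L2_diff:
  assumes "f \<in> L2" "g \<in> L2" shows "(\<lambda>x. f x - g x) \<in> L2"
proof -
  have [measurable]: "f \<in> borel_measurable lborel" "g \<in> borel_measurable lborel"
    and i: "integrable lborel (\<lambda>x. (norm (f x))\<^sup>2)" "integrable lborel (\<lambda>x. (norm (g x))\<^sup>2)"
    using assms by (auto simp: L2_def)
  have "integrable lborel (\<lambda>x. (norm (f x - g x))\<^sup>2)"
  proof (rule Bochner_Integration.integrable_bound)
    show "integrable lborel (\<lambda>x. 2 * (norm (f x))\<^sup>2 + 2 * (norm (g x))\<^sup>2)" using i by simp
    have "(norm (f x - g x))\<^sup>2 \<le> 2 * (norm (f x))\<^sup>2 + 2 * (norm (g x))\<^sup>2" for x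
    proof -
      have "(norm (f x - g x))\<^sup>2 \<le> (norm (f x) + norm (g x))\<^sup>2" by (intro power_mono norm_triangle_ineq4) auto
      also have "\<dots> \<le> 2 * (norm (f x))\<^sup>2 + 2 * (norm (g x))\<^sup>2"
        using sum_squares_bound[of "norm (f x)" "norm (g x)"] by (simp add: power2_sum)
      finally show ?thesis .
    qed
    then show "AE x in lborel. norm ((norm (f x - g x))\<^sup>2) \<le> norm (2 * (norm (f x))\<^sup>2 + 2 * (norm (g x))\<^sup>2)"
      by simp
  qed measurable
  then show ?thesis by (simp add: L2_def)
qed

lemma L2_norm_power2: "(L2_norm f)\<^sup>2 = (LINT x|lborel. (norm (f x))\<^sup>2)"
  unfolding L2_norm_def by (simp add: integral_nonneg_AE)

text \<open>The squared distance of g and g' is at most 2 |F - g|^2 + 2 |F - g'|^2 after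
  integration, and the right-hand side tends to 0 along the filter; working with squares avoids the
  triangle inequality for \<open>L2_norm\<close>.\<close>

lemma L2_limit_unique:
  assumes F: "L2_limit F g A" "L2_limit F g' A" and A: "A \<noteq> bot"
  shows "AE x in lborel. g x = g' x"
proof -
  have g: "g \<in> L2" "g' \<in> L2" using F by (auto simp: L2_limit_def)
  let ?c = "LINT x|lborel. (norm (g x - g' x))\<^sup>2"
  have int: "integrable lborel (\<lambda>x. (norm (g x - g' x))\<^sup>2)" using L2_diff[OF g] by (simp add: L2_def)
  have "((\<lambda>i. 2 * (L2_norm (\<lambda>x. F i x - g x))\<^sup>2 + 2 * (L2_norm (\<lambda>x. F i x - g' x))\<^sup>2) \<longlongrightarrow> 2 * 0\<^sup>2 + 2 * 0\<^sup>2) A"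
    using F unfolding L2_limit_def by (intro tendsto_intros) auto
  moreover have "\<forall>\<^sub>F i in A. ?c \<le> 2 * (L2_norm (\<lambda>x. F i x - g x))\<^sup>2 + 2 * (L2_norm (\<lambda>x. F i x - g' x))\<^sup>2"
  proof -
    have "\<forall>\<^sub>F i in A. F i \<in> L2" using F by (auto simp: L2_limit_def)
    then show ?thesis
    proof eventually_elim
      case (elim i)
      have i: "integrable lborel (\<lambda>x. (norm (F i x - g x))\<^sup>2)" "integrable lborel (\<lambda>x. (norm (F i x - g' x))\<^sup>2)"
        using L2_diff[OF elim] g by (auto simp: L2_def)
      have "?c \<le> (LINT x|lborel. 2 * (norm (F i x - g x))\<^sup>2 + 2 * (norm (F i x - g' x))\<^sup>2)"
      proof (rule integral_mono[OF int])
        show "(norm (g x - g' x))\<^sup>2 \<le> 2 * (norm (F i x - g x))\<^sup>2 + 2 * (norm (F i x - g' x))\<^sup>2" for x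
        proof -
          have "norm (g x - g' x) \<le> norm (F i x - g x) + norm (F i x - g' x)"
            using norm_triangle_ineq4[of "F i x - g' x" "F i x - g x"] by simp
          then have "(norm (g x - g' x))\<^sup>2 \<le> (norm (F i x - g x) + norm (F i x - g' x))\<^sup>2" by (intro power_mono) auto
          also have "\<dots> \<le> 2 * (norm (F i x - g x))\<^sup>2 + 2 * (norm (F i x - g' x))\<^sup>2"
            using sum_squares_bound[of "norm (F i x - g x)" "norm (F i x - g' x)"] by (simp add: power2_sum)
          finally show ?thesis .
        qed
      qed (use i in simp)
      also have "\<dots> = 2 * (L2_norm (\<lambda>x. F i x - g x))\<^sup>2 + 2 * (L2_norm (\<lambda>x. F i x - g' x))\<^sup>2"
        using i by (simp add: L2_norm_power2)
      finally show ?case .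
    qed
  qed
  ultimately have "?c \<le> 2 * 0\<^sup>2 + 2 * 0\<^sup>2" using A by (intro tendsto_lowerbound)
  moreover have "?c \<ge> 0" by (rule integral_nonneg_AE) simp
  ultimately have "?c = 0" by simp
  then have "AE x in lborel. (norm (g x - g' x))\<^sup>2 = 0"
    using int by (subst (asm) integral_nonneg_eq_0_iff_AE) auto
  then show ?thesis by simp
qed

lemma L2_dilate:
  fixes f :: "'a::euclidean_space \<Rightarrow> complex"
  assumes f: "f \<in> L2" and t: "t > 0"
  shows "(\<lambda>x. a * f (t *\<^sub>R x)) \<in> L2"
    and "L2_norm (\<lambda>x. a * f (t *\<^sub>R x)) = norm a / sqrt (t ^ DIM('a)) * L2_norm f"
proof -
  have [measurable]: "f \<in> borel_measurable borel" and i: "integrable lborel (\<lambda>x. (norm (f x))\<^sup>2)"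
    using f by (auto simp: L2_def)
  have "integrable lborel (\<lambda>x. (norm (f (t *\<^sub>R x)))\<^sup>2)"
    using integrable_lborel_affine[OF i, of t 0] t by simp
  then show "(\<lambda>x. a * f (t *\<^sub>R x)) \<in> L2" by (simp add: L2_def norm_mult power_mult_distrib)
  have "(LINT x|lborel. (norm (f x))\<^sup>2) = t ^ DIM('a) * (LINT x|lborel. (norm (f (t *\<^sub>R x)))\<^sup>2)"
    using integral_lborel_affine[of t "\<lambda>x. (norm (f x))\<^sup>2" 0] t by simp
  then have e: "(LINT x|lborel. (norm (f (t *\<^sub>R x)))\<^sup>2) = (LINT x|lborel. (norm (f x))\<^sup>2) / t ^ DIM('a)" using t by simp
  show "L2_norm (\<lambda>x. a * f (t *\<^sub>R x)) = norm a / sqrt (t ^ DIM('a)) * L2_norm f"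
    unfolding L2_norm_def by (simp add: norm_mult power_mult_distrib e real_sqrt_mult real_sqrt_divide)
qed

lemma spherical_harmonics_simps:
  assumes "P \<in> spherical_harmonics k"
  shows "P (c *\<^sub>R x) = c ^ k *\<^sub>R P x" "continuous_on UNIV P" "P \<in> borel_measurable borel"
proof -
  show "continuous_on UNIV P"
    using assms by (auto simp: spherical_harmonics_def intro: continuous_on_polymonial_function)
  then show "P \<in> borel_measurable borel" by (rule borel_measurable_continuous_onI)
qed (use assms in \<open>auto simp: spherical_harmonics_def\<close>)

lemma borel_measurable_truncated_riesz [measurable]:
  assumes P: "P \<in> spherical_harmonics k" and [measurable]: "f \<in> borel_measurable borel"
  shows "truncated_riesz k P t f \<in> borel_measurable borel"
proof -
  have [measurable]: "P \<in> borel_measurable borel" by (rule spherical_harmonics_simps(3)[OF P])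
  show ?thesis unfolding truncated_riesz_def[abs_def] set_lebesgue_integral_def by measurable
qed

text \<open>The kernel is homogeneous of degree -d, which cancels the Jacobian of y -> t y, while
  the region |y| > t s becomes |y| > s. The scalar a is carried along for the existence proof below,
  which compares f with 2 f.\<close>

lemma truncated_riesz_dilate:
  fixes P :: "'a::euclidean_space \<Rightarrow> complex"
  assumes P: "P \<in> spherical_harmonics k" and t: "t > 0"
  shows "truncated_riesz k P s (\<lambda>x. a * f (t *\<^sub>R x)) x = a * truncated_riesz k P (t * s) f (t *\<^sub>R x)"
proof -
  let ?n = "DIM('a) + k"
  let ?F = "\<lambda>y. indicator {y. norm y > t * s} y *\<^sub>R (P y / of_real (norm y ^ ?n) * f (t *\<^sub>R x - y))"
  have "(LINT y|lborel. ?F y) = t ^ DIM('a) *\<^sub>R (LINT y|lborel. ?F (0 + t *\<^sub>R y))"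
    using integral_lborel_affine[of t ?F 0] t by (simp only: abs_of_pos)
  also have "\<dots> = (LINT y|lborel. t ^ DIM('a) *\<^sub>R ?F (0 + t *\<^sub>R y))" by (rule integral_scaleR_right[symmetric])
  also have "\<dots> = (LINT y|lborel. indicator {y. norm y > s} y *\<^sub>R (P y / of_real (norm y ^ ?n) * f (t *\<^sub>R (x - y))))"
  proof (rule Bochner_Integration.integral_cong[OF refl])
    fix y
    have "P (t *\<^sub>R y) = of_real (t ^ k) * P y" by (simp add: spherical_harmonics_simps(1)[OF P] scaleR_conv_of_real)
    then show "t ^ DIM('a) *\<^sub>R ?F (0 + t *\<^sub>R y) = indicator {y. norm y > s} y *\<^sub>R (P y / of_real (norm y ^ ?n) * f (t *\<^sub>R (x - y)))"
      using t by (simp add: power_add power_mult_distrib scaleR_conv_of_real scaleR_diff_right indicator_def)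
  qed
  finally have e: "(LINT y|lborel. ?F y) = (LINT y|lborel. indicator {y. norm y > s} y *\<^sub>R (P y / of_real (norm y ^ ?n) * f (t *\<^sub>R (x - y))))" .
  have "(LINT y|lborel. indicator {y. norm y > s} y *\<^sub>R (P y / of_real (norm y ^ ?n) * (a * f (t *\<^sub>R (x - y)))))
    = a * (LINT y|lborel. indicator {y. norm y > s} y *\<^sub>R (P y / of_real (norm y ^ ?n) * f (t *\<^sub>R (x - y))))"
    by (subst integral_mult_right_zero[symmetric]) (simp add: scaleR_conv_of_real mult_ac)
  then show ?thesis unfolding truncated_riesz_def set_lebesgue_integral_def e by simp
qed

lemma filterlim_divide_at_right_0: "t > 0 \<Longrightarrow> filterlim (\<lambda>s::real. s / t) (at_right 0) (at_right 0)"
  by real_asymp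

text \<open>It passes from a dilate back to f because it serves twice in that direction:
  contrapositively, non-existence of the limit for f spreads to all its dilates; and with a = 1 it
  expresses the Riesz transform of f by that of a dilate.\<close>

lemma L2_limit_truncated_riesz_dilate:
  fixes P :: "'a::euclidean_space \<Rightarrow> complex"
  assumes P: "P \<in> spherical_harmonics k" and t: "t > 0" and a: "a \<noteq> 0"
    and lim: "L2_limit (\<lambda>s. truncated_riesz k P s (\<lambda>x. a * f (t *\<^sub>R x))) g (at_right 0)"
  shows "L2_limit (\<lambda>s. truncated_riesz k P s f) (\<lambda>x. 1 / a * g ((1 / t) *\<^sub>R x)) (at_right 0)"
proof -
  let ?H = "\<lambda>s. truncated_riesz k P s (\<lambda>x. a * f (t *\<^sub>R x))"
  have t': "1 / t > 0" using t by simp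
  have eq: "truncated_riesz k P s f = (\<lambda>x. 1 / a * ?H (s / t) ((1 / t) *\<^sub>R x))" for s
    using a t by (auto simp: truncated_riesz_dilate[OF P t])
  have fl: "filterlim (\<lambda>s::real. s / t) (at_right 0) (at_right 0)" by (rule filterlim_divide_at_right_0[OF t])
  have ev: "\<forall>\<^sub>F s in at_right 0. ?H (s / t) \<in> L2"
    using lim fl unfolding L2_limit_def filterlim_iff by blast
  have g: "g \<in> L2" using lim by (simp add: L2_limit_def)
  have "((\<lambda>s. norm (1 / a) / sqrt ((1 / t) ^ DIM('a)) * L2_norm (\<lambda>x. ?H (s / t) x - g x)) \<longlongrightarrow> norm (1 / a) / sqrt ((1 / t) ^ DIM('a)) * 0) (at_right 0)"
    using lim unfolding L2_limit_def by (intro tendsto_intros filterlim_compose[OF _ fl]) auto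
  moreover have "\<forall>\<^sub>F s in at_right 0. norm (1 / a) / sqrt ((1 / t) ^ DIM('a)) * L2_norm (\<lambda>x. ?H (s / t) x - g x)
      = L2_norm (\<lambda>x. truncated_riesz k P s f x - 1 / a * g ((1 / t) *\<^sub>R x))"
    using ev
  proof eventually_elim
    case (elim s)
    show ?case using L2_dilate(2)[OF L2_diff[OF elim g] t', of "1 / a"]
      unfolding eq[of s] by (simp add: right_diff_distrib diff_divide_distrib)
  qed
  ultimately have "((\<lambda>s. L2_norm (\<lambda>x. truncated_riesz k P s f x - 1 / a * g ((1 / t) *\<^sub>R x))) \<longlongrightarrow> 0) (at_right 0)"
    using Lim_transform_eventually by fastforce
  moreover have "\<forall>\<^sub>F s in at_right 0. truncated_riesz k P s f \<in> L2"
    using ev by eventually_elim (subst eq, rule L2_dilate(1)[OF _ t'])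
  ultimately show ?thesis using L2_dilate(1)[OF g t', of "1 / a"] by (simp add: L2_limit_def)
qed

text \<open>If the limit failed to exist for \<open>f\<close>, it would fail for every \<open>a * f (t \<cdot>)\<close>, so that all their Riesz
  transforms would be the same junk value of \<open>SOME\<close>. The factorization then gives
  \<open>R\<^sup>1 h = R\<^sup>1 (2 h)\<close> for all dilates \<open>h\<close> of \<open>f\<close>, hence \<open>R\<^sup>t f = 0\<close> for all \<open>t\<close>.\<close>

lemma riesz_transform_L2_limit:
  fixes b :: "'a::euclidean_space \<Rightarrow> real" and P f :: "'a \<Rightarrow> complex"
  assumes b: "riesz_factorization_kernel k b" and P: "P \<in> spherical_harmonics k" and f: "f \<in> L2"
  shows "L2_limit (\<lambda>t. truncated_riesz k P t f) (riesz_transform k P f) (at_right 0)"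
proof -
  have "\<exists>g. L2_limit (\<lambda>t. truncated_riesz k P t f) g (at_right 0)"
  proof (rule ccontr)
    assume no: "\<nexists>g. L2_limit (\<lambda>t. truncated_riesz k P t f) g (at_right 0)"
    have [measurable]: "f \<in> borel_measurable borel" using f by (simp add: L2_def)
    have [measurable]: "truncated_riesz k P t f \<in> borel_measurable borel" for t
      by (rule borel_measurable_truncated_riesz[OF P]) measurable
    have junk: "riesz_transform k P (\<lambda>x. a * f (t *\<^sub>R x)) = (SOME g. False)" if "t > 0" "a \<noteq> 0" for a t
    proof -
      have "(\<lambda>g. L2_limit (\<lambda>s. truncated_riesz k P s (\<lambda>x. a * f (t *\<^sub>R x))) g (at_right 0)) = (\<lambda>g. False)"
        using no L2_limit_truncated_riesz_dilate[OF P that] by blast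
      then show ?thesis unfolding riesz_transform_def by simp
    qed
    have zero: "AE x in lborel. truncated_riesz k P t f x = 0" if t: "t > 0" for t
    proof -
      let ?c = "convolution b (SOME g. False)"
      have *: "AE x in lborel. truncated_riesz k P 1 (\<lambda>x. a * f (t *\<^sub>R x)) x = ?c x" if "a \<noteq> 0" for a
        using b P L2_dilate(1)[OF f t, of a] junk[OF t that] unfolding riesz_factorization_kernel_def by metis
      have "AE x in lborel. truncated_riesz k P 1 (\<lambda>x. 1 * f (t *\<^sub>R x)) x = ?c x"
          "AE x in lborel. truncated_riesz k P 1 (\<lambda>x. 2 * f (t *\<^sub>R x)) x = ?c x"
        by (rule *; simp)+
      then have "AE x in lborel. truncated_riesz k P t f (t *\<^sub>R x) = 0"
      proof eventually_elim
        case (elim x)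
        then show ?case using truncated_riesz_dilate[OF P t, of 1 1 f x] truncated_riesz_dilate[OF P t, of 1 2 f x] by simp
      qed
      then have "AE x in lborel. truncated_riesz k P t f (0 + t *\<^sub>R x) = 0" by simp
      then have "AE x in distr lborel borel (\<lambda>x. 0 + t *\<^sub>R x). truncated_riesz k P t f x = 0"
        by (subst AE_distr_iff) auto
      then show ?thesis using t by (subst lborel_affine[of t 0]) (auto simp: AE_density)
    qed
    \<comment> \<open>Truncations that vanish almost everywhere do converge in L^2, namely to 0,
      which is the contradiction. The null set may depend on t, but each norm involves a single
      t.\<close>
    have "L2_limit (\<lambda>t. truncated_riesz k P t f) (\<lambda>x. 0) (at_right 0)"
      unfolding L2_limit_def
    proof (intro conjI)
      have z: "L2_norm (\<lambda>x. truncated_riesz k P t f x - 0) = 0" if "t > 0" for t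
        unfolding L2_norm_def using integral_cong_AE[of "\<lambda>x. (norm (truncated_riesz k P t f x))\<^sup>2" lborel "\<lambda>x. 0"] zero[OF that]
        by auto
      show "\<forall>\<^sub>F t in at_right 0. truncated_riesz k P t f \<in> L2"
        using eventually_at_right_less[of "0::real"]
      proof eventually_elim
        case (elim t)
        have "integrable lborel (\<lambda>x. (norm (truncated_riesz k P t f x))\<^sup>2) \<longleftrightarrow> integrable lborel (\<lambda>x::'a. 0::real)"
          using zero[OF elim] by (intro integrable_cong_AE) auto
        then show ?case by (simp add: L2_def)
      qed
      show "((\<lambda>t. L2_norm (\<lambda>x. truncated_riesz k P t f x - 0)) \<longlongrightarrow> 0) (at_right 0)"
        by (rule tendsto_eventually) (use eventually_at_right_less[of "0::real"] in eventually_elim, rule z)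
    qed (simp add: L2_def)
    then show False using no by blast
  qed
  then show ?thesis unfolding riesz_transform_def by (rule someI_ex)
qed

text \<open>The factorization is given for t = 1 only, so it is applied to f(t x). Since
  \<open>riesz_transform\<close> is a choice, it commutes with dilations only almost everywhere, by
  uniqueness of L^2 limits; the factors by which dilation changes the two norms coincide.\<close>

lemma truncated_riesz_le_riesz_transform:
  fixes b :: "'a::euclidean_space \<Rightarrow> real" and P f :: "'a \<Rightarrow> complex"
  assumes b: "riesz_factorization_kernel k b" and le1: "\<And>\<xi>. norm (fourier (\<lambda>x. of_real (b x)) \<xi>) \<le> 1"
    and P: "P \<in> spherical_harmonics k" and f: "f \<in> L2" and t: "t > 0"
  shows "truncated_riesz k P t f \<in> L2"
    and "L2_norm (truncated_riesz k P t f) \<le> L2_norm (riesz_transform k P f)"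
proof -
  have bi: "integrable lborel b" using b by (simp add: riesz_factorization_kernel_def)
  have fm[measurable]: "f \<in> borel_measurable borel" using f by (simp add: L2_def)
  let ?f = "\<lambda>x. 1 * f (t *\<^sub>R x)"
  define F F' where "F = riesz_transform k P f" and "F' = riesz_transform k P ?f"
  have ft: "?f \<in> L2" by (rule L2_dilate(1)[OF f t])
  have lim': "L2_limit (\<lambda>s. truncated_riesz k P s ?f) F' (at_right 0)" unfolding F'_def by (rule riesz_transform_L2_limit[OF b P ft])
  have F': "F' \<in> L2" using lim' by (simp add: L2_limit_def)
  have lim: "L2_limit (\<lambda>s. truncated_riesz k P s f) F (at_right 0)" unfolding F_def by (rule riesz_transform_L2_limit[OF b P f])
  have F: "F \<in> L2" using lim by (simp add: L2_limit_def)
  have ae: "AE x in lborel. 1 / 1 * F' ((1 / t) *\<^sub>R x) = F x"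
    by (rule L2_limit_unique[OF L2_limit_truncated_riesz_dilate[OF P t _ lim'] lim]) auto
  have t': "1 / t > 0" using t by simp
  have nF: "L2_norm F = L2_norm F' / sqrt ((1 / t) ^ DIM('a))"
  proof -
    have "L2_norm F = L2_norm (\<lambda>x. 1 * F' ((1 / t) *\<^sub>R x))"
      unfolding L2_norm_def
      using ae F L2_dilate(1)[OF F' t', of 1] by (intro arg_cong[of _ _ sqrt] integral_cong_AE) (auto simp: L2_def)
    then show ?thesis unfolding L2_dilate(2)[OF F' t', of 1] by simp
  qed
  have conv: "AE x in lborel. truncated_riesz k P 1 ?f x = convolution b F' x"
    using b P ft unfolding riesz_factorization_kernel_def F'_def by blast
  note cL2 = convolution_contraction[OF bi le1 F']
  have m: "truncated_riesz k P 1 ?f \<in> borel_measurable lborel"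
    using borel_measurable_truncated_riesz[OF P, of ?f] ft by (simp add: L2_def)
  have cm: "convolution b F' \<in> borel_measurable lborel" using cL2(1) by (simp add: L2_def)
  have R1: "truncated_riesz k P 1 ?f \<in> L2"
  proof -
    have "integrable lborel (\<lambda>x. (norm (truncated_riesz k P 1 ?f x))\<^sup>2) \<longleftrightarrow> integrable lborel (\<lambda>x. (norm (convolution b F' x))\<^sup>2)"
      using conv m cm by (intro integrable_cong_AE) auto
    then show ?thesis using cL2(1) m by (simp add: L2_def)
  qed
  have R1n: "L2_norm (truncated_riesz k P 1 ?f) = L2_norm (convolution b F')"
    unfolding L2_norm_def using conv m cm by (intro arg_cong[of _ _ sqrt] integral_cong_AE) auto
  have eq: "truncated_riesz k P t f = (\<lambda>x. 1 * truncated_riesz k P 1 ?f ((1 / t) *\<^sub>R x))"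
    using t by (simp only: truncated_riesz_dilate[OF P t]) simp
  show "truncated_riesz k P t f \<in> L2" unfolding eq by (rule L2_dilate(1)[OF R1 t'])
  have "L2_norm (truncated_riesz k P t f) = L2_norm (convolution b F') / sqrt ((1 / t) ^ DIM('a))"
    unfolding eq L2_dilate(2)[OF R1 t'] R1n by simp
  also have "\<dots> \<le> L2_norm F' / sqrt ((1 / t) ^ DIM('a))"
    using t by (intro divide_right_mono cL2) auto
  finally show "L2_norm (truncated_riesz k P t f) \<le> L2_norm (riesz_transform k P f)" using nF by (simp add: F_def)
qed

section \<open>The Hecke--Bochner formula on annuli\<close>

lemma integrable_gaussian:
  assumes "l > 0" shows "integrable lborel (\<lambda>y::'a::euclidean_space. exp (- (l * (norm y)\<^sup>2)))"
proof -
  have "integrable lborel (\<lambda>y::'a. Re (exp (of_real (- l * (norm y)\<^sup>2) + (\<Sum>b\<in>Basis. of_real (y \<bullet> b) * 0))))"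
    by (rule integrable_Re[OF gaussian_integral(1)[OF assms]])
  then show ?thesis by (simp add: Re_exp)
qed

lemma integrable_exp_linear_gaussian:
  assumes l: "l > 0"
  shows "integrable lborel (\<lambda>y::'a::euclidean_space. exp (r * norm y) * exp (- (l * (norm y)\<^sup>2)))"
proof (rule Bochner_Integration.integrable_bound)
  show "integrable lborel (\<lambda>y::'a. exp (r\<^sup>2 / (2 * l)) * exp (- (l / 2 * (norm y)\<^sup>2)))"
    using integrable_gaussian[of "l / 2", where 'a = 'a] l by simp
  show "AE y::'a in lborel. norm (exp (r * norm y) * exp (- (l * (norm y)\<^sup>2)))
      \<le> norm (exp (r\<^sup>2 / (2 * l)) * exp (- (l / 2 * (norm y)\<^sup>2)))"
  proof (rule AE_I2)
    fix y :: 'a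
    have "r\<^sup>2 / (2 * l) + l / 2 * (norm y)\<^sup>2 - r * norm y = (r - l * norm y)\<^sup>2 / (2 * l)"
      using l by (simp add: field_simps power2_eq_square)
    also have "\<dots> \<ge> 0" using l by simp
    finally have "r * norm y + - (l * (norm y)\<^sup>2) \<le> r\<^sup>2 / (2 * l) + - (l / 2 * (norm y)\<^sup>2)" by simp
    then show "norm (exp (r * norm y) * exp (- (l * (norm y)\<^sup>2))) \<le> norm (exp (r\<^sup>2 / (2 * l)) * exp (- (l / 2 * (norm y)\<^sup>2)))"
      unfolding exp_add[symmetric] by simp
  qed
qed measurable

lemma sum_power_over_fact_le_exp: "x \<ge> 0 \<Longrightarrow> (\<Sum>i<n. x ^ i / fact i) \<le> exp (x :: real)"
  unfolding exp_def using summable_exp_generic[of x]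
  by (intro order_trans[OF _ sum_le_suminf[of _ "{..<n}"]]) (auto simp: divide_inverse mult.commute)

definition complex_linear :: "'a::euclidean_space \<Rightarrow> 'a \<Rightarrow> 'a \<Rightarrow> complex" where
  "complex_linear a a' y = Complex (y \<bullet> a) (y \<bullet> a')"

lemma norm_complex_linear_le: "norm (complex_linear a a' y) \<le> (norm a + norm a') * norm y"
proof -
  have "norm (complex_linear a a' y) \<le> \<bar>y \<bullet> a\<bar> + \<bar>y \<bullet> a'\<bar>"
    unfolding complex_linear_def using cmod_le[of "Complex (y \<bullet> a) (y \<bullet> a')"] by simp
  also have "\<dots> \<le> norm y * norm a + norm y * norm a'" by (intro add_mono Cauchy_Schwarz_ineq2)
  finally show ?thesis by (simp add: algebra_simps)
qed

lemma continuous_on_complex_linear: "continuous_on UNIV (complex_linear a a')"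
  unfolding complex_linear_def[abs_def] by (intro continuous_intros)

lemma borel_measurable_complex_linear [measurable]: "complex_linear a a' \<in> borel_measurable borel"
  by (intro borel_measurable_continuous_onI continuous_on_complex_linear)

text \<open>The exponential of w z(y) generates the powers of the linear form z, and its integral
  against a Gaussian times a character is explicit. The coefficient of w^2 in the exponent is the
  bilinear square of a + i a' divided by 4 l; isotropy means exactly that it vanishes.\<close>

lemma gaussian_generating_function:
  fixes a a' \<xi> :: "'a::euclidean_space"
  assumes l: "l > 0"
  defines "G \<equiv> \<lambda>y. of_real (exp (- (l * (norm y)\<^sup>2))) * cis (- (2 * pi * (y \<bullet> \<xi>)))"
  shows "(\<lambda>j. (LINT y|lborel. complex_linear a a' y ^ j / fact j * G y) * w ^ j) sums
    (of_real (sqrt (pi / l) ^ DIM('a) * exp (- (pi\<^sup>2 * (norm \<xi>)\<^sup>2 / l)))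
      * exp (- (\<i> * pi * complex_linear a a' \<xi> / l) * w + Complex ((norm a)\<^sup>2 - (norm a')\<^sup>2) (2 * (a \<bullet> a')) / (4 * l) * w\<^sup>2))" (is "_ sums ?R")
    and "integrable lborel (\<lambda>y. complex_linear a a' y ^ j * G y)"
proof -
  let ?z = "complex_linear a a'"
  let ?M = "norm a + norm a'"
  have [measurable]: "G \<in> borel_measurable borel" unfolding G_def by measurable
  have nG: "norm (G y) = exp (- (l * (norm y)\<^sup>2))" for y unfolding G_def by (simp add: norm_mult)
  define f where "f = (\<lambda>w j y. (w * ?z y) ^ j / fact j * G y)"
  have [measurable]: "f w j \<in> borel_measurable borel" for w j unfolding f_def by measurable
  have nf: "norm (f w j y) = (norm w * norm (?z y)) ^ j / fact j * exp (- (l * (norm y)\<^sup>2))" for w j y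
    unfolding f_def by (simp add: norm_mult norm_divide norm_power nG)
  have sum_le: "(\<Sum>j<n. norm (f w j y)) \<le> exp (norm w * ?M * norm y) * exp (- (l * (norm y)\<^sup>2))" for n w y
  proof -
    have "(\<Sum>j<n. norm (f w j y)) = (\<Sum>j<n. (norm w * norm (?z y)) ^ j / fact j) * exp (- (l * (norm y)\<^sup>2))"
      unfolding nf sum_distrib_right ..
    also have "\<dots> \<le> exp (norm w * norm (?z y)) * exp (- (l * (norm y)\<^sup>2))"
      by (intro mult_right_mono sum_power_over_fact_le_exp) auto
    also have "\<dots> \<le> exp (norm w * ?M * norm y) * exp (- (l * (norm y)\<^sup>2))"
      using mult_left_mono[OF norm_complex_linear_le[of a a' y], of "norm w"] by (intro mult_right_mono) (auto simp: mult.assoc)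
    finally show ?thesis .
  qed
  have dom: "integrable lborel (\<lambda>y::'a. exp (norm w * ?M * norm y) * exp (- (l * (norm y)\<^sup>2)))" for w :: complex
    by (rule integrable_exp_linear_gaussian[OF l])
  have int: "integrable lborel (f w j)" for w j
  proof (rule Bochner_Integration.integrable_bound[OF dom[of w]])
    show "AE y in lborel. norm (f w j y) \<le> norm (exp (norm w * ?M * norm y) * exp (- (l * (norm y)\<^sup>2)))"
    proof (rule AE_I2)
      fix y
      have "norm (f w j y) \<le> (\<Sum>i<Suc j. norm (f w i y))" by (simp add: sum_nonneg)
      also note sum_le
      finally show "norm (f w j y) \<le> norm (exp (norm w * ?M * norm y) * exp (- (l * (norm y)\<^sup>2)))" by simp
    qed
  qed measurable
  have "integrable lborel (\<lambda>y. fact j * f 1 j y)" using int[of 1 j] by simp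
  then show "integrable lborel (\<lambda>y. ?z y ^ j * G y)" by (simp add: f_def)
  have "(\<lambda>j. LINT y|lborel. f w j y) sums (LINT y|lborel. (\<Sum>j. f w j y))"
  proof (rule sums_integral)
    show "AE y in lborel. summable (\<lambda>j. norm (f w j y))"
      by (intro AE_I2 summableI_nonneg_bounded[OF _ sum_le]) auto
    show "summable (\<lambda>j. LINT y|lborel. norm (f w j y))"
    proof (rule summableI_nonneg_bounded)
      fix n
      have "(\<Sum>j<n. LINT y|lborel. norm (f w j y)) = (LINT y|lborel. (\<Sum>j<n. norm (f w j y)))"
        using int by (subst Bochner_Integration.integral_sum) auto
      also have "\<dots> \<le> (LINT y::'a|lborel. exp (norm w * ?M * norm y) * exp (- (l * (norm y)\<^sup>2)))"
        using int by (intro integral_mono dom sum_le) auto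
      finally show "(\<Sum>j<n. LINT y|lborel. norm (f w j y)) \<le> (LINT y::'a|lborel. exp (norm w * ?M * norm y) * exp (- (l * (norm y)\<^sup>2)))" .
    qed (simp add: integral_nonneg_AE)
  qed (rule int)
  also have "(\<lambda>j. LINT y|lborel. f w j y) = (\<lambda>j. (LINT y|lborel. ?z y ^ j / fact j * G y) * w ^ j)"
    unfolding f_def by (intro ext, subst integral_mult_left_zero[symmetric]) (simp add: power_mult_distrib mult_ac)
  also have "(\<lambda>y. \<Sum>j. f w j y) = (\<lambda>y. exp (of_real (- l * (norm y)\<^sup>2)
       + (\<Sum>b\<in>Basis. of_real (y \<bullet> b) * (w * Complex (a \<bullet> b) (a' \<bullet> b) - 2 * pi * \<i> * (\<xi> \<bullet> b)))))"
  proof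
    fix y
    have "(\<lambda>j. (w * ?z y) ^ j / fact j * G y) sums (exp (w * ?z y) * G y)"
      using sums_mult2[OF exp_converges[of "w * ?z y"], of "G y"] by (simp add: scaleR_conv_of_real field_simps)
    then have "(\<Sum>j. f w j y) = exp (w * ?z y) * G y" unfolding f_def by (simp add: sums_iff)
    also have "\<dots> = exp (w * ?z y + of_real (- (l * (norm y)\<^sup>2)) + \<i> * of_real (- (2 * pi * (y \<bullet> \<xi>))))"
      unfolding G_def cis_conv_exp by (simp only: exp_add exp_of_real mult.assoc)
    also have "w * ?z y + of_real (- (l * (norm y)\<^sup>2)) + \<i> * of_real (- (2 * pi * (y \<bullet> \<xi>))) = of_real (- l * (norm y)\<^sup>2)
       + (\<Sum>b\<in>Basis. of_real (y \<bullet> b) * (w * Complex (a \<bullet> b) (a' \<bullet> b) - 2 * pi * \<i> * (\<xi> \<bullet> b)))"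
    proof -
      have 1: "?z y = (\<Sum>b\<in>Basis. of_real (y \<bullet> b) * Complex (a \<bullet> b) (a' \<bullet> b))"
        unfolding complex_linear_def by (simp add: complex_eq_iff euclidean_inner[of y a] euclidean_inner[of y a'])
      have 2: "complex_of_real (y \<bullet> \<xi>) = (\<Sum>b\<in>Basis. of_real (y \<bullet> b) * of_real (\<xi> \<bullet> b))"
        by (simp add: euclidean_inner[of y \<xi>])
      have "(\<Sum>b\<in>Basis. of_real (y \<bullet> b) * (w * Complex (a \<bullet> b) (a' \<bullet> b) - 2 * pi * \<i> * (\<xi> \<bullet> b)))
        = (\<Sum>b\<in>Basis. w * (of_real (y \<bullet> b) * Complex (a \<bullet> b) (a' \<bullet> b)) - 2 * pi * \<i> * (of_real (y \<bullet> b) * of_real (\<xi> \<bullet> b)))"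
        by (intro sum.cong refl) (simp only: right_diff_distrib mult_ac)
      also have "\<dots> = w * ?z y - 2 * pi * \<i> * of_real (y \<bullet> \<xi>)"
        unfolding 1 2 sum_subtractf sum_distrib_left ..
      finally show ?thesis by simp
    qed
    finally show "(\<Sum>j. f w j y) = exp (of_real (- l * (norm y)\<^sup>2)
       + (\<Sum>b\<in>Basis. of_real (y \<bullet> b) * (w * Complex (a \<bullet> b) (a' \<bullet> b) - 2 * pi * \<i> * (\<xi> \<bullet> b))))" .
  qed
  also have "(LINT y|lborel. exp (of_real (- l * (norm y)\<^sup>2)
       + (\<Sum>b\<in>Basis. of_real (y \<bullet> b) * (w * Complex (a \<bullet> b) (a' \<bullet> b) - 2 * pi * \<i> * (\<xi> \<bullet> b))))) =
     of_real (sqrt (pi / l) ^ DIM('a)) * exp ((\<Sum>b\<in>Basis. (w * Complex (a \<bullet> b) (a' \<bullet> b) - 2 * pi * \<i> * (\<xi> \<bullet> b))\<^sup>2) / (4 * of_real l))"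
    by (rule gaussian_integral(2)[OF l])
  also have "(\<Sum>b\<in>Basis. (w * Complex (a \<bullet> b) (a' \<bullet> b) - 2 * pi * \<i> * (\<xi> \<bullet> b))\<^sup>2)
     = w\<^sup>2 * Complex ((norm a)\<^sup>2 - (norm a')\<^sup>2) (2 * (a \<bullet> a')) - 4 * pi * \<i> * w * ?z \<xi> - of_real (4 * pi\<^sup>2 * (norm \<xi>)\<^sup>2)"
  proof -
    have sq: "(norm u)\<^sup>2 = (\<Sum>b\<in>Basis. (u \<bullet> b)\<^sup>2)" for u :: 'a
      unfolding power2_norm_eq_inner by (subst euclidean_inner) (simp add: power2_eq_square)
    have ip: "u \<bullet> v = (\<Sum>b\<in>Basis. (u \<bullet> b) * (v \<bullet> b))" for u v :: 'a
      by (rule euclidean_inner)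
    have 1: "(\<Sum>b\<in>Basis. (Complex (a \<bullet> b) (a' \<bullet> b))\<^sup>2) = Complex ((norm a)\<^sup>2 - (norm a')\<^sup>2) (2 * (a \<bullet> a'))"
      unfolding sq ip[of a a'] sum_distrib_left sum_subtractf[symmetric]
      by (rule complex_eqI) (simp_all add: power2_eq_square mult.assoc)
    have 2: "(\<Sum>b\<in>Basis. Complex (a \<bullet> b) (a' \<bullet> b) * of_real (\<xi> \<bullet> b)) = ?z \<xi>"
      unfolding complex_linear_def ip[of \<xi> a] ip[of \<xi> a'] by (rule complex_eqI) (simp_all add: mult.commute)
    have 3: "(\<Sum>b\<in>Basis. (complex_of_real (\<xi> \<bullet> b))\<^sup>2) = of_real ((norm \<xi>)\<^sup>2)"
      unfolding sq by simp
    have "(\<Sum>b\<in>Basis. (w * Complex (a \<bullet> b) (a' \<bullet> b) - 2 * pi * \<i> * (\<xi> \<bullet> b))\<^sup>2)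
      = (\<Sum>b\<in>Basis. w\<^sup>2 * (Complex (a \<bullet> b) (a' \<bullet> b))\<^sup>2 - 4 * pi * \<i> * w * (Complex (a \<bullet> b) (a' \<bullet> b) * of_real (\<xi> \<bullet> b)) - of_real (4 * pi\<^sup>2) * (complex_of_real (\<xi> \<bullet> b))\<^sup>2)"
    proof (intro sum.cong refl)
      fix b :: 'a
      have "(w * c - 2 * p * \<i> * x)\<^sup>2 = w\<^sup>2 * c\<^sup>2 - 4 * p * \<i> * w * (c * x) - 4 * p\<^sup>2 * x\<^sup>2" for c p x :: complex
        by (simp add: power2_diff power_mult_distrib mult_ac)
      from this[of "Complex (a \<bullet> b) (a' \<bullet> b)" "of_real pi" "of_real (\<xi> \<bullet> b)"]
      show "(w * Complex (a \<bullet> b) (a' \<bullet> b) - 2 * pi * \<i> * (\<xi> \<bullet> b))\<^sup>2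
        = w\<^sup>2 * (Complex (a \<bullet> b) (a' \<bullet> b))\<^sup>2 - 4 * pi * \<i> * w * (Complex (a \<bullet> b) (a' \<bullet> b) * of_real (\<xi> \<bullet> b)) - of_real (4 * pi\<^sup>2) * (complex_of_real (\<xi> \<bullet> b))\<^sup>2"
        by (simp only: of_real_mult of_real_power of_real_numeral)
    qed
    also have "\<dots> = w\<^sup>2 * (\<Sum>b\<in>Basis. (Complex (a \<bullet> b) (a' \<bullet> b))\<^sup>2) - 4 * pi * \<i> * w * (\<Sum>b\<in>Basis. Complex (a \<bullet> b) (a' \<bullet> b) * of_real (\<xi> \<bullet> b)) - of_real (4 * pi\<^sup>2) * (\<Sum>b\<in>Basis. (complex_of_real (\<xi> \<bullet> b))\<^sup>2)"
      unfolding sum_subtractf sum_distrib_left ..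
    finally show ?thesis unfolding 1 2 3 by simp
  qed
  also have "of_real (sqrt (pi / l) ^ DIM('a)) * exp ((w\<^sup>2 * Complex ((norm a)\<^sup>2 - (norm a')\<^sup>2) (2 * (a \<bullet> a')) - 4 * pi * \<i> * w * ?z \<xi> - of_real (4 * pi\<^sup>2 * (norm \<xi>)\<^sup>2)) / (4 * of_real l)) = ?R"
  proof -
    have "(w\<^sup>2 * Complex ((norm a)\<^sup>2 - (norm a')\<^sup>2) (2 * (a \<bullet> a')) - 4 * pi * \<i> * w * ?z \<xi> - of_real (4 * pi\<^sup>2 * (norm \<xi>)\<^sup>2)) / (4 * of_real l)
      = of_real (- (pi\<^sup>2 * (norm \<xi>)\<^sup>2 / l)) + (- (\<i> * pi * ?z \<xi> / l) * w + Complex ((norm a)\<^sup>2 - (norm a')\<^sup>2) (2 * (a \<bullet> a')) / (4 * l) * w\<^sup>2)"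
    proof -
      have "(w\<^sup>2 * X - 4 * p * \<i> * w * z - 4 * p\<^sup>2 * N) / (4 * L) = - (p\<^sup>2 * N / L) + (- (\<i> * p * z / L) * w + X / (4 * L) * w\<^sup>2)"
        if "L \<noteq> 0" for X p z N L :: complex
        using that by (simp add: field_simps)
      from this[of "of_real l" "Complex ((norm a)\<^sup>2 - (norm a')\<^sup>2) (2 * (a \<bullet> a'))" "of_real pi" "?z \<xi>" "of_real ((norm \<xi>)\<^sup>2)"] l
      show ?thesis by simp
    qed
    then show ?thesis by (simp only: exp_add exp_of_real of_real_mult mult.assoc)
  qed
  finally show "(\<lambda>j. (LINT y|lborel. ?z y ^ j / fact j * G y) * w ^ j) sums ?R" .
qed

text \<open>Comparison of the coefficients of w^k in the generating function. For isotropic a + i a'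
  the right-hand side is a pure exponential in w; for k = 1 the quadratic term does not affect the
  coefficient of w, so any a and a' will do.\<close>

lemma gaussian_harmonic_fourier:
  fixes a a' \<xi> :: "'a::euclidean_space"
  assumes l: "l > 0" and harm: "k = 1 \<or> (norm a = norm a' \<and> a \<bullet> a' = 0)"
  shows "(LINT y|lborel. complex_linear a a' y ^ k * (of_real (exp (- (l * (norm y)\<^sup>2))) * cis (- (2 * pi * (y \<bullet> \<xi>)))))
     = of_real (sqrt (pi / l) ^ DIM('a) * exp (- (pi\<^sup>2 * (norm \<xi>)\<^sup>2 / l))) * (- (\<i> * pi * complex_linear a a' \<xi> / l)) ^ k"
proof -
  define G where "G = (\<lambda>y. of_real (exp (- (l * (norm y)\<^sup>2))) * cis (- (2 * pi * (y \<bullet> \<xi>))))"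
  define c where "c = (\<lambda>j. LINT y|lborel. complex_linear a a' y ^ j / fact j * G y)"
  define C where "C = complex_of_real (sqrt (pi / l) ^ DIM('a) * exp (- (pi\<^sup>2 * (norm \<xi>)\<^sup>2 / l)))"
  define \<alpha> where "\<alpha> = - (\<i> * pi * complex_linear a a' \<xi> / l)"
  define \<beta> where "\<beta> = Complex ((norm a)\<^sup>2 - (norm a')\<^sup>2) (2 * (a \<bullet> a')) / (4 * l)"
  have sums: "(\<lambda>j. c j * w ^ j) sums (C * exp (\<alpha> * w + \<beta> * w\<^sup>2))" for w
    using gaussian_generating_function(1)[OF l, where a = a and a' = a' and \<xi> = \<xi> and w = w] unfolding c_def G_def C_def \<alpha>_def \<beta>_def by simp
  have summ: "summable (\<lambda>j. c j * w ^ j)" for w using sums sums_iff by blast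
  have "c k = C * \<alpha> ^ k / fact k"
  proof (cases "k = 1")
    case True
    have "((\<lambda>w. \<Sum>j. c j * w ^ j) has_field_derivative (\<Sum>j. diffs c j * 0 ^ j)) (at 0)"
      by (rule termdiffs_strong_converges_everywhere[OF summ])
    moreover have "(\<lambda>w. \<Sum>j. c j * w ^ j) = (\<lambda>w. C * exp (\<alpha> * w + \<beta> * w\<^sup>2))" using sums by (auto simp: sums_iff)
    moreover have "((\<lambda>w. C * exp (\<alpha> * w + \<beta> * w\<^sup>2)) has_field_derivative C * \<alpha>) (at 0)"
      by (auto intro!: derivative_eq_intros)
    ultimately have "(\<Sum>j. diffs c j * 0 ^ j) = C * \<alpha>" using DERIV_unique by metis
    then show ?thesis by (simp add: powser_zero diffs_def True)
  next
    case False
    then have \<beta>: "\<beta> = 0" using harm by (auto simp: \<beta>_def complex_eq_iff)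
    define F where "F = Abs_fps c"
    have F: "fps_conv_radius F = \<infinity>" unfolding fps_conv_radius_def F_def
      using conv_radius_inftyI''[of c] summ by simp
    have "F = fps_const C * fps_exp \<alpha>"
    proof (rule eval_fps_eqD)
      show "fps_conv_radius F > 0" using F by simp
      have r: "fps_conv_radius (fps_const C * fps_exp \<alpha>) = \<infinity>"
        using fps_conv_radius_mult[of "fps_const C" "fps_exp \<alpha>"] by simp
      then show "fps_conv_radius (fps_const C * fps_exp \<alpha>) > 0" by simp
      show "\<forall>\<^sub>F z in nhds 0. eval_fps F z = eval_fps (fps_const C * fps_exp \<alpha>) z"
      proof (rule always_eventually, rule allI)
        fix z
        have "eval_fps F z = C * exp (\<alpha> * z)" unfolding eval_fps_def F_def using sums[of z] \<beta> by (simp add: sums_iff)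
        also have "\<dots> = eval_fps (fps_const C * fps_exp \<alpha>) z" by (subst eval_fps_mult) auto
        finally show "eval_fps F z = eval_fps (fps_const C * fps_exp \<alpha>) z" .
      qed
    qed
    then have "fps_nth F k = C * (\<alpha> ^ k / fact k)" by simp
    then show ?thesis by (simp add: F_def)
  qed
  moreover have "c k = (LINT y|lborel. complex_linear a a' y ^ k * G y) / fact k"
    unfolding c_def by (subst integral_divide_zero[symmetric]) simp
  ultimately have "(LINT y|lborel. complex_linear a a' y ^ k * G y) = C * \<alpha> ^ k" by simp
  then show ?thesis unfolding C_def \<alpha>_def G_def by (simp only: of_real_mult)
qed

text \<open>The value is Gamma((m + 1) / 2) / 2. What is used later is that it is positive and
  satisfies the recursion in steps of two.\<close>

definition half_moment :: "nat \<Rightarrow> real" where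
  "half_moment m = (LINT x|lborel. indicator {0..} x *\<^sub>R (exp (- x\<^sup>2) * x ^ m))"

lemma half_moment_parity:
  "integrable lborel (\<lambda>x::real. indicator {0..} x *\<^sub>R (exp (- x\<^sup>2) * x ^ (2 * p)))"
  "half_moment (2 * p) = (sqrt pi / 2) * (fact (2 * p) / (2 ^ (2 * p) * fact p))"
  "integrable lborel (\<lambda>x::real. indicator {0..} x *\<^sub>R (exp (- x\<^sup>2) * x ^ (2 * p + 1)))"
  "half_moment (2 * p + 1) = fact p / 2"
  unfolding half_moment_def
  using gaussian_moment_even_pos[of p] gaussian_moment_odd_pos[of p] by (simp_all only: has_bochner_integral_iff)

lemma integrable_half_moment: "integrable lborel (\<lambda>x::real. indicator {0..} x *\<^sub>R (exp (- x\<^sup>2) * x ^ m))"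
  using half_moment_parity(1,3)[of "m div 2"] by (cases "even m") auto

lemma half_moment_pos: "half_moment m > 0"
proof (cases "even m")
  case True
  then obtain p where m: "m = 2 * p" by blast
  show ?thesis unfolding m half_moment_parity(2) by simp
next
  case False
  then obtain p where m: "m = 2 * p + 1" using oddE by blast
  show ?thesis unfolding m half_moment_parity(4) by simp
qed

lemma half_moment_Suc_Suc: "half_moment (Suc (Suc m)) = (real m + 1) / 2 * half_moment m"
proof (cases "even m")
  case True
  then obtain p where m: "m = 2 * p" by blast
  have e: "Suc (Suc m) = 2 * Suc p" using m by simp
  have f: "fact (2 * Suc p) = (2 * (real p + 1)) * (2 * real p + 1) * fact (2 * p)"
    by (simp add: algebra_simps)
  have c: "(2 * c) * D * X / (4 * Y * (c * Z)) = D / 2 * (X / (Y * Z))" if "c \<noteq> 0" for c D X Y Z :: real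
    using that by simp
  have "fact (2 * Suc p) / (2 ^ (2 * Suc p) * fact (Suc p)) = (2 * real p + 1) / 2 * (fact (2 * p) / (2 ^ (2 * p) * fact p) :: real)"
    using c[of "real p + 1" "2 * real p + 1" "fact (2 * p)" "2 ^ (2 * p)" "fact p"] unfolding f by (simp add: add.commute)
  then show ?thesis unfolding e half_moment_parity(2) unfolding m half_moment_parity(2) by simp
next
  case False
  then obtain p where m: "m = 2 * p + 1" using oddE by blast
  have e: "Suc (Suc m) = 2 * Suc p + 1" using m by simp
  show ?thesis unfolding e half_moment_parity(4) unfolding m half_moment_parity(4) by simp
qed

text \<open>The factor on the right is the Pochhammer symbol in the denominator of
  \<open>bessel_coeff\<close> for D = N, so the two cancel when the Bessel series is integrated
  against a Gaussian.\<close>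

lemma half_moment_pochhammer:
  assumes "N > 0" shows "half_moment (N - 1 + 2 * n) = pochhammer (real N / 2) n * half_moment (N - 1)"
proof (induction n)
  case (Suc n)
  have "N - 1 + 2 * Suc n = Suc (Suc (N - 1 + 2 * n))" by simp
  then have "half_moment (N - 1 + 2 * Suc n) = (real (N - 1 + 2 * n) + 1) / 2 * half_moment (N - 1 + 2 * n)"
    by (simp only: half_moment_Suc_Suc)
  also have "(real (N - 1 + 2 * n) + 1) / 2 = real N / 2 + real n" using assms by (simp add: of_nat_diff)
  finally show ?case using Suc by (simp add: pochhammer_Suc)
qed simp

lemma half_moment_scaled:
  assumes l: "l > 0"
  shows "integrable lborel (\<lambda>r::real. indicator {0..} r *\<^sub>R (exp (- (l * r\<^sup>2)) * r ^ m))"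
    and "(LINT r|lborel. indicator {0..} r *\<^sub>R (exp (- (l * (r::real)\<^sup>2)) * r ^ m)) = (1 / sqrt l) ^ (m + 1) * half_moment m"
proof -
  let ?f = "\<lambda>r::real. indicator {0..} r *\<^sub>R (exp (- (l * r\<^sup>2)) * r ^ m)"
  let ?g = "\<lambda>x::real. indicator {0..} x *\<^sub>R (exp (- x\<^sup>2) * x ^ m)"
  define c where "c = 1 / sqrt l"
  have c: "c > 0" using l by (simp add: c_def)
  have eq: "?f (0 + c * x) = c ^ m * ?g x" for x
  proof -
    have "l * (c * x)\<^sup>2 = x\<^sup>2" using l by (simp add: c_def power_mult_distrib power_divide)
    moreover have "indicator {0..} (c * x) = (indicator {0..} x :: real)" using c by (simp add: indicator_def zero_le_mult_iff)
    ultimately show ?thesis by (simp add: power_mult_distrib)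
  qed
  have "integrable lborel (\<lambda>x. ?f (0 + c * x))" unfolding eq using integrable_half_moment by simp
  then show "integrable lborel ?f" using c by (subst (asm) lborel_integrable_real_affine_iff) auto
  have "(LINT r|lborel. ?f r) = c *\<^sub>R (LINT x|lborel. ?f (0 + c * x))"
    using lborel_integral_real_affine[of c ?f 0] c by simp
  also have "\<dots> = c * (c ^ m * half_moment m)" unfolding eq half_moment_def by simp
  finally show "(LINT r|lborel. ?f r) = (1 / sqrt l) ^ (m + 1) * half_moment m" by (simp add: c_def)
qed

text \<open>Termwise integration leaves the series of exp (- pi^2 s^2 / l). This is the radial form,
  in dimension N, of the fact that the transform of a Gaussian is a Gaussian.\<close>

lemma bessel_j_gaussian_integral:
  fixes s :: real
  assumes l: "l > 0" and N: "N \<ge> 2"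
  defines "A \<equiv> \<lambda>r. indicator {0..} r *\<^sub>R (bessel_j (real N) (2 * pi * s * r) * r ^ (N - 1) * exp (- (l * r\<^sup>2)))"
  shows "integrable lborel A"
    and "(LINT r|lborel. A r) = (1 / sqrt l) ^ N * half_moment (N - 1) * exp (- (pi\<^sup>2 * s\<^sup>2 / l))"
proof -
  define q where "q = pi\<^sup>2 * s\<^sup>2 / l"
  define f where "f = (\<lambda>n (r::real). (bessel_coeff (real N) n * ((2 * pi * s)\<^sup>2) ^ n) * (indicator {0..} r *\<^sub>R (exp (- (l * r\<^sup>2)) * r ^ (N - 1 + 2 * n))))"
  define C where "C = (1 / sqrt l) ^ N * half_moment (N - 1)"
  have N0: "N > 0" using N by simp
  have poch: "pochhammer (real N / 2) n > 0" for n using N by (intro pochhammer_pos) auto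
  have m: "((2 * pi * s)\<^sup>2) ^ n * ((1 / sqrt l) ^ (N - 1 + 2 * n + 1) * half_moment (N - 1 + 2 * n)) / (4 ^ n * fact n * pochhammer (real N / 2) n)
      = C * (q ^ n / fact n)" for n
  proof -
    have 1: "(1 / sqrt l) ^ (N - 1 + 2 * n + 1) = (1 / sqrt l) ^ N * (1 / l) ^ n"
    proof -
      have "N - 1 + 2 * n + 1 = N + 2 * n" using N by simp
      then show ?thesis using l by (simp add: power_add power_mult power_divide)
    qed
    have 2: "((2 * pi * s)\<^sup>2) ^ n * (1 / l) ^ n = 4 ^ n * q ^ n"
      unfolding q_def power_mult_distrib[symmetric] by (simp add: power_mult_distrib mult.assoc)
    have 3: "S * (X * L * (p * h)) / (F * f * p) = X * h * (S * L / (F * f))" if "p > 0" for S X L p h F f :: real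
      using that by simp
    show ?thesis unfolding half_moment_pochhammer[OF N0] 1 3[OF poch] 2 C_def by simp
  qed
  have int: "integrable lborel (f n)" for n
    unfolding f_def using half_moment_scaled(1)[OF l] by simp
  have val: "(LINT r|lborel. f n r) = C * ((- q) ^ n / fact n)" for n
  proof -
    have "(LINT r|lborel. f n r) = (-1) ^ n * (((2 * pi * s)\<^sup>2) ^ n * ((1 / sqrt l) ^ (N - 1 + 2 * n + 1) * half_moment (N - 1 + 2 * n)) / (4 ^ n * fact n * pochhammer (real N / 2) n))"
      unfolding f_def bessel_coeff_def integral_mult_right_zero half_moment_scaled(2)[OF l] by (simp add: mult_ac)
    also have "\<dots> = C * ((- q) ^ n / fact n)" unfolding m by (simp add: power_minus[of q])
    finally show ?thesis .
  qed
  \<comment> \<open>The sign of each term is (-1)^n for all r, so the integrals of the absolute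
    values sum to C exp q. This finite sum justifies the exchange of sum and integral.\<close>
  have valn: "(LINT r|lborel. norm (f n r)) = C * (q ^ n / fact n)" for n
  proof -
    have "norm (f n r) = (-1) ^ n * f n r" for r
    proof -
      have 1: "\<bar>bessel_coeff (real N) n\<bar> = (-1) ^ n * bessel_coeff (real N) n"
        using poch[of n] by (simp add: bessel_coeff_def abs_mult power_abs power_mult_distrib[symmetric])
      have "indicator {0..} r *\<^sub>R (exp (- (l * r\<^sup>2)) * r ^ (N - 1 + 2 * n)) \<ge> 0" by (simp add: indicator_def)
      then show ?thesis unfolding f_def real_norm_def abs_mult 1 by (simp add: mult_ac)
    qed
    then have "(LINT r|lborel. norm (f n r)) = (-1) ^ n * (C * ((- q) ^ n / fact n))" using val[of n] by simp
    then show ?thesis by (simp add: power_mult_distrib[symmetric])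
  qed
  have exps: "(\<lambda>n. C * (x ^ n / fact n)) sums (C * exp x)" for x :: real
    using sums_mult[OF exp_converges[of x], of C] by (simp add: field_simps)
  define W where "W = (\<lambda>r::real. indicator {0..} r * (exp (- (l * r\<^sup>2)) * r ^ (N - 1)))"
  have f_eq: "f n r = bessel_coeff (real N) n * ((2 * pi * s * r)\<^sup>2) ^ n * W r" for n r
  proof -
    have "((2 * pi * s * r)\<^sup>2) ^ n = ((2 * pi * s)\<^sup>2) ^ n * (r\<^sup>2) ^ n"
      unfolding power_mult_distrib[of "2 * pi * s" r 2] by (rule power_mult_distrib)
    moreover have "r ^ (N - 1 + 2 * n) = r ^ (N - 1) * (r\<^sup>2) ^ n" by (simp only: power_add power_mult)
    ultimately show ?thesis unfolding f_def W_def real_scaleR_def by (simp only: mult_ac)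
  qed
  have fA: "(\<lambda>n. f n r) sums A r" for r
  proof -
    have "(\<lambda>n. bessel_coeff (real N) n * ((2 * pi * s * r)\<^sup>2) ^ n) sums bessel_j (real N) (2 * pi * s * r)"
      unfolding bessel_j_def using N by (intro summable_sums summable_bessel_coeff) auto
    from sums_mult2[OF this, of "W r"] show ?thesis unfolding f_eq by (simp add: A_def W_def mult_ac)
  qed
  have summ: "summable (\<lambda>n. norm (f n r))" for r
  proof -
    have "norm (f n r) \<le> \<bar>W r\<bar> * (((2 * pi * s * r)\<^sup>2) ^ n /\<^sub>R fact n)" for n
    proof -
      have "\<bar>bessel_coeff (real N) n\<bar> \<le> 1 / (4 ^ n * fact n)" using N by (intro abs_bessel_coeff_le) auto
      also have "\<dots> \<le> 1 / (1 * fact n)" by (intro divide_left_mono mult_right_mono) auto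
      finally have "\<bar>bessel_coeff (real N) n\<bar> * (((2 * pi * s * r)\<^sup>2) ^ n * \<bar>W r\<bar>) \<le> 1 / (1 * fact n) * (((2 * pi * s * r)\<^sup>2) ^ n * \<bar>W r\<bar>)"
        by (intro mult_right_mono) auto
      moreover have "norm (f n r) = \<bar>bessel_coeff (real N) n\<bar> * (((2 * pi * s * r)\<^sup>2) ^ n * \<bar>W r\<bar>)"
      proof -
        have "\<bar>((2 * pi * s * r)\<^sup>2) ^ n\<bar> = ((2 * pi * s * r)\<^sup>2) ^ n" by (rule abs_of_nonneg) simp
        then show ?thesis
          unfolding f_eq real_norm_def abs_mult[of _ "W r"] abs_mult[of "bessel_coeff (real N) n"] by (simp only: mult.assoc)
      qed
      ultimately show ?thesis by (simp add: divide_inverse mult_ac)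
    qed
    then show ?thesis
      by (intro summable_comparison_test'[where N = 0, OF summable_mult[OF summable_exp_generic]]) auto
  qed
  have "(\<lambda>r. \<Sum>n. f n r) = A" using fA by (auto simp: sums_iff)
  moreover have sn: "summable (\<lambda>n. LINT r|lborel. norm (f n r))" unfolding valn using exps sums_iff by blast
  ultimately show "integrable lborel A"
    using integrable_suminf[of lborel f, OF int _ sn] summ by simp
  have "(\<lambda>n. LINT r|lborel. f n r) sums (LINT r|lborel. (\<Sum>n. f n r))"
    by (rule sums_integral[OF int _ sn]) (use summ in simp)
  then have "(LINT r|lborel. (\<Sum>n. f n r)) = C * exp (- q)" unfolding val using exps[of "- q"] sums_unique2 by blast
  then show "(LINT r|lborel. A r) = (1 / sqrt l) ^ N * half_moment (N - 1) * exp (- (pi\<^sup>2 * s\<^sup>2 / l))"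
    using fA by (simp add: C_def q_def sums_iff)
qed

section \<open>Integrals determined by moments\<close>

lemma integrable_mult_continuous_compose:
  fixes A :: "'a \<Rightarrow> complex" and \<phi> F :: "_ \<Rightarrow> real"
  assumes F: "continuous_on UNIV F"
    and A: "integrable M A" and [measurable]: "\<phi> \<in> borel_measurable M" and r: "\<And>x. \<phi> x \<in> {0..1}"
  shows "integrable M (\<lambda>x. A x * of_real (F (\<phi> x)))"
proof -
  have [measurable]: "F \<in> borel_measurable borel" by (rule borel_measurable_continuous_onI[OF F])
  have "bounded (F ` {0..1})"
    by (intro compact_imp_bounded compact_continuous_image continuous_on_subset[OF F]) auto
  then obtain C where "\<forall>x\<in>F ` {0..1}. norm x \<le> C" unfolding bounded_iff by blast
  then have C: "\<bar>F q\<bar> \<le> C" if "q \<in> {0..1}" for q using that by auto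
  show ?thesis
  proof (rule Bochner_Integration.integrable_bound)
    show "integrable M (\<lambda>x. C * norm (A x))" using A by simp
    show "AE x in M. norm (A x * of_real (F (\<phi> x))) \<le> norm (C * norm (A x))"
    proof (rule AE_I2)
      fix x
      have "norm (A x) * \<bar>F (\<phi> x)\<bar> \<le> norm (A x) * \<bar>C\<bar>" using C[OF r[of x]] by (intro mult_left_mono) auto
      then show "norm (A x * of_real (F (\<phi> x))) \<le> norm (C * norm (A x))" by (simp add: norm_mult abs_mult mult.commute)
    qed
  qed (use A in \<open>auto intro: borel_measurable_integrable\<close>)
qed

lemma norm_integral_diff_compose_le:
  fixes A :: "'a \<Rightarrow> complex" and \<phi> F p :: "_ \<Rightarrow> real"
  assumes A: "integrable M A" "\<phi> \<in> borel_measurable M" "\<And>x. \<phi> x \<in> {0..1}"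
    and F: "continuous_on UNIV F" and p: "continuous_on UNIV p" "\<And>q. q \<in> {0..1} \<Longrightarrow> \<bar>F q - p q\<bar> < e"
  shows "norm ((LINT x|M. A x * of_real (F (\<phi> x))) - (LINT x|M. A x * of_real (p (\<phi> x)))) \<le> e * (LINT x|M. norm (A x))"
proof -
  note i = integrable_mult_continuous_compose[OF F A] integrable_mult_continuous_compose[OF p(1) A]
  have "(LINT x|M. A x * of_real (F (\<phi> x))) - (LINT x|M. A x * of_real (p (\<phi> x))) = (LINT x|M. A x * of_real (F (\<phi> x) - p (\<phi> x)))"
    unfolding Bochner_Integration.integral_diff[OF i, symmetric] by (simp add: right_diff_distrib)
  also have "norm \<dots> \<le> (LINT x|M. e * norm (A x))"
  proof (rule order_trans[OF integral_norm_bound integral_mono])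
    have "integrable M (\<lambda>x. A x * of_real (F (\<phi> x) - p (\<phi> x)))"
      using Bochner_Integration.integrable_diff[OF i] by (simp add: right_diff_distrib)
    then show "integrable M (\<lambda>x. norm (A x * of_real (F (\<phi> x) - p (\<phi> x))))" by (rule integrable_norm)
    show "norm (A x * of_real (F (\<phi> x) - p (\<phi> x))) \<le> e * norm (A x)" for x
      using mult_left_mono[OF less_imp_le[OF p(2)[OF A(3)[of x]]], of "norm (A x)"]
      unfolding norm_mult norm_of_real by (simp add: mult.commute)
  qed (use A in simp)
  finally show ?thesis by simp
qed

text \<open>The images of A dM under \<phi> and of B dM' under \<psi> are complex measures on [0,1]
  with the same moments, hence they agree on polynomials and, by uniform approximation, on
  continuous functions. The denominator S + 1 in the proof avoids a case distinction at S =
  0.\<close>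

lemma integral_eq_of_moments_eq:
  fixes A :: "'a \<Rightarrow> complex" and B :: "'b \<Rightarrow> complex" and \<phi> :: "'a \<Rightarrow> real" and \<psi> :: "'b \<Rightarrow> real"
  assumes A: "integrable M A" "\<phi> \<in> borel_measurable M" "\<And>x. \<phi> x \<in> {0..1}"
    and B: "integrable M' B" "\<psi> \<in> borel_measurable M'" "\<And>x. \<psi> x \<in> {0..1}"
    and mom: "\<And>n. (LINT x|M. A x * of_real (\<phi> x ^ n)) = (LINT y|M'. B y * of_real (\<psi> y ^ n))"
    and F: "continuous_on UNIV (F :: real \<Rightarrow> real)"
  shows "(LINT x|M. A x * of_real (F (\<phi> x))) = (LINT y|M'. B y * of_real (F (\<psi> y)))"
proof -
  note FA = integrable_mult_continuous_compose
  define S where "S = (LINT x|M. norm (A x)) + (LINT y|M'. norm (B y))"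
  have S0: "S \<ge> 0" unfolding S_def by (intro add_nonneg_nonneg integral_nonneg_AE) auto
  have "norm ((LINT x|M. A x * of_real (F (\<phi> x))) - (LINT y|M'. B y * of_real (F (\<psi> y)))) \<le> e" if e: "e > 0" for e
  proof -
    obtain p where p: "real_polynomial_function p" "\<And>q. q \<in> {0..1} \<Longrightarrow> \<bar>F q - p q\<bar> < e / (S + 1)"
      using Stone_Weierstrass_real_polynomial_function[of "{0..1}" F "e / (S + 1)"] continuous_on_subset[OF F] e S0 by auto
    obtain a n where pa: "p = (\<lambda>x. \<Sum>i\<le>n. a i * x ^ i)" using p(1) real_polynomial_function_iff_sum by metis
    have pc: "continuous_on UNIV p" unfolding pa by (intro continuous_intros)
    have powc: "continuous_on UNIV (\<lambda>x::real. x ^ i)" for i by (intro continuous_intros)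
    have peq: "(LINT x|M. A x * of_real (p (\<phi> x))) = (LINT y|M'. B y * of_real (p (\<psi> y)))"
    proof -
      have "(LINT x|M. A x * of_real (p (\<phi> x))) = (LINT x|M. (\<Sum>i\<le>n. of_real (a i) * (A x * of_real (\<phi> x ^ i))))"
        unfolding pa by (simp add: sum_distrib_left mult_ac)
      also have "\<dots> = (\<Sum>i\<le>n. of_real (a i) * (LINT x|M. A x * of_real (\<phi> x ^ i)))"
        using FA[OF powc A] by (subst Bochner_Integration.integral_sum) auto
      also have "\<dots> = (\<Sum>i\<le>n. of_real (a i) * (LINT y|M'. B y * of_real (\<psi> y ^ i)))" unfolding mom ..
      also have "\<dots> = (LINT y|M'. (\<Sum>i\<le>n. of_real (a i) * (B y * of_real (\<psi> y ^ i))))"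
        using FA[OF powc B] by (subst Bochner_Integration.integral_sum) auto
      also have "\<dots> = (LINT y|M'. B y * of_real (p (\<psi> y)))"
        unfolding pa by (simp add: sum_distrib_left mult_ac)
      finally show ?thesis .
    qed
    note close = norm_integral_diff_compose_le[OF _ _ _ F pc p(2)]
    have "norm ((LINT x|M. A x * of_real (F (\<phi> x))) - (LINT y|M'. B y * of_real (F (\<psi> y))))
      \<le> e / (S + 1) * (LINT x|M. norm (A x)) + e / (S + 1) * (LINT y|M'. norm (B y))"
      using norm_triangle_ineq4[of "(LINT x|M. A x * of_real (F (\<phi> x))) - (LINT x|M. A x * of_real (p (\<phi> x)))"
          "(LINT y|M'. B y * of_real (F (\<psi> y))) - (LINT y|M'. B y * of_real (p (\<psi> y)))"] close[OF A] close[OF B]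
      unfolding peq by simp
    also have "\<dots> = e / (S + 1) * S" by (simp add: S_def distrib_left)
    also have "\<dots> \<le> e" using e S0 by (simp add: field_simps)
    finally show ?thesis .
  qed
  then have "norm ((LINT x|M. A x * of_real (F (\<phi> x))) - (LINT y|M'. B y * of_real (F (\<psi> y)))) \<le> 0"
    by (rule field_le_epsilon[of _ 0, simplified])
  then show ?thesis by simp
qed

text \<open>The discontinuous cutoff is a pointwise limit of continuous functions: G extends c by
  its boundary values, and F i multiplies G by a trapezoid that rises with slope i from the end
  points. The trapezoids vanish at the end points themselves, so the limit is the indicator of the
  open interval.\<close>

lemma integral_eq_of_moments_eq_interval:
  fixes A :: "'a \<Rightarrow> complex" and B :: "'b \<Rightarrow> complex" and \<phi> :: "'a \<Rightarrow> real" and \<psi> :: "'b \<Rightarrow> real"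
  assumes A: "integrable M A" "\<phi> \<in> borel_measurable M" "\<And>x. \<phi> x \<in> {0..1}"
    and B: "integrable M' B" "\<psi> \<in> borel_measurable M'" "\<And>x. \<psi> x \<in> {0..1}"
    and mom: "\<And>n. (LINT x|M. A x * of_real (\<phi> x ^ n)) = (LINT y|M'. B y * of_real (\<psi> y ^ n))"
    and c: "continuous_on {\<alpha>..\<beta>} c" and ab: "\<alpha> < \<beta>"
  shows "(LINT x|M. A x * of_real (if \<alpha> < \<phi> x \<and> \<phi> x < \<beta> then c (\<phi> x) else 0))
       = (LINT y|M'. B y * of_real (if \<alpha> < \<psi> y \<and> \<psi> y < \<beta> then c (\<psi> y) else 0))"
proof -
  define G where "G = (\<lambda>q. c (max \<alpha> (min \<beta> q)))"
  define F where "F = (\<lambda>i q. min 1 (real i * max 0 (min (q - \<alpha>) (\<beta> - q))) * G q)"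
  define L where "L = (\<lambda>q. if \<alpha> < q \<and> q < \<beta> then c q else 0)"
  have G: "continuous_on UNIV G" unfolding G_def
    by (rule continuous_on_compose2[OF c]) (use ab in \<open>auto intro!: continuous_intros\<close>)
  have F: "continuous_on UNIV (F i)" for i unfolding F_def by (intro continuous_intros G)
  obtain C where C: "\<And>q. \<bar>G q\<bar> \<le> C"
  proof -
    have "bounded (c ` {\<alpha>..\<beta>})" by (intro compact_imp_bounded compact_continuous_image c) auto
    then obtain C where "\<forall>x\<in>c ` {\<alpha>..\<beta>}. norm x \<le> C" unfolding bounded_iff by blast
    then have "\<bar>G q\<bar> \<le> C" for q using ab by (auto simp: G_def)
    then show ?thesis using that by blast
  qed
  have FC: "\<bar>F i q\<bar> \<le> C" for i q
  proof -
    have "\<bar>F i q\<bar> \<le> 1 * \<bar>G q\<bar>" unfolding F_def abs_mult by (intro mult_right_mono) auto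
    then show ?thesis using C[of q] by simp
  qed
  have lim: "(\<lambda>i. F i q) \<longlonglongrightarrow> L q" for q
  proof (cases "\<alpha> < q \<and> q < \<beta>")
    case True
    define \<delta> where "\<delta> = min (q - \<alpha>) (\<beta> - q)"
    have \<delta>: "\<delta> > 0" using True by (simp add: \<delta>_def)
    have "\<forall>\<^sub>F i in sequentially. real i \<ge> 1 / \<delta>" by real_asymp
    then have "\<forall>\<^sub>F i in sequentially. F i q = L q"
    proof eventually_elim
      case (elim i)
      then have "real i * max 0 \<delta> \<ge> 1" using \<delta> by (simp add: field_simps)
      then show ?case using True unfolding F_def L_def G_def \<delta>_def[symmetric] by (simp add: min_def max_def)
    qed
    then show ?thesis by (rule tendsto_eventually)
  next
    case False
    then have "max 0 (min (q - \<alpha>) (\<beta> - q)) = 0" by auto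
    then show ?thesis using False by (auto simp: F_def L_def)
  qed
  have Lm: "L \<in> borel_measurable borel"
    by (rule borel_measurable_LIMSEQ_real[OF lim borel_measurable_continuous_onI[OF F]])
  have conv: "(\<lambda>i. LINT x|M. A x * of_real (F i (\<phi> x))) \<longlonglongrightarrow> (LINT x|M. A x * of_real (L (\<phi> x)))"
  proof (rule integral_dominated_convergence[where w = "\<lambda>x. C * norm (A x)"])
    have [measurable]: "A \<in> borel_measurable M" "\<phi> \<in> borel_measurable M" "L \<in> borel_measurable borel"
        "F i \<in> borel_measurable borel" for i
      using A Lm borel_measurable_continuous_onI[OF F] by auto
    show "(\<lambda>x. A x * of_real (L (\<phi> x))) \<in> borel_measurable M" "(\<lambda>x. A x * of_real (F i (\<phi> x))) \<in> borel_measurable M" for i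
      by measurable
    show "integrable M (\<lambda>x. C * norm (A x))" using A by simp
    show "AE x in M. (\<lambda>i. A x * of_real (F i (\<phi> x))) \<longlonglongrightarrow> A x * of_real (L (\<phi> x))"
      by (intro AE_I2 tendsto_intros lim)
    show "AE x in M. norm (A x * of_real (F i (\<phi> x))) \<le> C * norm (A x)" for i
    proof (rule AE_I2)
      fix x
      have "norm (A x) * \<bar>F i (\<phi> x)\<bar> \<le> norm (A x) * C" by (intro mult_left_mono FC) auto
      then show "norm (A x * of_real (F i (\<phi> x))) \<le> C * norm (A x)"
        unfolding norm_mult norm_of_real by (simp only: mult.commute)
    qed
  qed
  have conv': "(\<lambda>i. LINT x|M'. B x * of_real (F i (\<psi> x))) \<longlonglongrightarrow> (LINT x|M'. B x * of_real (L (\<psi> x)))"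
  proof (rule integral_dominated_convergence[where w = "\<lambda>x. C * norm (B x)"])
    have [measurable]: "B \<in> borel_measurable M'" "\<psi> \<in> borel_measurable M'" "L \<in> borel_measurable borel"
        "F i \<in> borel_measurable borel" for i
      using B Lm borel_measurable_continuous_onI[OF F] by auto
    show "(\<lambda>x. B x * of_real (L (\<psi> x))) \<in> borel_measurable M'" "(\<lambda>x. B x * of_real (F i (\<psi> x))) \<in> borel_measurable M'" for i
      by measurable
    show "integrable M' (\<lambda>x. C * norm (B x))" using B by simp
    show "AE x in M'. (\<lambda>i. B x * of_real (F i (\<psi> x))) \<longlonglongrightarrow> B x * of_real (L (\<psi> x))"
      by (intro AE_I2 tendsto_intros lim)
    show "AE x in M'. norm (B x * of_real (F i (\<psi> x))) \<le> C * norm (B x)" for i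
    proof (rule AE_I2)
      fix x
      have "norm (B x) * \<bar>F i (\<psi> x)\<bar> \<le> norm (B x) * C" by (intro mult_left_mono FC) auto
      then show "norm (B x * of_real (F i (\<psi> x))) \<le> C * norm (B x)"
        unfolding norm_mult norm_of_real by (simp only: mult.commute)
    qed
  qed
  have "(LINT x|M. A x * of_real (F i (\<phi> x))) = (LINT x|M'. B x * of_real (F i (\<psi> x)))" for i
    by (rule integral_eq_of_moments_eq[OF A B mom F])
  from LIMSEQ_unique[OF conv[unfolded this] conv'] show ?thesis by (simp only: L_def)
qed

text \<open>The quotient of the constants in the Gaussian formulas for the d-dimensional and the
  radial integral. The powers of l in them are l^(-d/2-k) and l^(-N/2) with N = 2 k + d, so they
  cancel, and one constant matches all moments at once.\<close>

definition riesz_multiplier_const :: "nat \<Rightarrow> nat \<Rightarrow> complex" where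
  "riesz_multiplier_const k d = of_real (sqrt pi ^ d / half_moment (2 * k + d - 1)) * (- (\<i> * pi)) ^ k"

lemma bessel_j_annulus_integral:
  assumes tR: "0 < t" "t < R" and k: "k > 0" and s: "s > 0"
  shows "(LINT r|lborel. indicator {t<..<R} r *\<^sub>R (bessel_j (real (2 * k + d)) (s * r) * r ^ (k - 1)))
     = (bessel_primitive k d (s * R) - bessel_primitive k d (s * t)) / s ^ k"
proof -
  let ?f = "\<lambda>r. bessel_j (real (2 * k + d)) (s * r) * r ^ (k - 1)"
  let ?F = "\<lambda>r. bessel_primitive k d (s * r) / s ^ k"
  have "(LBINT r=t..R. ?f r) = ?F R - ?F t"
  proof (rule interval_integral_FTC_finite)
    show "continuous_on {min t R..max t R} ?f" using k by (intro continuous_intros) auto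
    fix r assume "min t R \<le> r" "r \<le> max t R"
    then have r: "r > 0" using tR by auto
    have sk: "s ^ k = s * s ^ (k - 1)" using k by (cases k) auto
    have "((\<lambda>r. bessel_primitive k d (s * r)) has_real_derivative (bessel_j (real (2 * k + d)) (s * r) * (s * r) ^ (k - 1)) * s) (at r)"
    proof (rule DERIV_chain'[where f = "\<lambda>r. s * r"])
      show "((\<lambda>r. s * r) has_real_derivative s) (at r)" by (auto intro!: derivative_eq_intros)
      show "(bessel_primitive k d has_real_derivative bessel_j (real (2 * k + d)) (s * r) * (s * r) ^ (k - 1)) (at (s * r))"
        using r s k by (intro bessel_primitive_deriv) auto
    qed
    from DERIV_cdivide[OF this, of "s ^ k"]
    have "(?F has_real_derivative ?f r) (at r)"
      by (rule DERIV_cong) (use s in \<open>simp add: sk power_mult_distrib\<close>)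
    then show "(?F has_vector_derivative ?f r) (at r within {min t R..max t R})"
      by (simp add: has_real_derivative_iff_has_vector_derivative has_vector_derivative_at_within)
  qed
  moreover have "(LBINT r=t..R. ?f r) = (LINT r|lborel. indicator {t<..<R} r *\<^sub>R ?f r)"
    using tR by (simp add: interval_lebesgue_integral_def set_lebesgue_integral_def)
  ultimately show ?thesis by (simp add: diff_divide_distrib)
qed

text \<open>Hecke--Bochner on annuli: both sides are integrals of the same function of \<open>exp (- |y|\<^sup>2)\<close>, against
  two measures with equal moments by the Gaussian case.\<close>

lemma annulus_fourier:
  fixes a a' \<xi> :: "'a::euclidean_space"
  assumes k: "k > 0" and harm: "k = 1 \<or> (norm a = norm a' \<and> a \<bullet> a' = 0)" and tR: "0 < t" "t < R" and \<xi>: "\<xi> \<noteq> 0"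
  defines "s \<equiv> 2 * pi * norm \<xi>"
  shows "(LINT y|lborel. indicator {y. t < norm y \<and> norm y < R} y *\<^sub>R
      (complex_linear a a' y ^ k / of_real (norm y ^ (DIM('a) + k)) * cis (- (2 * pi * (y \<bullet> \<xi>)))))
    = riesz_multiplier_const k DIM('a) * (complex_linear a a' \<xi> / of_real s) ^ k
       * of_real (bessel_primitive k DIM('a) (s * R) - bessel_primitive k DIM('a) (s * t))"
proof -
  let ?z = "complex_linear a a'"
  define N where "N = 2 * k + DIM('a)"
  define \<kappa> where "\<kappa> = riesz_multiplier_const k DIM('a) * ?z \<xi> ^ k"
  define A where "A = (\<lambda>y. ?z y ^ k * (of_real (exp (- (1 * (norm y)\<^sup>2))) * cis (- (2 * pi * (y \<bullet> \<xi>)))))"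
  define B0 where "B0 = (\<lambda>r. indicator {0..} r *\<^sub>R (bessel_j (real N) (2 * pi * norm \<xi> * r) * r ^ (N - 1) * exp (- (1 * r\<^sup>2))))"
  define B where "B = (\<lambda>r. \<kappa> * of_real (B0 r))"
  let ?\<phi> = "\<lambda>y::'a. exp (- (norm y)\<^sup>2)" and ?\<psi> = "\<lambda>r::real. exp (- r\<^sup>2)"
  have N: "N \<ge> 2" using k by (simp add: N_def)
  have A: "integrable lborel A" unfolding A_def by (rule gaussian_generating_function(2)) simp
  have B: "integrable lborel B"
    unfolding B_def B0_def by (intro integrable_mult_right integrable_of_real bessel_j_gaussian_integral(1) N) simp
  \<comment> \<open>The n-th power of exp (- |y|^2) turns the Gaussian with parameter 1 into the one
    with parameter n + 1, so each moment is an instance of the two Gaussian formulas.\<close>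
  have mom: "(LINT y|lborel. A y * of_real (?\<phi> y ^ n)) = (LINT r|lborel. B r * of_real (?\<psi> r ^ n))" for n
  proof -
    define l where "l = real n + 1"
    have l: "l > 0" by (simp add: l_def)
    have e: "exp (- (1 * x)) * exp (- x) ^ n = exp (- (l * x))" for x
      by (simp add: exp_of_nat_mult[symmetric] exp_add[symmetric] l_def algebra_simps)
    have "(LINT y|lborel. A y * of_real (?\<phi> y ^ n)) = (LINT y|lborel. ?z y ^ k * (of_real (exp (- (l * (norm y)\<^sup>2))) * cis (- (2 * pi * (y \<bullet> \<xi>)))))"
      unfolding A_def e[symmetric] by (simp add: mult_ac)
    also have "\<dots> = of_real (sqrt (pi / l) ^ DIM('a) * exp (- (pi\<^sup>2 * (norm \<xi>)\<^sup>2 / l))) * (- (\<i> * pi * ?z \<xi> / l)) ^ k"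
      by (rule gaussian_harmonic_fourier[OF l harm])
    also have "\<dots> = \<kappa> * of_real ((1 / sqrt l) ^ N * half_moment (N - 1) * exp (- (pi\<^sup>2 * (norm \<xi>)\<^sup>2 / l)))"
    proof -
      have 1: "(1 / sqrt l) ^ N = (1 / l) ^ k * (1 / sqrt l) ^ DIM('a)"
        using l by (simp add: N_def power_add power_mult power_divide)
      have 2: "sqrt (pi / l) ^ DIM('a) = sqrt pi ^ DIM('a) * (1 / sqrt l) ^ DIM('a)"
        by (simp add: real_sqrt_divide power_divide)
      have 3: "(- (\<i> * pi * ?z \<xi> / l)) ^ k = (- (\<i> * pi)) ^ k * ?z \<xi> ^ k * of_real ((1 / l) ^ k)"
        unfolding of_real_power power_mult_distrib[symmetric] by simp
      have h: "half_moment (N - 1) \<noteq> 0" using half_moment_pos[of "N - 1"] by simp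
      show ?thesis unfolding \<kappa>_def riesz_multiplier_const_def N_def[symmetric] 1 2 3 using h by simp
    qed
    also have "\<dots> = \<kappa> * of_real (LINT r|lborel. indicator {0..} r *\<^sub>R (bessel_j (real N) (2 * pi * norm \<xi> * r) * r ^ (N - 1) * exp (- (l * r\<^sup>2))))"
      by (subst bessel_j_gaussian_integral(2)[OF l N]) simp
    also have "\<dots> = (LINT r|lborel. B r * of_real (?\<psi> r ^ n))"
      unfolding integral_complex_of_real[symmetric] integral_mult_right_zero[symmetric] B_def B0_def e[symmetric]
      by (simp add: mult_ac)
    finally show ?thesis .
  qed
  \<comment> \<open>The Riesz kernel in the variable q = exp (- r^2): the factor 1 / q removes the
    Gaussian weight of A and B, and sqrt (- ln q) is r. The map reverses the order, so t < r < R
    becomes exp (- R^2) < q < exp (- t^2).\<close>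
  define c where "c = (\<lambda>q. 1 / (sqrt (- ln q) ^ (DIM('a) + k) * q))"
  have ab: "exp (- R\<^sup>2) < exp (- t\<^sup>2)" using tR by (simp add: power_strict_mono)
  have cont: "continuous_on {exp (- R\<^sup>2)..exp (- t\<^sup>2)} c"
  proof -
    have "q > 0 \<and> sqrt (- ln q) > 0" if "q \<in> {exp (- R\<^sup>2)..exp (- t\<^sup>2)}" for q
    proof
      have "0 < exp (- R\<^sup>2)" by simp
      also have "\<dots> \<le> q" using that by simp
      finally show q: "q > 0" .
      have "ln q \<le> - t\<^sup>2" using that q by (metis atLeastAtMost_iff ln_exp ln_le_cancel_iff exp_gt_zero)
      also have "\<dots> < 0" using tR by simp
      finally show "sqrt (- ln q) > 0" by simp
    qed
    then show ?thesis unfolding c_def by (intro continuous_intros) force+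
  qed
  have cval: "c (exp (- x\<^sup>2)) = exp (x\<^sup>2) / x ^ (DIM('a) + k)" if "x \<ge> 0" for x :: real
    using that unfolding c_def ln_exp by (simp add: exp_minus field_simps)
  have cond: "exp (- R\<^sup>2) < exp (- x\<^sup>2) \<and> exp (- x\<^sup>2) < exp (- t\<^sup>2) \<longleftrightarrow> t < x \<and> x < R" if "x \<ge> 0" for x
    using that tR by (auto simp: power_strict_mono dest: power2_less_imp_less)
  have "(LINT y|lborel. A y * of_real (if exp (- R\<^sup>2) < ?\<phi> y \<and> ?\<phi> y < exp (- t\<^sup>2) then c (?\<phi> y) else 0))
     = (LINT r|lborel. B r * of_real (if exp (- R\<^sup>2) < ?\<psi> r \<and> ?\<psi> r < exp (- t\<^sup>2) then c (?\<psi> r) else 0))"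
    by (rule integral_eq_of_moments_eq_interval[OF A _ _ B _ _ mom cont ab]) auto
  moreover have "A y * of_real (if exp (- R\<^sup>2) < ?\<phi> y \<and> ?\<phi> y < exp (- t\<^sup>2) then c (?\<phi> y) else 0)
     = indicator {y. t < norm y \<and> norm y < R} y *\<^sub>R (?z y ^ k / of_real (norm y ^ (DIM('a) + k)) * cis (- (2 * pi * (y \<bullet> \<xi>))))" for y
  proof -
    have "complex_of_real (exp (- (norm y)\<^sup>2)) * of_real (exp ((norm y)\<^sup>2)) = 1"
      unfolding of_real_mult[symmetric] exp_add[symmetric] by simp
    then show ?thesis using tR unfolding A_def cond[OF norm_ge_zero] cval[OF norm_ge_zero]
      by (auto simp: indicator_def field_simps)
  qed
  moreover have "B r * of_real (if exp (- R\<^sup>2) < ?\<psi> r \<and> ?\<psi> r < exp (- t\<^sup>2) then c (?\<psi> r) else 0)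
     = \<kappa> * of_real (indicator {t<..<R} r *\<^sub>R (bessel_j (real N) (s * r) * r ^ (k - 1)))" for r
  proof (cases "r \<ge> 0")
    case True
    show ?thesis
    proof (cases "t < r \<and> r < R")
      case in_range: True
      then have r: "r > 0" using tR by simp
      have "N - 1 = (k - 1) + (DIM('a) + k)" using k by (simp add: N_def)
      then have pw: "r ^ (N - 1) * (exp (r\<^sup>2) / r ^ (DIM('a) + k)) * exp (- r\<^sup>2) = r ^ (k - 1)"
        using r by (simp add: power_add exp_minus)
      have "B0 r * (exp (r\<^sup>2) / r ^ (DIM('a) + k)) = bessel_j (real N) (s * r) * (r ^ (N - 1) * (exp (r\<^sup>2) / r ^ (DIM('a) + k)) * exp (- r\<^sup>2))"
        using r by (simp add: B0_def s_def mult_ac)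
      then have "B0 r * (exp (r\<^sup>2) / r ^ (DIM('a) + k)) = bessel_j (real N) (s * r) * r ^ (k - 1)"
        unfolding pw .
      then show ?thesis using in_range unfolding B_def cond[OF True] cval[OF True]
        by (simp del: of_real_mult of_real_divide add: mult.assoc of_real_mult[symmetric])
    next
      case out: False
      show ?thesis unfolding cond[OF True] using out by (auto simp: indicator_def)
    qed
  qed (use tR in \<open>auto simp: B_def B0_def\<close>)
  ultimately have "(LINT y|lborel. indicator {y. t < norm y \<and> norm y < R} y *\<^sub>R
      (?z y ^ k / of_real (norm y ^ (DIM('a) + k)) * cis (- (2 * pi * (y \<bullet> \<xi>)))))
     = (LINT r|lborel. \<kappa> * of_real (indicator {t<..<R} r *\<^sub>R (bessel_j (real N) (s * r) * r ^ (k - 1))))"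
    by (simp only:)
  also have "\<dots> = \<kappa> * of_real ((bessel_primitive k DIM('a) (s * R) - bessel_primitive k DIM('a) (s * t)) / s ^ k)"
    unfolding integral_mult_right_zero integral_complex_of_real N_def
    by (subst bessel_j_annulus_integral) (use tR k \<xi> in \<open>auto simp: s_def\<close>)
  finally show ?thesis by (simp add: \<kappa>_def power_divide)
qed

section \<open>The multiplier of the factorization kernel\<close>

lemma complex_linear_add: "complex_linear a a' (x + y) = complex_linear a a' x + complex_linear a a' y"
  by (simp add: complex_linear_def inner_add_left complex_eq_iff)

lemma complex_linear_scaleR: "complex_linear a a' (c *\<^sub>R x) = of_real c * complex_linear a a' x"
  by (simp add: complex_linear_def complex_eq_iff)

lemma polynomial_function_complex_linear_power:
  "polynomial_function (\<lambda>y. complex_linear a a' y ^ k)"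
proof -
  have lin: "real_polynomial_function (\<lambda>y. Re (complex_linear a a' y))" "real_polynomial_function (\<lambda>y. Im (complex_linear a a' y))"
    by (auto simp: complex_linear_def intro!: real_polynomial_function.intros bounded_linear_inner_left)
  have "real_polynomial_function (\<lambda>y. Re (complex_linear a a' y ^ k)) \<and> real_polynomial_function (\<lambda>y. Im (complex_linear a a' y ^ k))"
  proof (induction k)
    case (Suc k)
    then show ?case using lin
      by (simp, intro conjI real_polynomial_function_diff real_polynomial_function.intros(3,4)) simp_all
  qed (auto intro!: real_polynomial_function.intros)
  then show ?thesis by (simp add: polynomial_function_iff_Basis_inner Basis_complex_def inner_complex_def)
qed

text \<open>The constant factor w allows a second application to the derivative itself.\<close>

lemma complex_linear_power_deriv:
  "((\<lambda>t. complex_linear a a' (x + t *\<^sub>R b) ^ k * w) has_vector_derivative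
     of_nat k * complex_linear a a' x ^ (k - 1) * complex_linear a a' b * w) (at 0)"
proof -
  let ?z = "complex_linear a a'"
  have "((\<lambda>u. (?z x + u * ?z b) ^ k * w) has_field_derivative of_nat k * ?z x ^ (k - 1) * ?z b * w) (at (of_real 0))"
    by (auto intro!: derivative_eq_intros)
  from has_vector_derivative_real_field[OF this] show ?thesis
    by (simp add: complex_linear_add complex_linear_scaleR)
qed

text \<open>The Laplacian is k (k - 1) z^(k-2) times the sum of the squares of z over the basis, and
  that sum is the bilinear square of a + i a'. It vanishes by isotropy; for k = 1 the factor k - 1
  does.\<close>

lemma complex_linear_power_harmonic:
  fixes a a' :: "'a::euclidean_space"
  assumes harm: "k = 1 \<or> (norm a = norm a' \<and> a \<bullet> a' = 0)"
  shows "(\<lambda>y. complex_linear a a' y ^ k) \<in> spherical_harmonics k"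
proof -
  let ?z = "complex_linear a a'"
  have d1: "partial_deriv b (\<lambda>y. ?z y ^ k) = (\<lambda>x. ?z x ^ (k - 1) * (of_nat k * ?z b))" for b
    unfolding partial_deriv_def using vector_derivative_at[OF complex_linear_power_deriv[of a a' _ b k 1]]
    by (auto simp: mult_ac)
  have d2: "partial_deriv b (partial_deriv b (\<lambda>y. ?z y ^ k)) x = of_nat (k - 1) * ?z x ^ (k - 1 - 1) * of_nat k * (?z b)\<^sup>2" for b x
    unfolding d1 unfolding partial_deriv_def
    using vector_derivative_at[OF complex_linear_power_deriv[of a a' x b "k - 1" "of_nat k * ?z b"]]
    by (simp add: power2_eq_square mult_ac)
  have "laplacian (\<lambda>y. ?z y ^ k) x = 0" for x
  proof (cases "k = 1")
    case False
    then have h: "norm a = norm a'" "a \<bullet> a' = 0" using harm by auto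
    have sq: "(norm u)\<^sup>2 = (\<Sum>b\<in>Basis. (u \<bullet> b)\<^sup>2)" for u :: 'a
      unfolding power2_norm_eq_inner by (subst euclidean_inner) (simp add: power2_eq_square)
    have ip: "u \<bullet> v = (\<Sum>b\<in>Basis. (u \<bullet> b) * (v \<bullet> b))" for u v :: 'a by (rule euclidean_inner)
    have "(\<Sum>b\<in>Basis. (?z b)\<^sup>2) = Complex ((norm a)\<^sup>2 - (norm a')\<^sup>2) (2 * (a \<bullet> a'))"
      unfolding sq ip[of a a'] sum_distrib_left sum_subtractf[symmetric] complex_linear_def
      by (rule complex_eqI) (simp_all add: power2_eq_square mult.assoc inner_commute)
    also have "\<dots> = 0" using h by (simp add: complex_eq_iff)
    finally show ?thesis unfolding laplacian_def d2 sum_distrib_left[symmetric] by simp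
  next
    case True
    then show ?thesis unfolding laplacian_def d2 by simp
  qed
  then show ?thesis
    unfolding spherical_harmonics_def
    by (auto simp: polynomial_function_complex_linear_power complex_linear_scaleR power_mult_distrib scaleR_conv_of_real)
qed

lemma riesz_const_pos: "k > 0 \<Longrightarrow> riesz_const k d > 0"
  unfolding riesz_const_def by (intro divide_pos_pos mult_pos_pos Gamma_real_pos) (auto intro: add_pos_nonneg)

text \<open>Fatou's lemma applied to |f i - g|^2 identifies the two limits without passing to a
  subsequence, and without knowing beforehand that h is in L^2.\<close>

lemma L2_limit_eq_pointwise_limit:
  fixes f :: "nat \<Rightarrow> 'a::euclidean_space \<Rightarrow> complex"
  assumes f: "\<forall>\<^sub>F i in sequentially. f i \<in> L2" and g: "g \<in> L2"
    and lim: "(\<lambda>i. L2_norm (\<lambda>x. f i x - g x)) \<longlonglongrightarrow> 0"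
    and pw: "\<And>x. (\<lambda>i. f i x) \<longlonglongrightarrow> h x"
    and fm: "\<And>i. f i \<in> borel_measurable borel"
  shows "AE x in lborel. g x = h x"
proof -
  have [measurable]: "g \<in> borel_measurable borel" using g by (simp add: L2_def)
  note [measurable] = fm
  have hm[measurable]: "h \<in> borel_measurable borel" by (rule borel_measurable_LIMSEQ_metric[OF fm pw])
  have "(\<integral>\<^sup>+x. ennreal ((norm (h x - g x))\<^sup>2) \<partial>lborel) = (\<integral>\<^sup>+x. liminf (\<lambda>i. ennreal ((norm (f i x - g x))\<^sup>2)) \<partial>lborel)"
  proof (rule nn_integral_cong)
    fix x
    have "(\<lambda>i. ennreal ((norm (f i x - g x))\<^sup>2)) \<longlonglongrightarrow> ennreal ((norm (h x - g x))\<^sup>2)"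
      by (intro tendsto_intros pw)
    then show "ennreal ((norm (h x - g x))\<^sup>2) = liminf (\<lambda>i. ennreal ((norm (f i x - g x))\<^sup>2))"
      using lim_imp_Liminf[OF sequentially_bot] by metis
  qed
  also have "\<dots> \<le> liminf (\<lambda>i. \<integral>\<^sup>+x. ennreal ((norm (f i x - g x))\<^sup>2) \<partial>lborel)"
    by (rule nn_integral_liminf) measurable
  also have "\<dots> = 0"
  proof (rule lim_imp_Liminf[OF sequentially_bot])
    have "(\<lambda>i. ennreal ((L2_norm (\<lambda>x. f i x - g x))\<^sup>2)) \<longlonglongrightarrow> ennreal (0\<^sup>2)"
      by (intro tendsto_intros lim)
    moreover have "\<forall>\<^sub>F i in sequentially. ennreal ((L2_norm (\<lambda>x. f i x - g x))\<^sup>2) = (\<integral>\<^sup>+x. ennreal ((norm (f i x - g x))\<^sup>2) \<partial>lborel)"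
      using f
    proof eventually_elim
      case (elim i)
      show ?case unfolding L2_norm_power2
        using L2_diff[OF elim g] by (intro nn_integral_eq_integral[symmetric]) (auto simp: L2_def)
    qed
    ultimately show "(\<lambda>i. \<integral>\<^sup>+x. ennreal ((norm (f i x - g x))\<^sup>2) \<partial>lborel) \<longlonglongrightarrow> 0"
      using Lim_transform_eventually by fastforce
  qed
  finally have "(\<integral>\<^sup>+x. ennreal ((norm (h x - g x))\<^sup>2) \<partial>lborel) = 0" by simp
  then have "AE x in lborel. ennreal ((norm (h x - g x))\<^sup>2) = 0"
    by (subst (asm) nn_integral_0_iff_AE) auto
  then show ?thesis by (auto simp: ennreal_eq_0_iff)
qed

text \<open>The equality holds at every x: after the reflection y -> x - y the exceptional null set
  no longer depends on x.\<close>

lemma convolution_cong_AE: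
  fixes b :: "'a::euclidean_space \<Rightarrow> real"
  assumes [measurable]: "b \<in> borel_measurable borel" "f \<in> borel_measurable borel" "g \<in> borel_measurable borel"
    and ae: "AE x in lborel. f x = g x"
  shows "convolution b f x = convolution b g x"
proof -
  have conv: "convolution b f x = (LINT y|lborel. of_real (b (x - y)) * f y)" for f
    unfolding convolution_def
    using integral_lborel_reflect[of "\<lambda>y. of_real (b (x - y)) * f y" x] by simp
  show ?thesis unfolding conv
    by (rule integral_cong_AE) (use ae in auto)
qed

lemma norm_complex_linear_quotient_le:
  "norm ((complex_linear a a' y / of_real (2 * pi * norm y)) ^ k) \<le> ((norm a + norm a') / (2 * pi)) ^ k"
proof -
  have "norm (complex_linear a a' y / of_real (2 * pi * norm y)) \<le> (norm a + norm a') / (2 * pi)"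
    using norm_complex_linear_le[of a a' y] by (cases "y = 0") (simp_all add: norm_divide norm_mult field_simps)
  then show ?thesis unfolding norm_power by (intro power_mono) auto
qed

lemma isCont_complex_linear: "isCont (complex_linear a a') x"
  using continuous_on_complex_linear[of a a'] by (simp add: continuous_on_eq_continuous_at)

lemma continuous_on_bessel_primitive_norm:
  assumes "k > 0" "t \<ge> 0"
  shows "continuous_on UNIV (\<lambda>\<xi>::'a::euclidean_space. bessel_primitive k d (2 * pi * norm \<xi> * t))"
  by (rule continuous_on_compose2[OF continuous_on_bessel_primitive[OF assms(1)]])
     (use assms in \<open>auto intro!: continuous_intros\<close>)

text \<open>The Fourier multiplier of \<open>R\<^sup>t\<close> for \<open>P y = (y \<bullet> a + \<i> y \<bullet> a')\<^sup>k\<close>, where \<open>c\<close> is the limit of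
  \<open>bessel_primitive\<close> at infinity; \<open>t = 0\<close> gives the multiplier of the Riesz transform itself.
  At \<open>\<xi> = 0\<close> the quotient is \<open>0 / 0 = 0\<close>.\<close>

definition riesz_multiplier :: "nat \<Rightarrow> 'a \<Rightarrow> 'a \<Rightarrow> real \<Rightarrow> real \<Rightarrow> 'a::euclidean_space \<Rightarrow> complex" where
  "riesz_multiplier k a a' c t \<xi> = of_real (riesz_const k DIM('a)) * (riesz_multiplier_const k DIM('a) *
     (complex_linear a a' \<xi> / of_real (2 * pi * norm \<xi>)) ^ k * of_real (c - bessel_primitive k DIM('a) (2 * pi * norm \<xi> * t)))"

lemma borel_measurable_riesz_multiplier [measurable]:
  fixes a a' :: "'a::euclidean_space"
  assumes "k > 0" "t \<ge> 0" shows "riesz_multiplier k a a' c t \<in> borel_measurable borel"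
proof -
  have [measurable]: "(\<lambda>\<xi>::'a. bessel_primitive k DIM('a) (2 * pi * norm \<xi> * t)) \<in> borel_measurable borel"
    by (intro borel_measurable_continuous_onI continuous_on_bessel_primitive_norm assms)
  show ?thesis unfolding riesz_multiplier_def[abs_def] by measurable
qed

lemma isCont_riesz_multiplier:
  fixes a a' :: "'a::euclidean_space"
  assumes "k > 0" "t \<ge> 0" "\<xi> \<noteq> 0" shows "isCont (riesz_multiplier k a a' c t) \<xi>"
proof -
  have "isCont (\<lambda>\<xi>::'a. bessel_primitive k DIM('a) (2 * pi * norm \<xi> * t)) \<xi>"
    using continuous_on_bessel_primitive_norm[OF assms(1,2), of "DIM('a)", where 'a = 'a] by (simp add: continuous_on_eq_continuous_at)
  then show ?thesis unfolding riesz_multiplier_def[abs_def]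
    using assms by (intro continuous_intros isCont_complex_linear) auto
qed

text \<open>The kernel decays only like |y|^(-d) and is in general not integrable on |y| > t, so
  Fubini is applied on t < |y| < R and R tends to infinity on both sides. On the frequency side the
  bound |c - n| <= c provides the domination, uniformly in R.\<close>

lemma truncated_riesz_gaussian:
  fixes a a' x :: "'a::euclidean_space"
  assumes k: "k > 0" and harm: "k = 1 \<or> (norm a = norm a' \<and> a \<bullet> a' = 0)" and t: "t > 0"
    and c: "(bessel_primitive k DIM('a) \<longlongrightarrow> c) at_top" "\<And>s. s > 0 \<Longrightarrow> \<bar>c - bessel_primitive k DIM('a) s\<bar> \<le> c"
  shows "truncated_riesz k (\<lambda>y. complex_linear a a' y ^ k) t (\<lambda>x. of_real (exp (- (pi * (norm x)\<^sup>2)))) x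
    = (LINT \<xi>|lborel. (riesz_multiplier k a a' c t \<xi> * of_real (exp (- (pi * (norm \<xi>)\<^sup>2)))) * cis (2 * pi * (x \<bullet> \<xi>)))"
proof -
  let ?z = "complex_linear a a'" and ?n = "bessel_primitive k DIM('a)"
  let ?g = "\<lambda>x::'a. complex_of_real (exp (- (pi * (norm x)\<^sup>2)))"
  let ?M = "norm a + norm a'"
  define K where "K = (\<lambda>y. ?z y ^ k / of_real (norm y ^ (DIM('a) + k)))"
  define m where "m = (\<lambda>R \<xi>. riesz_multiplier_const k DIM('a) * (?z \<xi> / of_real (2 * pi * norm \<xi>)) ^ k
      * of_real (?n (2 * pi * norm \<xi> * R) - ?n (2 * pi * norm \<xi> * t)))"
  have [measurable]: "K \<in> borel_measurable borel" unfolding K_def by measurable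
  have g: "integrable lborel ?g" using gaussian_fourier(1)[of 1, where 'a = 'a] by simp
  have gF: "?g x = (LINT \<xi>|lborel. ?g \<xi> * cis (2 * pi * (x \<bullet> \<xi>)))" for x
    using gaussian_fourier(2)[of 1 x] by simp
  have Kle: "norm (K y) \<le> ?M ^ k / t ^ DIM('a)" if "norm y > t" for y
  proof -
    have y: "norm y > 0" using that t by linarith
    have "norm (K y) \<le> (?M * norm y) ^ k / norm y ^ (DIM('a) + k)"
      unfolding K_def norm_divide norm_power
      by (simp add: norm_power divide_right_mono power_mono norm_complex_linear_le)
    also have "\<dots> = ?M ^ k / norm y ^ DIM('a)" using y by (simp add: power_mult_distrib power_add)
    also have "\<dots> \<le> ?M ^ k / t ^ DIM('a)" using that t y by (intro divide_left_mono power_mono mult_pos_pos zero_less_power) auto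
    finally show ?thesis .
  qed
  have KR: "integrable lborel (\<lambda>y. indicator {y. t < norm y \<and> norm y < R} y *\<^sub>R K y)" for R
  proof (rule Bochner_Integration.integrable_bound)
    show "integrable lborel (\<lambda>y::'a. indicator (cball 0 R) y *\<^sub>R (?M ^ k / t ^ DIM('a)))"
      using emeasure_lborel_cball_finite[of "0::'a" R] by (intro integrable_indicator) auto
    show "AE y in lborel. norm (indicator {y. t < norm y \<and> norm y < R} y *\<^sub>R K y) \<le> norm (indicator (cball 0 R) y *\<^sub>R (?M ^ k / t ^ DIM('a)))"
    proof (rule AE_I2)
      fix y
      show "norm (indicator {y. t < norm y \<and> norm y < R} y *\<^sub>R K y) \<le> norm (indicator (cball 0 R) y *\<^sub>R (?M ^ k / t ^ DIM('a)))"
        using Kle[of y] t by (auto simp: indicator_def)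
    qed
  qed measurable
  have step1: "(LINT y|lborel. (indicator {y. t < norm y \<and> norm y < R} y *\<^sub>R K y) * ?g (x - y))
     = (LINT \<xi>|lborel. ?g \<xi> * (cis (2 * pi * (x \<bullet> \<xi>)) * m R \<xi>))" if R: "R > t" for R
  proof -
    let ?K = "\<lambda>y. indicator {y. t < norm y \<and> norm y < R} y *\<^sub>R K y"
    have "(LINT y|lborel. ?K y * ?g (x - y)) = (LINT y|lborel. ?K y * (LINT \<xi>|lborel. ?g \<xi> * cis (2 * pi * ((x - y) \<bullet> \<xi>))))"
      by (subst gF) (rule refl)
    also have "\<dots> = (LINT \<xi>|lborel. ?g \<xi> * (LINT y|lborel. ?K y * cis (2 * pi * ((x - y) \<bullet> \<xi>))))"
      using Fubini_bounded_kernel(1)[OF KR g, of "\<lambda>(y, \<xi>). cis (2 * pi * ((x - y) \<bullet> \<xi>))" 1 R]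
      by (simp add: split_beta borel_prod[symmetric])
    also have "\<dots> = (LINT \<xi>|lborel. ?g \<xi> * (cis (2 * pi * (x \<bullet> \<xi>)) * m R \<xi>))"
    proof (rule integral_cong_AE)
      have [measurable]: "?K \<in> borel_measurable borel" by measurable
      show "(\<lambda>\<xi>. ?g \<xi> * (LINT y|lborel. ?K y * cis (2 * pi * ((x - y) \<bullet> \<xi>)))) \<in> borel_measurable lborel" by measurable
      have [measurable]: "(\<lambda>\<xi>::'a. ?n (2 * pi * norm \<xi> * R)) \<in> borel_measurable borel" "(\<lambda>\<xi>::'a. ?n (2 * pi * norm \<xi> * t)) \<in> borel_measurable borel"
        using R t by (auto intro!: borel_measurable_continuous_onI continuous_on_bessel_primitive_norm k)
      have [measurable]: "m R \<in> borel_measurable borel" unfolding m_def by measurable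
      show "(\<lambda>\<xi>. ?g \<xi> * (cis (2 * pi * (x \<bullet> \<xi>)) * m R \<xi>)) \<in> borel_measurable lborel" by measurable
      show "AE \<xi> in lborel. ?g \<xi> * (LINT y|lborel. ?K y * cis (2 * pi * ((x - y) \<bullet> \<xi>))) = ?g \<xi> * (cis (2 * pi * (x \<bullet> \<xi>)) * m R \<xi>)"
        using AE_lborel_singleton[of "0::'a"]
      proof eventually_elim
        case (elim \<xi>)
        have "cis (2 * pi * ((x - y) \<bullet> \<xi>)) = cis (2 * pi * (x \<bullet> \<xi>)) * cis (- (2 * pi * (y \<bullet> \<xi>)))" for y
          unfolding cis_mult by (simp add: inner_diff_left algebra_simps)
        then have "(LINT y|lborel. ?K y * cis (2 * pi * ((x - y) \<bullet> \<xi>)))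
           = (LINT y|lborel. cis (2 * pi * (x \<bullet> \<xi>)) * (indicator {y. t < norm y \<and> norm y < R} y *\<^sub>R (K y * cis (- (2 * pi * (y \<bullet> \<xi>))))))"
          by (simp add: mult_ac scaleR_conv_of_real)
        also have "\<dots> = cis (2 * pi * (x \<bullet> \<xi>)) * m R \<xi>"
          unfolding integral_mult_right_zero K_def m_def
          using annulus_fourier[OF k harm t R elim] by simp
        finally show ?case by simp
      qed
    qed
    finally show ?thesis .
  qed
  define R where "R = (\<lambda>j::nat. t + 1 + real j)"
  have R: "R j > t" for j by (simp add: R_def)
  have left: "(\<lambda>j. LINT y|lborel. (indicator {y. t < norm y \<and> norm y < R j} y *\<^sub>R K y) * ?g (x - y))
     \<longlonglongrightarrow> (LINT y|lborel. (indicator {y. t < norm y} y *\<^sub>R K y) * ?g (x - y))"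
  proof (rule integral_dominated_convergence[where w = "\<lambda>y. ?M ^ k / t ^ DIM('a) * norm (?g (x - y))"])
    show "integrable lborel (\<lambda>y. ?M ^ k / t ^ DIM('a) * norm (?g (x - y)))"
      using integrable_lborel_reflect[of ?g x] g by (intro integrable_mult_right integrable_norm) simp
    show "AE y in lborel. (\<lambda>j. (indicator {y. t < norm y \<and> norm y < R j} y *\<^sub>R K y) * ?g (x - y)) \<longlonglongrightarrow> (indicator {y. t < norm y} y *\<^sub>R K y) * ?g (x - y)"
    proof (rule AE_I2, rule tendsto_eventually)
      fix y :: 'a
      have "\<forall>\<^sub>F j in sequentially. real j \<ge> norm y" by real_asymp
      then show "\<forall>\<^sub>F j in sequentially. (indicator {y. t < norm y \<and> norm y < R j} y *\<^sub>R K y) * ?g (x - y) = (indicator {y. t < norm y} y *\<^sub>R K y) * ?g (x - y)"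
        by eventually_elim (use t in \<open>auto simp: R_def indicator_def\<close>)
    qed
    show "AE y in lborel. norm ((indicator {y. t < norm y \<and> norm y < R j} y *\<^sub>R K y) * ?g (x - y)) \<le> ?M ^ k / t ^ DIM('a) * norm (?g (x - y))" for j
    proof (rule AE_I2)
      fix y
      have "norm (indicator {y. t < norm y \<and> norm y < R j} y *\<^sub>R K y) \<le> ?M ^ k / t ^ DIM('a)"
        using Kle[of y] t by (auto simp: indicator_def)
      then show "norm ((indicator {y. t < norm y \<and> norm y < R j} y *\<^sub>R K y) * ?g (x - y)) \<le> ?M ^ k / t ^ DIM('a) * norm (?g (x - y))"
        unfolding norm_mult[of _ "?g (x - y)"] by (intro mult_right_mono) auto
    qed
  qed measurable
  define m' where "m' = (\<lambda>\<xi>. riesz_multiplier_const k DIM('a) * (?z \<xi> / of_real (2 * pi * norm \<xi>)) ^ k * of_real (c - ?n (2 * pi * norm \<xi> * t)))"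
  define C where "C = norm (riesz_multiplier_const k DIM('a)) * (?M / (2 * pi)) ^ k * (2 * c)"
  have right: "(\<lambda>j. LINT \<xi>|lborel. ?g \<xi> * (cis (2 * pi * (x \<bullet> \<xi>)) * m (R j) \<xi>)) \<longlonglongrightarrow> (LINT \<xi>|lborel. ?g \<xi> * (cis (2 * pi * (x \<bullet> \<xi>)) * m' \<xi>))"
  proof (rule integral_dominated_convergence[where w = "\<lambda>\<xi>. norm (?g \<xi>) * C"])
    have [measurable]: "(\<lambda>\<xi>::'a. ?n (2 * pi * norm \<xi> * R j)) \<in> borel_measurable borel" "(\<lambda>\<xi>::'a. ?n (2 * pi * norm \<xi> * t)) \<in> borel_measurable borel" for j
      using R[of j] t by (auto intro!: borel_measurable_continuous_onI continuous_on_bessel_primitive_norm k)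
    have [measurable]: "m (R j) \<in> borel_measurable borel" for j unfolding m_def by measurable
    have [measurable]: "m' \<in> borel_measurable borel" unfolding m'_def by measurable
    show "(\<lambda>\<xi>. ?g \<xi> * (cis (2 * pi * (x \<bullet> \<xi>)) * m' \<xi>)) \<in> borel_measurable lborel"
      "(\<lambda>\<xi>. ?g \<xi> * (cis (2 * pi * (x \<bullet> \<xi>)) * m (R j) \<xi>)) \<in> borel_measurable lborel" for j by measurable
    show "integrable lborel (\<lambda>\<xi>. norm (?g \<xi>) * C)" by (intro integrable_mult_left integrable_norm g)
    show "AE \<xi> in lborel. (\<lambda>j. ?g \<xi> * (cis (2 * pi * (x \<bullet> \<xi>)) * m (R j) \<xi>)) \<longlonglongrightarrow> ?g \<xi> * (cis (2 * pi * (x \<bullet> \<xi>)) * m' \<xi>)"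
      using AE_lborel_singleton[of "0::'a"]
    proof eventually_elim
      case (elim \<xi>)
      have s: "2 * pi * norm \<xi> > 0" using elim by simp
      have "filterlim (\<lambda>j. 2 * pi * norm \<xi> * R j) at_top sequentially"
        unfolding R_def by (rule filterlim_tendsto_pos_mult_at_top[OF tendsto_const s]) real_asymp
      from filterlim_compose[OF c(1) this] show ?case
        unfolding m_def m'_def by (intro tendsto_intros)
    qed
    show "AE \<xi> in lborel. norm (?g \<xi> * (cis (2 * pi * (x \<bullet> \<xi>)) * m (R j) \<xi>)) \<le> norm (?g \<xi>) * C" for j
      using AE_lborel_singleton[of "0::'a"]
    proof eventually_elim
      case (elim \<xi>)
      have "\<bar>?n (2 * pi * norm \<xi> * R j) - ?n (2 * pi * norm \<xi> * t)\<bar> \<le> 2 * c"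
        using c(2)[of "2 * pi * norm \<xi> * R j"] c(2)[of "2 * pi * norm \<xi> * t"] elim t R[of j] by fastforce
      then have "norm (m (R j) \<xi>) \<le> C"
        unfolding m_def C_def norm_mult norm_of_real
        by (intro mult_mono norm_complex_linear_quotient_le) auto
      then show ?case unfolding norm_mult by (simp add: mult_left_mono)
    qed
  qed
  have "(LINT y|lborel. (indicator {y. t < norm y} y *\<^sub>R K y) * ?g (x - y)) = (LINT \<xi>|lborel. ?g \<xi> * (cis (2 * pi * (x \<bullet> \<xi>)) * m' \<xi>))"
    using left right unfolding step1[OF R] by (rule LIMSEQ_unique)
  then have "truncated_riesz k (\<lambda>y. ?z y ^ k) t ?g x = of_real (riesz_const k DIM('a)) * (LINT \<xi>|lborel. ?g \<xi> * (cis (2 * pi * (x \<bullet> \<xi>)) * m' \<xi>))"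
    unfolding truncated_riesz_def set_lebesgue_integral_def K_def by (simp add: scaleR_scaleR)
  also have "\<dots> = (LINT \<xi>|lborel. (riesz_multiplier k a a' c t \<xi> * ?g \<xi>) * cis (2 * pi * (x \<bullet> \<xi>)))"
    unfolding integral_mult_right_zero[symmetric] riesz_multiplier_def m'_def by (simp add: mult_ac)
  finally show ?thesis .
qed

text \<open>For k >= 2 an isotropic vector needs a real direction orthogonal to \<xi>, hence d >= 2;
  for k = 1 every linear form is harmonic and \<xi> itself serves. In both cases the form takes the
  nonzero value |\<xi>|^2 at \<xi>.\<close>

lemma isotropic_direction:
  fixes \<xi> :: "'a::euclidean_space"
  assumes \<xi>: "\<xi> \<noteq> 0" and d: "DIM('a) \<ge> 2 \<or> (DIM('a) = 1 \<and> k = 1)"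
  obtains a a' :: 'a where "k = 1 \<or> (norm a = norm a' \<and> a \<bullet> a' = 0)" "complex_linear a a' \<xi> \<noteq> 0"
proof (cases "k = 1")
  case True
  have "complex_linear \<xi> 0 \<xi> \<noteq> 0" using \<xi> by (simp add: complex_linear_def complex_eq_iff)
  then show ?thesis using that[of \<xi> 0] True by blast
next
  case False
  then have "2 \<le> DIM('a)" using d by simp
  then obtain y where y: "y \<noteq> 0" "orthogonal \<xi> y" by (rule orthogonal_to_vector_exists)
  define a' where "a' = (norm \<xi> / norm y) *\<^sub>R y"
  have "norm \<xi> = norm a'" "\<xi> \<bullet> a' = 0" using y by (auto simp: a'_def orthogonal_def)
  moreover have "complex_linear \<xi> a' \<xi> \<noteq> 0" using \<xi> by (simp add: complex_linear_def complex_eq_iff)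
  ultimately show ?thesis using that[of \<xi> a'] by blast
qed

text \<open>Both sides of the factorization for the Gaussian are inverse Fourier integrals of
  bounded integrable functions that are continuous at \<xi>0, so an identity for almost all x yields
  an identity at this one frequency. The frequency 0 is excluded because the direction \<xi> /
  |\<xi>| in the multiplier has no meaning there.\<close>

lemma fourier_riesz_factorization_kernel_le_1:
  fixes b :: "'a::euclidean_space \<Rightarrow> real"
  assumes k: "k > 0" and d: "DIM('a) \<ge> 2 \<or> (DIM('a) = 1 \<and> k = 1)" and b: "riesz_factorization_kernel k b" and \<xi>0: "\<xi>0 \<noteq> 0"
  shows "norm (fourier (\<lambda>x. of_real (b x)) \<xi>0) \<le> 1"
proof -
  let ?n = "bessel_primitive k DIM('a)"
  let ?g = "\<lambda>x::'a. complex_of_real (exp (- (pi * (norm x)\<^sup>2)))"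
  let ?b = "\<lambda>x. complex_of_real (b x)"
  obtain a a' :: 'a where harm: "k = 1 \<or> (norm a = norm a' \<and> a \<bullet> a' = 0)" and za: "complex_linear a a' \<xi>0 \<noteq> 0"
    using isotropic_direction[OF \<xi>0 d] by blast
  obtain c where c0: "c > 0" and c: "(?n \<longlongrightarrow> c) at_top" "\<And>s. s > 0 \<Longrightarrow> \<bar>c - ?n s\<bar> \<le> c"
    using bessel_primitive_bound[OF k d] by blast
  define P where "P = (\<lambda>y. complex_linear a a' y ^ k)"
  have P: "P \<in> spherical_harmonics k" unfolding P_def by (rule complex_linear_power_harmonic[OF harm])
  have bi: "integrable lborel b" using b by (simp add: riesz_factorization_kernel_def)
  then have bi': "integrable lborel ?b" by simp
  have [measurable]: "b \<in> borel_measurable borel" using bi borel_measurable_integrable by fastforce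
  have g: "integrable lborel ?g" using gaussian_fourier(1)[of 1, where 'a = 'a] by simp
  have gL2: "?g \<in> L2"
  proof -
    have "(norm (?g x))\<^sup>2 = exp (- (2 * pi * (norm x)\<^sup>2))" for x by (simp add: exp_double[symmetric] mult.assoc)
    then show ?thesis using integrable_gaussian[of "2 * pi", where 'a = 'a] by (simp add: L2_def)
  qed
  \<comment> \<open>The Gaussian is its own Fourier transform, so h t is the transform of its
    truncated Riesz transform for t > 0; h 0 is the candidate for the Riesz transform, since n
    vanishes at 0.\<close>
  define h where "h = (\<lambda>t \<xi>. riesz_multiplier k a a' c t \<xi> * ?g \<xi>)"
  define C where "C = riesz_const k DIM('a) * (norm (riesz_multiplier_const k DIM('a)) * ((norm a + norm a') / (2 * pi)) ^ k * c)"
  have mC: "norm (riesz_multiplier k a a' c t \<xi>) \<le> C" if "t \<ge> 0" for t \<xi>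
  proof -
    have n: "\<bar>c - ?n (2 * pi * norm \<xi> * t)\<bar> \<le> c"
    proof (cases "2 * pi * norm \<xi> * t > 0")
      case False
      then have z: "2 * pi * norm \<xi> * t = 0" using that by (simp add: zero_less_mult_iff not_less order_antisym)
      show ?thesis unfolding z using c0 by simp
    qed (rule c(2))
    show ?thesis
      unfolding riesz_multiplier_def C_def norm_mult norm_of_real
      using riesz_const_pos[OF k, of "DIM('a)"] n by (intro mult_mono norm_complex_linear_quotient_le) auto
  qed
  have h: "integrable lborel (h t)" if "t \<ge> 0" for t
  proof -
    have "integrable lborel (\<lambda>\<xi>. ?g \<xi> * riesz_multiplier k a a' c t \<xi>)"
      by (rule integrable_mult_bounded[OF g borel_measurable_riesz_multiplier[OF k that] mC[OF that]])
    then show ?thesis by (simp add: h_def mult.commute)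
  qed
  have hC: "norm (h t \<xi>) \<le> C" if "t \<ge> 0" for t \<xi>
  proof -
    have "norm (h t \<xi>) \<le> C * 1"
      unfolding h_def norm_mult using mC[OF that, of 0] norm_ge_zero order_trans
      by (intro mult_mono mC that) (auto intro: order_trans[OF norm_ge_zero])
    then show ?thesis by simp
  qed
  have hcont: "isCont (h t) \<xi>0" if "t \<ge> 0" for t
    unfolding h_def by (intro continuous_intros isCont_riesz_multiplier k that \<xi>0)
  define F where "F = (\<lambda>t x. LINT \<xi>|lborel. h t \<xi> * cis (2 * pi * (x \<bullet> \<xi>)))"
  have hm[measurable]: "h t \<in> borel_measurable borel" if "t \<ge> 0" for t
    using h[OF that] borel_measurable_integrable by fastforce
  have Fm[measurable]: "F t \<in> borel_measurable borel" if "t \<ge> 0" for t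
    unfolding F_def using that by measurable
  have RF: "truncated_riesz k P t ?g = F t" if "t > 0" for t
    unfolding P_def F_def h_def by (rule ext) (rule truncated_riesz_gaussian[OF k harm that c])
  define t where "t = (\<lambda>i. 1 / real (Suc i))"
  have t: "t i > 0" for i by (simp add: t_def)
  have t0: "filterlim t (at_right 0) sequentially" unfolding t_def by real_asymp
  have pw: "(\<lambda>i. F (t i) x) \<longlonglongrightarrow> F 0 x" for x
    unfolding F_def
  proof (rule integral_dominated_convergence[where w = "\<lambda>\<xi>. C * norm (?g \<xi>)"])
    show "integrable lborel (\<lambda>\<xi>. C * norm (?g \<xi>))" by (intro integrable_mult_right integrable_norm g)
    show "AE \<xi> in lborel. (\<lambda>i. h (t i) \<xi> * cis (2 * pi * (x \<bullet> \<xi>))) \<longlonglongrightarrow> h 0 \<xi> * cis (2 * pi * (x \<bullet> \<xi>))"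
    proof (rule AE_I2)
      fix \<xi> :: 'a
      have "(?n \<longlongrightarrow> ?n 0) (at 0 within {0..})"
        using continuous_on_bessel_primitive[OF k, of "DIM('a)"] unfolding continuous_on_def by (elim ballE[of _ _ 0]) auto
      then have n0: "continuous (at 0 within {0..}) ?n" by (simp add: continuous_within)
      have tl: "t \<longlonglongrightarrow> 0" unfolding t_def by real_asymp
      have "(\<lambda>i. 2 * pi * norm \<xi> * t i) \<longlonglongrightarrow> 2 * pi * norm \<xi> * 0" by (intro tendsto_intros tl)
      then have "(\<lambda>i. ?n (2 * pi * norm \<xi> * t i)) \<longlonglongrightarrow> ?n 0"
        using continuous_within_tendsto_compose'[OF n0, of "\<lambda>i. 2 * pi * norm \<xi> * t i" sequentially] t
        by (simp add: less_imp_le)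
      then show "(\<lambda>i. h (t i) \<xi> * cis (2 * pi * (x \<bullet> \<xi>))) \<longlonglongrightarrow> h 0 \<xi> * cis (2 * pi * (x \<bullet> \<xi>))"
        unfolding h_def riesz_multiplier_def mult_zero_right by (intro tendsto_intros)
    qed
    show "AE \<xi> in lborel. norm (h (t i) \<xi> * cis (2 * pi * (x \<bullet> \<xi>))) \<le> C * norm (?g \<xi>)" for i
    proof (rule AE_I2)
      fix \<xi>
      show "norm (h (t i) \<xi> * cis (2 * pi * (x \<bullet> \<xi>))) \<le> C * norm (?g \<xi>)"
        unfolding h_def norm_mult norm_cis mult_1_right using mC[of "t i" \<xi>] t[of i] by (intro mult_right_mono) auto
    qed
    have [measurable]: "h 0 \<in> borel_measurable borel" "h (t i) \<in> borel_measurable borel" for i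
      using hm[of 0] hm[of "t i"] t[of i] by simp_all
    show "(\<lambda>\<xi>. h 0 \<xi> * cis (2 * pi * (x \<bullet> \<xi>))) \<in> borel_measurable lborel"
      "(\<lambda>\<xi>. h (t i) \<xi> * cis (2 * pi * (x \<bullet> \<xi>))) \<in> borel_measurable lborel" for i
      by measurable
  qed
  define G where "G = riesz_transform k P ?g"
  have lim: "L2_limit (\<lambda>t. truncated_riesz k P t ?g) G (at_right 0)"
    unfolding G_def by (rule riesz_transform_L2_limit[OF b P gL2])
  have GL2: "G \<in> L2" using lim by (simp add: L2_limit_def)
  then have [measurable]: "G \<in> borel_measurable borel" by (simp add: L2_def)
  \<comment> \<open>G is merely some L^2 limit of the truncations, fixed by choice. They also
    converge pointwise to F 0, which identifies G almost everywhere by an explicit formula.\<close>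
  have ae: "AE x in lborel. G x = F 0 x"
  proof (rule L2_limit_eq_pointwise_limit[where f = "\<lambda>i. F (t i)"])
    have e: "\<forall>\<^sub>F s in at_right 0. truncated_riesz k P s ?g \<in> L2" and l: "((\<lambda>s. L2_norm (\<lambda>x. truncated_riesz k P s ?g x - G x)) \<longlongrightarrow> 0) (at_right 0)"
      using lim by (auto simp: L2_limit_def)
    have "\<forall>\<^sub>F i in sequentially. truncated_riesz k P (t i) ?g \<in> L2" using e t0 unfolding filterlim_iff by blast
    then show "\<forall>\<^sub>F i in sequentially. F (t i) \<in> L2" unfolding RF[OF t] .
    show "(\<lambda>i. L2_norm (\<lambda>x. F (t i) x - G x)) \<longlonglongrightarrow> 0"
      using filterlim_compose[OF l t0] unfolding RF[OF t] .
    show "F (t i) \<in> borel_measurable borel" for i using Fm[of "t i"] t[of i] by simp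
  qed (use GL2 pw in auto)
  have conv: "convolution b (F 0) x = (LINT \<xi>|lborel. (h 0 \<xi> * fourier ?b \<xi>) * cis (2 * pi * (x \<bullet> \<xi>)))" for x
  proof -
    have "convolution b (F 0) x = (LINT y|lborel. ?b y * (LINT \<xi>|lborel. h 0 \<xi> * cis (2 * pi * ((x - y) \<bullet> \<xi>))))"
      unfolding convolution_def F_def ..
    also have "\<dots> = (LINT \<xi>|lborel. h 0 \<xi> * (LINT y|lborel. ?b y * cis (2 * pi * ((x - y) \<bullet> \<xi>))))"
      using Fubini_bounded_kernel(1)[OF bi' h[of 0], of "\<lambda>(y, \<xi>). cis (2 * pi * ((x - y) \<bullet> \<xi>))" 1]
      by (simp add: split_beta borel_prod[symmetric])
    also have "\<dots> = (LINT \<xi>|lborel. (h 0 \<xi> * fourier ?b \<xi>) * cis (2 * pi * (x \<bullet> \<xi>)))"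
    proof (rule Bochner_Integration.integral_cong[OF refl])
      fix \<xi> :: 'a
      have "cis (2 * pi * ((x - y) \<bullet> \<xi>)) = cis (- (2 * pi * (y \<bullet> \<xi>))) * cis (2 * pi * (x \<bullet> \<xi>))" for y
        unfolding cis_mult by (simp add: inner_diff_left algebra_simps)
      then have "(LINT y|lborel. ?b y * cis (2 * pi * ((x - y) \<bullet> \<xi>))) = (LINT y|lborel. (?b y * cis (- (2 * pi * (y \<bullet> \<xi>)))) * cis (2 * pi * (x \<bullet> \<xi>)))"
        by (simp only: mult.assoc)
      also have "\<dots> = fourier ?b \<xi> * cis (2 * pi * (x \<bullet> \<xi>))" unfolding fourier_eq_cis by (rule integral_mult_left_zero)
      finally show "h 0 \<xi> * (LINT y|lborel. ?b y * cis (2 * pi * ((x - y) \<bullet> \<xi>))) = (h 0 \<xi> * fourier ?b \<xi>) * cis (2 * pi * (x \<bullet> \<xi>))"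
        by (simp only: mult.assoc)
    qed
    finally show ?thesis .
  qed
  define B where "B = (LINT x|lborel. norm (?b x))"
  have fB: "norm (fourier ?b \<xi>) \<le> B" for \<xi> unfolding B_def by (rule norm_fourier_le)
  have fm: "fourier ?b \<in> borel_measurable borel" by measurable
  have hb: "integrable lborel (\<lambda>\<xi>. h 0 \<xi> * fourier ?b \<xi>)"
    by (rule integrable_mult_bounded[OF h fm fB]) simp
  \<comment> \<open>Convolution with b multiplies the transform h 0 by that of b, so the
    factorization says that the inverse transform of H vanishes almost everywhere.\<close>
  define H where "H = (\<lambda>\<xi>. h 0 \<xi> * fourier ?b \<xi> - h 1 \<xi>)"
  have "H \<xi>0 = 0"
  proof (rule eq_0_of_inverse_fourier_eq_0[where H = H and B = "C * B + C"])
    show "integrable lborel H" unfolding H_def by (intro Bochner_Integration.integrable_diff hb h) simp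
    show "norm (H \<xi>) \<le> C * B + C" for \<xi>
    proof -
      have "norm (H \<xi>) \<le> norm (h 0 \<xi>) * norm (fourier ?b \<xi>) + norm (h 1 \<xi>)"
        unfolding H_def norm_mult[symmetric] by (rule norm_triangle_ineq4)
      also have "\<dots> \<le> C * B + C"
        using hC[of 0 \<xi>] order_trans[OF norm_ge_zero hC[of 0 \<xi>]] by (intro add_mono mult_mono fB hC) auto
      finally show ?thesis .
    qed
    show "isCont H \<xi>0" unfolding H_def by (intro continuous_intros hcont isCont_fourier bi') auto
    have "AE x in lborel. truncated_riesz k P 1 ?g x = convolution b G x"
      using b P gL2 unfolding riesz_factorization_kernel_def G_def by blast
    then show "AE x in lborel. (LINT \<xi>|lborel. H \<xi> * cis (2 * pi * (x \<bullet> \<xi>))) = 0"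
    proof eventually_elim
      case (elim x)
      have i: "integrable lborel (\<lambda>\<xi>. (h 0 \<xi> * fourier ?b \<xi>) * cis (2 * pi * (x \<bullet> \<xi>)))" "integrable lborel (\<lambda>\<xi>. h 1 \<xi> * cis (2 * pi * (x \<bullet> \<xi>)))"
        by (intro integrable_mult_cis hb h; simp)+
      have "(LINT \<xi>|lborel. H \<xi> * cis (2 * pi * (x \<bullet> \<xi>))) = convolution b (F 0) x - F 1 x"
        unfolding H_def left_diff_distrib Bochner_Integration.integral_diff[OF i] conv[symmetric]
        by (simp only: F_def)
      also have "F 1 = truncated_riesz k P 1 ?g" by (simp add: RF)
      also have "convolution b (F 0) x = convolution b G x"
        by (rule convolution_cong_AE[symmetric]) (use ae in auto)
      finally show ?case using elim by simp
    qed
  qed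
  then have eq: "h 0 \<xi>0 * fourier ?b \<xi>0 = h 1 \<xi>0" by (simp add: H_def)
  \<comment> \<open>The common factor of h 0 and h 1 at \<xi>0. It is nonzero by the choice of a and
    a', so it cancels and only c and c - n are left to compare.\<close>
  define K where "K = of_real (riesz_const k DIM('a)) * (riesz_multiplier_const k DIM('a) * (complex_linear a a' \<xi>0 / of_real (2 * pi * norm \<xi>0)) ^ k) * ?g \<xi>0"
  have K0: "K \<noteq> 0"
    using riesz_const_pos[OF k, of "DIM('a)"] za \<xi>0 half_moment_pos[of "2 * k + DIM('a) - 1"]
    by (simp add: K_def riesz_multiplier_const_def)
  have "h 0 \<xi>0 = K * of_real c" "h 1 \<xi>0 = K * of_real (c - ?n (2 * pi * norm \<xi>0))"
    by (simp_all add: h_def riesz_multiplier_def K_def mult_ac)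
  then have "K * (of_real c * fourier ?b \<xi>0) = K * of_real (c - ?n (2 * pi * norm \<xi>0))" using eq by (simp add: mult.assoc)
  then have "of_real c * fourier ?b \<xi>0 = of_real (c - ?n (2 * pi * norm \<xi>0))" using K0 by (simp only: mult_cancel_left) simp
  then have "c * norm (fourier ?b \<xi>0) = \<bar>c - ?n (2 * pi * norm \<xi>0)\<bar>"
    using c0 by (metis norm_mult norm_of_real abs_of_pos)
  also have "\<dots> \<le> c * 1" using c(2)[of "2 * pi * norm \<xi>0"] \<xi>0 by simp
  finally show ?thesis using c0 by (simp only: mult_le_cancel_left_pos)
qed

theorem theorem1p3:
  fixes k :: nat and b :: "'a::euclidean_space \<Rightarrow> real"
  assumes "k > 0"
    and "DIM('a) \<ge> 2 \<or> (DIM('a) = 1 \<and> k = 1)"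
    and "riesz_factorization_kernel k b"
  shows "(\<forall>\<xi>. norm (fourier (\<lambda>x. of_real (b x)) \<xi>) \<le> 1) \<and>
    (\<forall>f\<in>L2. convolution b f \<in> L2 \<and> L2_norm (convolution b f) \<le> L2_norm f) \<and>
    (\<forall>P\<in>(spherical_harmonics k :: ('a \<Rightarrow> complex) set). \<forall>t>0. \<forall>f\<in>L2.
       truncated_riesz k P t f \<in> L2 \<and>
       L2_norm (truncated_riesz k P t f) \<le> L2_norm (riesz_transform k P f))"
proof -
  have b: "integrable lborel b" using assms(3) by (simp add: riesz_factorization_kernel_def)
  have le1: "norm (fourier (\<lambda>x. of_real (b x)) \<xi>) \<le> 1" for \<xi>
  proof (cases "\<xi> = 0")
    case True
    \<comment> \<open>The multiplier gives no information at the origin; the bound extends to it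
      because the transform of the integrable function b is continuous.\<close>
    have "(fourier (\<lambda>x. of_real (b x)) \<longlongrightarrow> fourier (\<lambda>x. of_real (b x)) 0) (at (0 :: 'a))"
      using isCont_fourier[of "\<lambda>x. of_real (b x)" 0] b by (simp add: isCont_def)
    then have "norm (fourier (\<lambda>x. of_real (b x)) (0 :: 'a)) \<le> 1"
    proof (rule tendsto_upperbound[OF tendsto_norm])
      show "\<forall>\<^sub>F \<xi> in at (0 :: 'a). norm (fourier (\<lambda>x. of_real (b x)) \<xi>) \<le> 1"
        using fourier_riesz_factorization_kernel_le_1[OF assms] by (auto simp: eventually_at_filter)
    qed simp
    then show ?thesis using True by simp
  qed (rule fourier_riesz_factorization_kernel_le_1[OF assms])
  show ?thesis
    using le1 convolution_contraction[OF b le1] truncated_riesz_le_riesz_transform[OF assms(3) le1] by blast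
qed

end
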